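(* Let $Z\subseteq\mathrm{Proj}(\mathbb{C}[X_0,X_1,X_2])$ be a finite set of points and suppose $Z$ admits unexpected curves in some degree. If $Q=(A_0:A_1:A_2)$ is the generic point, then $I^{\gg}_Q(Z)$ is a free $\mathcal{F}_Q$-module on generators $f$ and $g$ with $\deg f<\deg g-1$, and $f$ can be lifted to an element $F$ of $I^{\gg}(Z)$ with $\varepsilon_Q(F)=f$. In particular, $f$ can be written as $$f=X_0f_0+X_1f_1+X_2f_2,$$ where each $f_i$ is a polynomial of degree $(\deg f)-1$ in the maximal minors of $\begin{bmatrix} A_0 & A_1 & A_2 \\ X_0 & X_1 & X_2 \end{bmatrix}$.
   Context: $Z$ admits unexpected curves in degree $d$ if, for a general point $P\in\mathbb{P}^2_{\mathbb{C}}$, $\dim[I(Z)\cap I(P)^{d-1}]_d>\max\{0,\dim[I(Z)]_d-\dim[R/I(P)^{d-1}]_d\}$, where $R=\mathbb{C}[X_0,X_1,X_2]$. Generic point: let $\mathbb{F}=\mathbb{C}(A_0,A_1,A_2)$ with $A_0,A_1,A_2$ indeterminates, and regard $Q=(A_0:A_1:A_2)$ as a point of $\mathbb{P}^2_{\mathbb{F}}=\mathrm{Proj}(\mathbb{F}[X_0,X_1,X_2])$. $\mathcal{F}_Q=\mathrm{Sym}_{\mathbb{F}}([I(Q)]_1)\subseteq\mathbb{F}[X_0,X_1,X_2]$ is the polynomial ring over $\mathbb{F}$ generated by the linear forms (in the $X_i$) vanishing at $Q$. $I^{\gg}_Q(Z)$ is the graded $\mathcal{F}_Q$-module with $[I^{\gg}_Q(Z)]_d=[I(Z)\cap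 I(Q)^{d-1}]_d$ (ideals extended to $\mathbb{F}[X_0,X_1,X_2]$); degrees of $f$ and $g$ are degrees in the $X_i$. The module $I^{\gg}(Z)$: let $M_0,M_1,M_2\in\mathbb{C}[X_0,X_1,X_2,A_0,A_1,A_2]$ be the signed maximal minors of $\begin{bmatrix} X_0 & X_1 & X_2 \\ A_0 & A_1 & A_2 \end{bmatrix}$, where $M_i$ is the determinant of the $3\times3$ matrix whose first row is the $i$-th standard basis vector (indexed from $0$) and whose other rows are $(X_0,X_1,X_2)$ and $(A_0,A_1,A_2)$. Let $\mathfrak{m}^{\gg}$ be the $\mathbb{C}[M_0,M_1,M_2]$-submodule of $\mathbb{C}[X_0,X_1,X_2,A_0,A_1,A_2]$ generated by $X_0,X_1,X_2$, graded with $\deg M_i=\deg X_i=1$. Then $I^{\gg}(Z)=\big(I(Z)\cdot\mathbb{C}[X_0,X_1,X_2,A_0,A_1,A_2]\big)\cap\mathfrak{m}^{\gg}$. $\varepsilon_Q$ is the inclusion $\mathbb{C}[X_0,X_1,X_2,A_0,A_1,A_2]\to\mathbb{F}[X_0,X_1,X_2]$. *)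

theory Defs
  imports
    "HOL-Analysis.Analysis"
    "HOL-Library.Poly_Mapping"
    "HOL-Computational_Algebra.Fraction_Field"
begin

text \<open>
  The three variables are indexed by \<^typ>\<open>3\<close>, whose elements are \<open>0\<close>, \<open>1\<close>, \<open>2\<close>. A vector over
  \<open>k\<close> with this index type is a triple of homogeneous coordinates.
\<close>

type_synonym 'k poly3 = "(3 \<Rightarrow>\<^sub>0 nat) \<Rightarrow>\<^sub>0 'k"

text \<open>
  The rings used below are \<open>complex poly3\<close>, the ring \<open>\<complex>[X\<^sub>0,X\<^sub>1,X\<^sub>2]\<close> (or \<open>\<complex>[A\<^sub>0,A\<^sub>1,A\<^sub>2]\<close>);
  \<open>func poly3\<close>, the ring \<open>\<F>[X\<^sub>0,X\<^sub>1,X\<^sub>2]\<close>; and \<open>biring\<close>, the ring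
  \<open>\<complex>[X\<^sub>0,X\<^sub>1,X\<^sub>2,A\<^sub>0,A\<^sub>1,A\<^sub>2]\<close>, built as \<open>\<complex>[A\<^sub>0,A\<^sub>1,A\<^sub>2][X\<^sub>0,X\<^sub>1,X\<^sub>2]\<close>, so that the degree of an
  element is its degree in the \<open>X\<^sub>i\<close>.
\<close>

type_synonym func = "complex poly3 fract"
type_synonym biring = "complex poly3 poly3"

section \<open>Polynomials in three variables\<close>

definition cst :: "'k::comm_ring_1 \<Rightarrow> 'k poly3" where
  "cst c = Poly_Mapping.single 0 c"

definition var :: "3 \<Rightarrow> 'k::comm_ring_1 poly3" where
  "var i = Poly_Mapping.single (Poly_Mapping.single i 1) 1"

definition forms :: "nat \<Rightarrow> 'k::comm_ring_1 poly3 set" where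
  "forms d = {p. \<forall>m\<in>Poly_Mapping.keys p. (\<Sum>i\<in>UNIV. Poly_Mapping.lookup m i) = d}"

text \<open>Evaluation at a vector of ring elements, the coefficients being mapped by \<open>\<phi>\<close>.\<close>

definition poly_eval ::
    "('k::comm_ring_1 \<Rightarrow> 'r::comm_ring_1) \<Rightarrow> 'r^3 \<Rightarrow> 'k poly3 \<Rightarrow> 'r" where
  "poly_eval \<phi> v p =
     (\<Sum>m\<in>Poly_Mapping.keys p.
        \<phi> (Poly_Mapping.lookup p m) * (\<Prod>i\<in>UNIV. (v $ i) ^ Poly_Mapping.lookup m i))"

definition pscale :: "'k::field \<Rightarrow> 'k poly3 \<Rightarrow> 'k poly3" where
  "pscale c p = cst c * p"

global_interpretation pvs: vector_space pscale
  by unfold_locales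
    (simp_all add: pscale_def cst_def algebra_simps single_add mult_single
      flip: mult.assoc)

text \<open>
  The dimension of \<open>V / W\<close>: the size of a finite set of representatives in \<open>V\<close> of a basis of
  \<open>V / W\<close>.
\<close>

definition quotient_basis ::
    "'k::field poly3 set \<Rightarrow> 'k poly3 set \<Rightarrow> 'k poly3 set \<Rightarrow> bool" where
  "quotient_basis V W B \<longleftrightarrow> finite B \<and> B \<subseteq> V \<and>
     (\<forall>v\<in>V. \<exists>!c. (\<forall>b. b \<notin> B \<longrightarrow> c b = 0) \<and> v - (\<Sum>b\<in>B. pscale (c b) b) \<in> W)"

definition quotient_dim :: "'k::field poly3 set \<Rightarrow> 'k poly3 set \<Rightarrow> nat" where
  "quotient_dim V W = (THE n. \<exists>B. quotient_basis V W B \<and> card B = n)"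

section \<open>Ideals and subrings\<close>

text \<open>\<open>ideal.span S\<close> is the ideal generated by \<open>S\<close>.\<close>

global_interpretation ideal: module "(*) :: 'a::comm_ring_1 \<Rightarrow> 'a \<Rightarrow> 'a"
  by unfold_locales (simp_all add: algebra_simps)

primrec ideal_power :: "'a::comm_ring_1 set \<Rightarrow> nat \<Rightarrow> 'a set" where
  "ideal_power I 0 = UNIV"
| "ideal_power I (Suc n) = ideal.span {x * y | x y. x \<in> I \<and> y \<in> ideal_power I n}"

definition extend_ideal ::
    "('k::comm_ring_1 \<Rightarrow> 'l::comm_ring_1) \<Rightarrow> 'k poly3 set \<Rightarrow> 'l poly3 set" where
  "extend_ideal \<phi> I = ideal.span (Poly_Mapping.map \<phi> ` I)"

inductive_set generated_subring :: "'a::comm_ring_1 set \<Rightarrow> 'a set" for S where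
  base: "x \<in> S \<Longrightarrow> x \<in> generated_subring S"
| one: "1 \<in> generated_subring S"
| diff: "x \<in> generated_subring S \<Longrightarrow> y \<in> generated_subring S \<Longrightarrow> x - y \<in> generated_subring S"
| mult: "x \<in> generated_subring S \<Longrightarrow> y \<in> generated_subring S \<Longrightarrow> x * y \<in> generated_subring S"

text \<open>The \<open>A\<close>-submodule \<open>N\<close> is free with basis \<open>f, g\<close> (\<open>A\<close> a subring of the ambient ring).\<close>

definition free_on_two :: "'a::comm_ring_1 set \<Rightarrow> 'a set \<Rightarrow> 'a \<Rightarrow> 'a \<Rightarrow> bool" where
  "free_on_two A N f g \<longleftrightarrow>
     N = {r * f + s * g | r s. r \<in> A \<and> s \<in> A} \<and>
     (\<forall>r\<in>A. \<forall>s\<in>A. r * f + s * g = 0 \<longrightarrow> r = 0 \<and> s = 0)"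

section \<open>Points of the projective plane\<close>

text \<open>Points are one-dimensional subspaces of the three-dimensional coordinate space.\<close>

definition proj_point :: "'k::field^3 \<Rightarrow> ('k^3) set" where
  "proj_point v = vec.span {v}"

definition proj_plane :: "('k::field^3) set set" where
  "proj_plane = {proj_point v | v. v \<noteq> 0}"

definition vanishes_at :: "'k::field poly3 \<Rightarrow> ('k^3) set \<Rightarrow> bool" where
  "vanishes_at p P \<longleftrightarrow> (\<forall>v\<in>P. poly_eval id v p = 0)"

definition vanishing_ideal :: "('k::field^3) set set \<Rightarrow> 'k poly3 set" where
  "vanishing_ideal Z = ideal.span {p. (\<exists>d. p \<in> forms d) \<and> (\<forall>P\<in>Z. vanishes_at p P)}"

definition zariski_closed :: "('k::field^3) set set \<Rightarrow> bool" where
  "zariski_closed W \<longleftrightarrow>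
     (\<exists>T. (\<forall>p\<in>T. \<exists>d. p \<in> forms d) \<and> W = {P \<in> proj_plane. \<forall>p\<in>T. vanishes_at p P})"

text \<open>A property of a general point: it holds on a nonempty Zariski-open set.\<close>

definition for_general_point :: "(('k::field^3) set \<Rightarrow> bool) \<Rightarrow> bool" where
  "for_general_point \<Phi> \<longleftrightarrow>
     (\<exists>W. zariski_closed W \<and> W \<noteq> proj_plane \<and> (\<forall>P \<in> proj_plane - W. \<Phi> P))"

definition admits_unexpected_curves :: "(complex^3) set set \<Rightarrow> nat \<Rightarrow> bool" where
  "admits_unexpected_curves Z d \<longleftrightarrow> 1 \<le> d \<and>
     for_general_point (\<lambda>P.
       int (pvs.dim (vanishing_ideal Z \<inter> ideal_power (vanishing_ideal {P}) (d - 1) \<inter> forms d))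
       > max 0 (int (pvs.dim (vanishing_ideal Z \<inter> forms d))
                - int (quotient_dim (forms d)
                        (ideal_power (vanishing_ideal {P}) (d - 1) \<inter> forms d))))"

section \<open>The generic point\<close>

definition generic_point :: "(func^3) set" where
  "generic_point = proj_point (\<chi> i. Fract (var i) 1)"

text \<open>\<open>\<F>\<^sub>Q\<close>, as the \<open>\<F>\<close>-subalgebra generated by the linear forms vanishing at \<open>Q\<close>.\<close>

definition F_Q :: "func poly3 set" where
  "F_Q = generated_subring (range cst \<union> (vanishing_ideal {generic_point} \<inter> forms 1))"

text \<open>
  The internal direct sum of its homogeneous components inside \<open>\<F>[X\<^sub>0,X\<^sub>1,X\<^sub>2]\<close>. For \<open>d = 0\<close> the
  truncated exponent amounts to reading \<open>I(Q)\<^bsup>-1\<^esup>\<close> as the unit ideal.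
\<close>

definition I_gg_Q :: "(complex^3) set set \<Rightarrow> func poly3 set" where
  "I_gg_Q Z = pvs.span
     (\<Union>d. extend_ideal (\<lambda>c. Fract (cst c) 1) (vanishing_ideal Z)
           \<inter> ideal_power (vanishing_ideal {generic_point}) (d - 1) \<inter> forms d)"

section \<open>The module over the signed minors\<close>

definition X_vec :: "biring^3" where
  "X_vec = (\<chi> i. var i)"

definition A_vec :: "biring^3" where
  "A_vec = (\<chi> i. cst (var i))"

text \<open>In the index type \<^typ>\<open>3\<close> the rows are numbered \<open>0\<close>, \<open>1\<close>, \<open>2\<close> from top to bottom.\<close>

definition signed_minor :: "3 \<Rightarrow> biring" where
  "signed_minor i = det (\<chi> r. if r = 0 then axis i 1 else if r = 1 then X_vec else A_vec)"

definition m_gg :: "biring set" where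
  "m_gg = {\<Sum>i\<in>UNIV. r i * var i | r.
             \<forall>i. r i \<in> generated_subring (range (\<lambda>c. cst (cst c)) \<union> range signed_minor)}"

definition I_gg :: "(complex^3) set set \<Rightarrow> biring set" where
  "I_gg Z = extend_ideal cst (vanishing_ideal Z) \<inter> m_gg"

definition eps_Q :: "biring \<Rightarrow> func poly3" where
  "eps_Q = Poly_Mapping.map (\<lambda>a. Fract a 1)"

text \<open>The maximal minor, obtained by deleting column \<open>i\<close>, of the matrix with rows \<open>u\<close> and \<open>v\<close>.\<close>

definition maximal_minor :: "'a::comm_ring_1^3 \<Rightarrow> 'a^3 \<Rightarrow> 3 \<Rightarrow> 'a" where
  "maximal_minor u v i =
     (if i = 0 then u $ 1 * v $ 2 - u $ 2 * v $ 1
      else if i = 1 then u $ 0 * v $ 2 - u $ 2 * v $ 0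
      else u $ 0 * v $ 1 - u $ 1 * v $ 0)"

end

theory Submission
  imports Defs
    "HOL-Computational_Algebra.Polynomial_Factorial"
    "HOL-Computational_Algebra.Field_as_Ring"
begin

text \<open>
  Write \<open>\<partial>\<close> for the derivative along \<open>Q\<close> in the variables \<open>X\<^sub>i\<close>. Then \<open>\<F>\<^sub>Q\<close> is the kernel of \<open>\<partial>\<close>, and a form of
  degree \<open>d\<close> lies in \<open>I(Q)\<^bsup>d - 1\<^esup>\<close> iff it is killed by \<open>\<partial>\<^bsup>2\<^esup>\<close>. Adding the points of \<open>Z\<close> one at a time shows
  that the module is free on generators of degrees \<open>a \<le> b\<close> with \<open>a + b = |Z| + 1\<close>, over every field of
  characteristic zero and for every point \<open>Q\<close> in general position. Counting dimensions, an
  unexpected curve of degree \<open>d\<close> forces \<open>a \<le> d < b - 1\<close> at a general complex point; the generators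
  at the generic point stay independent after a general specialization, hence \<open>a < b - 1\<close> there too.

  Let \<open>F\<close> be a multiple of \<open>f\<close> with coefficients in \<open>\<complex>[A\<^sub>0,A\<^sub>1,A\<^sub>2]\<close>, homogeneous of least possible degree \<open>e\<close>
  in the \<open>A\<^sub>i\<close>, and let \<open>D = \<Sum> X\<^sub>i \<partial>/\<partial>A\<^sub>i\<close>. Up to the correction term \<open>(e + 1 - a) X\<^sub>0 F / A\<^sub>0\<close>, the
  polynomial \<open>D F\<close> lies in the module in degree \<open>a + 1 < b\<close>, so it is a rational multiple of \<open>F\<close>. By
  Gauss's lemma the factor is a polynomial, and comparing degrees in the \<open>A\<^sub>i\<close> gives \<open>D F = 0\<close> and
  \<open>e = a - 1\<close>. Capelli's identity then writes \<open>F\<close> as \<open>\<Sum> X\<^sub>i h\<^sub>i\<close> with forms \<open>h\<^sub>i\<close> in the minors.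
\<close>

text \<open>For the interpretation \<open>ideal\<close> this simplification rule reads \<open>a * (b * x) = a * b * x\<close> and loops with \<open>mult.assoc\<close>.\<close>

declare ideal.scale_scale [simp del]

text \<open>The hypothesis speaks of complex points, the conclusion of a point over the function
  field. The bases are therefore built over any field of characteristic zero, once at a suitable
  complex point and once at Q. Freeness need not survive specialization, so the two are compared
  through a determinant that makes sense on both sides. It only shows that the smaller degree at Q
  is at most the one at the complex point, but as both pairs of degrees have the same sum, this
  carries the gap over. The gap matters because an element of degree a + 1 then cannot involve g.
  The constant e + 1 - a is forced: applying \<partial> twice to D F gives 2 (e + 1 - a) \<partial>
  F, and applying it twice to X_0 F gives 2 A_0 \<partial> F. Once D F = 0, only the correction term
  is left; it has to be F times a constant of \<partial>, and X_0 is not one, so its coefficient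
  vanishes and e = a - 1.\<close>

locale comm_hom =
  fixes h :: "'a::comm_ring_1 \<Rightarrow> 'b::comm_ring_1"
  assumes one: "h 1 = 1"
    and add: "h (x + y) = h x + h y"
    and mult: "h (x * y) = h x * h y"
begin

lemma zero: "h 0 = 0"
  using add[of 0 0] by simp

lemma uminus: "h (- x) = - h x"
  using add[of x "- x"] zero by (simp add: eq_neg_iff_add_eq_0 add.commute)

lemma diff: "h (x - y) = h x - h y"
  using add[of x "- y"] uminus by simp

lemma power: "h (x ^ n) = h x ^ n"
  by (induction n) (simp_all add: one mult)

lemma sum: "h (sum f A) = (\<Sum>x\<in>A. h (f x))"
  by (induction A rule: infinite_finite_induct) (simp_all add: zero add)

lemma prod: "h (prod f A) = (\<Prod>x\<in>A. h (f x))"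
  by (induction A rule: infinite_finite_induct) (simp_all add: one mult)

lemma of_nat: "h (of_nat n) = of_nat n"
  by (induction n) (simp_all add: zero one add)

lemmas simps = zero one add mult uminus diff power sum prod of_nat

end

lemma comm_hom_id: "comm_hom id"
  by unfold_locales auto

lemma comm_hom_comp: "comm_hom f \<Longrightarrow> comm_hom g \<Longrightarrow> comm_hom (\<lambda>x. f (g x))"
  by (simp add: comm_hom_def)

text \<open>In the type \<open>3\<close> the numeral 3 equals 0, which turns \<open>UNIV_3\<close>
  into the numbering of the coordinates used here.\<close>

lemma UNIV_3_from_0: "(UNIV :: 3 set) = {0, 1, 2}"
proof -
  have "(3::3) = 0" by simp
  then show ?thesis using UNIV_3 by auto
qed

lemma sum_3_from_0: "sum f (UNIV :: 3 set) = f 0 + f 1 + f 2"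
  unfolding UNIV_3_from_0 by (simp add: ac_simps)

lemma prod_3_from_0: "prod f (UNIV :: 3 set) = f 0 * f 1 * f 2"
  unfolding UNIV_3_from_0 by (simp add: ac_simps)

lemma forall_3_from_0: "(\<forall>i::3. P i) \<longleftrightarrow> P 0 \<and> P 1 \<and> P 2"
  using UNIV_3_from_0 by (metis UNIV_I empty_iff insert_iff)

lemma exhaust_3_from_0: fixes i :: 3 obtains "i = 0" | "i = 1" | "i = 2"
  using UNIV_3_from_0 by blast

section \<open>Polynomials in three variables\<close>

lemma sum_singles:
  "(\<Sum>m\<in>Poly_Mapping.keys p. Poly_Mapping.single m (Poly_Mapping.lookup p m)) = p"
  by (rule poly_mapping_eqI) (simp add: lookup_sum lookup_single when_def in_keys_iff)

lemma poly3_add_induct [case_names single add]: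
  assumes s: "\<And>m c. P (Poly_Mapping.single m c)"
    and a: "\<And>p q. P p \<Longrightarrow> P q \<Longrightarrow> P (p + q)"
  shows "P (p :: 'k::comm_ring_1 poly3)"
proof -
  have "P (\<Sum>m\<in>A. Poly_Mapping.single m (Poly_Mapping.lookup p m))" if "finite A" for A
    using that
  proof (induction A rule: finite_induct)
    case empty
    show ?case using s[of 0 0] by simp
  next
    case (insert x F)
    then show ?case by (simp add: a s)
  qed
  then show ?thesis
    using finite_keys[of p] sum_singles[of p] by metis
qed

lemma cst_0 [simp]: "cst 0 = 0" and cst_1 [simp]: "cst 1 = 1"
  by (simp_all add: cst_def)

lemma comm_hom_cst: "comm_hom cst"
  by unfold_locales (simp_all add: cst_def single_add mult_single)

lemmas cst_simps = comm_hom.simps[OF comm_hom_cst]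

lemma lookup_cst_mult [simp]:
  "Poly_Mapping.lookup (cst c * p) m = c * Poly_Mapping.lookup p m"
proof (induction p rule: poly3_add_induct)
  case (single n d)
  then show ?case by (simp add: cst_def mult_single lookup_single when_def)
qed (simp add: algebra_simps lookup_add)

lemma var_nonzero: "(var i :: 'k::comm_ring_1 poly3) \<noteq> 0"
  by (metis lookup_single_eq lookup_zero one_neq_zero var_def)

lemma var_power: "var i ^ n = Poly_Mapping.single (Poly_Mapping.single i n) 1"
  by (induction n) (simp_all add: var_def mult_single flip: single_add)


lemma sum_single_lookup:
  "(\<Sum>i\<in>UNIV. Poly_Mapping.single i (Poly_Mapping.lookup m i)) = (m :: 3 \<Rightarrow>\<^sub>0 nat)"
  by (rule poly_mapping_eqI) (simp add: lookup_sum lookup_single when_def)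

lemma prod_single_1:
  "finite A \<Longrightarrow> (\<Prod>i\<in>A. Poly_Mapping.single (f i) (1 :: 'k::comm_ring_1)) = Poly_Mapping.single (\<Sum>i\<in>A. f i) 1"
  by (induction A rule: finite_induct) (simp_all add: mult_single)

lemma single_conv_var:
  "Poly_Mapping.single (m :: 3 \<Rightarrow>\<^sub>0 nat) (c :: 'k::comm_ring_1)
     = cst c * (\<Prod>i\<in>UNIV. var i ^ Poly_Mapping.lookup m i)"
  by (simp add: var_power prod_single_1 sum_single_lookup) (simp add: cst_def mult_single)

lemma poly3_induct [case_names cst var add mult]:
  assumes c: "\<And>c. P (cst c)" and v: "\<And>i. P (var i)"
    and a: "\<And>p q. P p \<Longrightarrow> P q \<Longrightarrow> P (p + q)"
    and m: "\<And>p q. P p \<Longrightarrow> P q \<Longrightarrow> P (p * q)"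
  shows "P (p :: 'k::comm_ring_1 poly3)"
proof (induction p rule: poly3_add_induct)
  case (single n c)
  have "P (var i ^ k)" for i k
    by (induction k) (use c[of 1] v m in auto)
  then show ?case
    by (simp add: single_conv_var prod_3_from_0 c m)
qed (rule a)

lemma comm_hom_ext:
  assumes "comm_hom f" "comm_hom g" "\<And>c. f (cst c) = g (cst c)" "\<And>i. f (var i) = g (var i)"
  shows "f p = g p"
  by (induction p rule: poly3_induct) (simp_all add: assms comm_hom.simps[OF assms(1)] comm_hom.simps[OF assms(2)])

section \<open>Substitution and change of coefficients\<close>

lemma poly_eval_superset:
  assumes "finite S" "Poly_Mapping.keys p \<subseteq> S" "\<phi> 0 = 0"
  shows "poly_eval \<phi> v p = (\<Sum>m\<in>S. \<phi> (Poly_Mapping.lookup p m) * (\<Prod>i\<in>UNIV. (v $ i) ^ Poly_Mapping.lookup m i))"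
  unfolding poly_eval_def
  by (rule sum.mono_neutral_left) (use assms in \<open>auto simp: in_keys_iff\<close>)

context comm_hom
begin

lemma poly_eval_single:
  "poly_eval h v (Poly_Mapping.single m c) = h c * (\<Prod>i\<in>UNIV. (v $ i) ^ Poly_Mapping.lookup m i)"
  by (subst poly_eval_superset[where S = "{m}"]) (simp_all add: zero)

lemma poly_eval_add: "poly_eval h v (p + q) = poly_eval h v p + poly_eval h v q"
proof -
  let ?S = "Poly_Mapping.keys p \<union> Poly_Mapping.keys q"
  have *: "poly_eval h v r = (\<Sum>m\<in>?S. h (Poly_Mapping.lookup r m) * (\<Prod>i\<in>UNIV. (v $ i) ^ Poly_Mapping.lookup m i))"
    if "Poly_Mapping.keys r \<subseteq> ?S" for r
    by (rule poly_eval_superset) (use that zero in auto)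
  show ?thesis
    by (subst (1 2 3) *) (use keys_add[of p q] in \<open>auto simp: lookup_add add algebra_simps sum.distrib\<close>)
qed

lemma poly_eval_mult: "poly_eval h v (p * q) = poly_eval h v p * poly_eval h v q"
proof (induction p rule: poly3_add_induct)
  case (single m c)
  show ?case
  proof (induction q rule: poly3_add_induct)
    case (single n d)
    show ?case
      by (simp only: mult_single poly_eval_single lookup_add power_add prod.distrib mult mult_ac)
  qed (simp add: poly_eval_add distrib_left)
qed (simp add: poly_eval_add distrib_right)

lemma poly_eval_cst [simp]: "poly_eval h v (cst c) = h c"
  by (simp add: cst_def poly_eval_single)

lemma poly_eval_var [simp]: "poly_eval h v (var i) = v $ i"
proof -
  have "(\<Prod>j\<in>UNIV. (v $ j) ^ Poly_Mapping.lookup (Poly_Mapping.single i 1) j) = v $ i"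
    by (cases i rule: exhaust_3_from_0) (simp_all add: prod_3_from_0 lookup_single)
  then show ?thesis
    by (simp add: var_def poly_eval_single one)
qed

lemma comm_hom_poly_eval: "comm_hom (poly_eval h v)"
  by unfold_locales (use poly_eval_cst[of v 1] in \<open>simp_all add: one poly_eval_add poly_eval_mult\<close>)

lemmas poly_eval_simps = comm_hom.simps[OF comm_hom_poly_eval] poly_eval_cst poly_eval_var

lemma lookup_map_hom [simp]: "Poly_Mapping.lookup (Poly_Mapping.map h p) m = h (Poly_Mapping.lookup p m)"
  by (simp add: map.rep_eq when_def zero)

lemma map_add: "Poly_Mapping.map h (p + q) = Poly_Mapping.map h p + Poly_Mapping.map h q"
  by (rule poly_mapping_eqI) (simp add: lookup_add add)

lemma map_single: "Poly_Mapping.map h (Poly_Mapping.single m c) = Poly_Mapping.single m (h c)"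
  by (rule poly_mapping_eqI) (simp add: lookup_single when_def zero)

lemma map_mult:
  "Poly_Mapping.map h (p * q) = Poly_Mapping.map h p * Poly_Mapping.map h (q :: 'a poly3)"
proof (induction p rule: poly3_add_induct)
  case (single m c)
  show ?case
    by (induction q rule: poly3_add_induct) (simp_all add: map_single mult_single mult map_add algebra_simps)
qed (simp add: map_add algebra_simps)

lemma map_cst [simp]: "Poly_Mapping.map h (cst c) = cst (h c)"
  by (simp add: cst_def map_single)

lemma map_var [simp]: "Poly_Mapping.map h (var i) = var i"
  by (simp add: var_def map_single one)

lemma comm_hom_map: "comm_hom (Poly_Mapping.map h :: 'a poly3 \<Rightarrow> 'b poly3)"
  by unfold_locales (use map_cst[of 1] in \<open>simp_all add: one map_add map_mult\<close>)

lemmas map_simps = comm_hom.simps[OF comm_hom_map] map_cst map_var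

end

section \<open>Partial derivatives\<close>

text \<open>If the exponent of \<open>i\<close> is 0, the truncated subtraction leaves the monomial
  unchanged, but its coefficient is then 0.\<close>

definition pd :: "3 \<Rightarrow> 'k::comm_ring_1 poly3 \<Rightarrow> 'k poly3" where
  "pd i p = (\<Sum>m\<in>Poly_Mapping.keys p.
     Poly_Mapping.single (m - Poly_Mapping.single i 1) (of_nat (Poly_Mapping.lookup m i) * Poly_Mapping.lookup p m))"

lemma pd_superset:
  assumes "finite S" "Poly_Mapping.keys p \<subseteq> S"
  shows "pd i p = (\<Sum>m\<in>S.
     Poly_Mapping.single (m - Poly_Mapping.single i 1) (of_nat (Poly_Mapping.lookup m i) * Poly_Mapping.lookup p m))"
  unfolding pd_def
  by (rule sum.mono_neutral_left) (use assms in \<open>auto simp: in_keys_iff\<close>)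

lemma pd_add [simp]: "pd i (p + q) = pd i p + pd i q"
proof -
  let ?S = "Poly_Mapping.keys p \<union> Poly_Mapping.keys q"
  have *: "pd i r = (\<Sum>m\<in>?S.
     Poly_Mapping.single (m - Poly_Mapping.single i 1) (of_nat (Poly_Mapping.lookup m i) * Poly_Mapping.lookup r m))"
    if "Poly_Mapping.keys r \<subseteq> ?S" for r
    by (rule pd_superset) (use that in auto)
  show ?thesis
    by (subst (1 2 3) *) (use keys_add[of p q] in \<open>auto simp: lookup_add single_add algebra_simps sum.distrib\<close>)
qed

lemma pd_single:
  "pd i (Poly_Mapping.single m c) = Poly_Mapping.single (m - Poly_Mapping.single i 1) (of_nat (Poly_Mapping.lookup m i) * c)"
  by (subst pd_superset[where S = "{m}"]) simp_all

lemma lookup_pd: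
  "Poly_Mapping.lookup (pd i p) m
     = of_nat (Poly_Mapping.lookup m i + 1) * Poly_Mapping.lookup p (m + Poly_Mapping.single i 1)"
proof (induction p rule: poly3_add_induct)
  case (single n c)
  show ?case
  proof (cases "Poly_Mapping.lookup n i = 0")
    case True
    then have "n \<noteq> m + Poly_Mapping.single i 1"
      by (auto simp: lookup_add)
    with True show ?thesis by (simp add: pd_single lookup_single when_def)
  next
    case False
    then have n: "n = (n - Poly_Mapping.single i 1) + Poly_Mapping.single i 1"
      by (intro poly_mapping_eqI) (auto simp: lookup_add lookup_minus lookup_single when_def)
    have *: "n = m + Poly_Mapping.single i 1" if e: "n - Poly_Mapping.single i 1 = m"
      using n unfolding e .
    show ?thesis
    proof (cases "n = m + Poly_Mapping.single i 1")
      case True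
      then show ?thesis by (simp add: pd_single lookup_add)
    next
      case False
      with * have "n - Poly_Mapping.single i 1 \<noteq> m" by blast
      with False show ?thesis
        unfolding pd_single lookup_single by simp
    qed
  qed
qed (simp add: lookup_add algebra_simps)

lemma pd_mult: "pd i (p * q) = pd i p * q + p * pd i q"
proof (induction p rule: poly3_add_induct)
  case (single m c)
  show ?case
  proof (induction q rule: poly3_add_induct)
    case (single n d)
    \<comment> \<open>The monomials agree only if the exponent of \<open>i\<close> in
      \<open>a\<close> is positive. The assumption is made in the coefficient ring, since in the
      other case both sides of \<open>2\<close> have coefficient 0.\<close>
    have 1: "of_nat (Poly_Mapping.lookup a i) \<noteq> (0::'a) \<Longrightarrow> a + b - Poly_Mapping.single i (1::nat) = (a - Poly_Mapping.single i 1) + b" for a b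
    proof (rule poly_mapping_eqI)
      fix j
      assume "of_nat (Poly_Mapping.lookup a i) \<noteq> (0::'a)"
      then have "Poly_Mapping.lookup a i \<noteq> 0" by (metis of_nat_0)
      then show "Poly_Mapping.lookup (a + b - Poly_Mapping.single i 1) j = Poly_Mapping.lookup (a - Poly_Mapping.single i 1 + b) j"
        by (cases "i = j") (simp_all add: lookup_add lookup_minus lookup_single)
    qed
    have 2: "Poly_Mapping.single (a + b - Poly_Mapping.single i 1) (of_nat (Poly_Mapping.lookup a i) * (e * f))
        = Poly_Mapping.single (a - Poly_Mapping.single i 1) (of_nat (Poly_Mapping.lookup a i) * e) * Poly_Mapping.single b f" for a b and e f :: 'a
      by (cases "of_nat (Poly_Mapping.lookup a i) = (0::'a)")
        (simp, simp only: mult_single 1 mult.assoc not_False_eq_True)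
    have "pd i (Poly_Mapping.single m c * Poly_Mapping.single n d)
        = Poly_Mapping.single (m + n - Poly_Mapping.single i 1) (of_nat (Poly_Mapping.lookup m i) * (c * d))
        + Poly_Mapping.single (n + m - Poly_Mapping.single i 1) (of_nat (Poly_Mapping.lookup n i) * (d * c))"
      by (simp only: mult_single pd_single lookup_add of_nat_add distrib_right single_add mult.commute[of d c] add.commute[of n m])
    then show ?case
      unfolding 2 by (simp add: pd_single mult.commute)
  qed (simp add: algebra_simps)
qed (simp add: algebra_simps)

lemma pd_cst [simp]: "pd i (cst c) = 0"
  by (simp add: cst_def pd_single)

lemma pd_1 [simp]: "pd i 1 = 0"
  using pd_cst[of i 1] by simp

lemma pd_var: "pd i (var j) = (if i = j then 1 else 0)"
  by (simp add: var_def pd_single lookup_single when_def)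

lemma pd_commute: "pd i (pd j p) = pd j (pd i p)"
proof (rule poly_mapping_eqI)
  fix m
  have 1: "Poly_Mapping.lookup (pd a (pd b p)) m = of_nat (Poly_Mapping.lookup m a + 1)
      * (of_nat (Poly_Mapping.lookup m b + (1 when a = b) + 1)
      * Poly_Mapping.lookup p (m + Poly_Mapping.single a 1 + Poly_Mapping.single b 1))" for a b
    by (simp only: lookup_pd lookup_add lookup_single)
  have 2: "m + Poly_Mapping.single i 1 + Poly_Mapping.single j (1::nat)
      = m + Poly_Mapping.single j 1 + Poly_Mapping.single i 1"
    by (simp only: ac_simps)
  show "Poly_Mapping.lookup (pd i (pd j p)) m = Poly_Mapping.lookup (pd j (pd i p)) m"
  proof (cases "i = j")
    case False
    then have "((1::nat) when i = j) = 0" "((1::nat) when j = i) = 0"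
      by auto
    then show ?thesis
      unfolding 1 2 by (simp only: add_0_right mult.left_commute)
  qed simp
qed

lemma pd_0 [simp]: "pd i 0 = 0"
  using pd_cst[of i 0] by simp

lemma pd_uminus [simp]: "pd i (- p) = - pd i p"
  using pd_add[of i p "- p"] by (simp add: eq_neg_iff_add_eq_0 add.commute)

lemma pd_diff [simp]: "pd i (p - q) = pd i p - pd i q"
  using pd_add[of i p "- q"] by simp

lemma (in comm_hom) map_pd: "Poly_Mapping.map h (pd i p) = pd i (Poly_Mapping.map h p)"
  by (rule poly_mapping_eqI) (simp add: lookup_pd simps)

section \<open>Derivation along a vector\<close>

definition dd :: "'k::comm_ring_1 ^ 3 \<Rightarrow> 'k poly3 \<Rightarrow> 'k poly3" where
  "dd v p = (\<Sum>i\<in>UNIV. cst (v $ i) * pd i p)"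

lemma dd_simps [simp]:
  "dd v (p + q) = dd v p + dd v q" "dd v (p - q) = dd v p - dd v q" "dd v (- p) = - dd v p"
  "dd v (cst c) = 0" "dd v 0 = 0" "dd v (var i) = cst (v $ i)"
  "dd v 1 = 0"
  by (simp_all add: dd_def algebra_simps sum.distrib sum_subtractf sum_negf pd_var if_distrib cong: if_cong)

lemma dd_mult: "dd v (p * q) = dd v p * q + p * dd v q"
  by (simp add: dd_def pd_mult sum_3_from_0 algebra_simps)

lemma dd_cst_mult [simp]: "dd v (cst c * p) = cst c * dd v p"
  by (simp add: dd_mult)

lemma dd_power: "dd v (p ^ n) = of_nat n * p ^ (n - 1) * dd v p"
proof (induction n)
  case (Suc n)
  then show ?case by (cases n) (simp_all add: dd_mult algebra_simps)
qed simp

lemma dd_sum: "dd v (sum f A) = (\<Sum>x\<in>A. dd v (f x))"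
  by (induction A rule: infinite_finite_induct) simp_all

lemma (in comm_hom) map_dd: "Poly_Mapping.map h (dd v p) = dd (\<chi> i. h (v $ i)) (Poly_Mapping.map h p)"
  by (simp add: dd_def map_simps map_pd)

section \<open>Forms\<close>

abbreviation tdeg :: "(3 \<Rightarrow>\<^sub>0 nat) \<Rightarrow> nat" where
  "tdeg m \<equiv> \<Sum>i\<in>UNIV. Poly_Mapping.lookup m i"

lemma forms_iff: "p \<in> forms d \<longleftrightarrow> (\<forall>m. Poly_Mapping.lookup p m \<noteq> 0 \<longrightarrow> tdeg m = d)"
  by (auto simp: forms_def in_keys_iff)

lemma forms_0 [simp]: "0 \<in> forms d"
  by (simp add: forms_iff)

lemma forms_add: "p \<in> forms d \<Longrightarrow> q \<in> forms d \<Longrightarrow> p + q \<in> forms d"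
  unfolding forms_iff lookup_add by (metis add_0)

lemma forms_uminus: "p \<in> forms d \<Longrightarrow> - p \<in> forms d"
  by (simp add: forms_iff)

lemma forms_diff: "p \<in> forms d \<Longrightarrow> q \<in> forms d \<Longrightarrow> p - q \<in> forms d"
  using forms_add[of p d "- q"] forms_uminus by auto

lemma forms_sum: "(\<And>x. x \<in> A \<Longrightarrow> f x \<in> forms d) \<Longrightarrow> sum f A \<in> forms d"
  by (induction A rule: infinite_finite_induct) (auto intro: forms_add)

lemma forms_single: "Poly_Mapping.single m c \<in> forms d \<longleftrightarrow> c = 0 \<or> tdeg m = d"
  by (auto simp: forms_iff lookup_single when_def)

lemma forms_cst: "cst c \<in> forms 0"
  by (simp add: cst_def forms_single)

lemma forms_1: "1 \<in> forms 0"
  using forms_cst[of 1] by simp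

lemma forms_var: "var i \<in> forms 1"
  by (cases i rule: exhaust_3_from_0) (simp_all add: var_def forms_single sum_3_from_0 lookup_single)

lemma forms_mult:
  assumes "p \<in> forms d" "q \<in> forms e"
  shows "p * q \<in> forms (d + e)"
proof -
  have "p * q = (\<Sum>m\<in>Poly_Mapping.keys p. \<Sum>n\<in>Poly_Mapping.keys q.
     Poly_Mapping.single (m + n) (Poly_Mapping.lookup p m * Poly_Mapping.lookup q n))"
    by (subst sum_singles[of p, symmetric], subst sum_singles[of q, symmetric]) (simp add: sum_product mult_single)
  also have "\<dots> \<in> forms (d + e)"
    using assms by (intro forms_sum) (auto simp: forms_single forms_def lookup_add sum.distrib)
  finally show ?thesis .
qed

lemma forms_cst_mult: "p \<in> forms d \<Longrightarrow> cst c * p \<in> forms d"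
  using forms_mult[OF forms_cst, of p d c] by simp

lemma forms_power: "p \<in> forms d \<Longrightarrow> p ^ k \<in> forms (k * d)"
  by (induction k) (auto simp: forms_1 intro: forms_mult)

text \<open>Induction along the grading: the degree is an argument of \<open>P\<close>, so that
  multiplication by a variable can raise it.\<close>

lemma forms_induct [consumes 1, case_names zero cst var add]:
  assumes "p \<in> forms d"
    and z: "\<And>k. P k 0" and c: "\<And>c. P 0 (cst c)"
    and v: "\<And>k q i. q \<in> forms k \<Longrightarrow> P k q \<Longrightarrow> P (Suc k) (var i * q)"
    and a: "\<And>k p q. p \<in> forms k \<Longrightarrow> q \<in> forms k \<Longrightarrow> P k p \<Longrightarrow> P k q \<Longrightarrow> P k (p + q)"
  shows "P d (p :: 'k::comm_ring_1 poly3)"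
proof -
  have *: "P (tdeg m) (Poly_Mapping.single m c)" for m c
  proof (induction "tdeg m" arbitrary: m)
    case 0
    then have "m = 0" by (intro poly_mapping_eqI) auto
    then show ?case using c by (simp add: cst_def)
  next
    case (Suc k)
    then obtain i where i: "Poly_Mapping.lookup m i \<noteq> 0"
      by (metis (no_types, lifting) nat.distinct(1) sum.neutral)
    let ?n = "m - Poly_Mapping.single i 1"
    have m: "m = Poly_Mapping.single i 1 + ?n"
      using i by (intro poly_mapping_eqI) (auto simp: lookup_add lookup_minus lookup_single when_def)
    have "tdeg m = 1 + tdeg ?n"
      by (subst m) (cases i rule: exhaust_3_from_0, simp_all add: sum_3_from_0 lookup_add lookup_single)
    with Suc have "k = tdeg ?n" by simp
    from Suc(1)[OF this] have "P (Suc (tdeg ?n)) (var i * Poly_Mapping.single ?n c)"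
      by (intro v) (simp_all add: forms_single)
    moreover have "var i * Poly_Mapping.single ?n c = Poly_Mapping.single m c"
      by (subst (2) m) (simp add: var_def mult_single)
    ultimately show ?case using \<open>tdeg m = _\<close> by simp
  qed
  have "P d (\<Sum>m\<in>A. Poly_Mapping.single m (Poly_Mapping.lookup p m)) \<and>
      (\<Sum>m\<in>A. Poly_Mapping.single m (Poly_Mapping.lookup p m)) \<in> forms d" if "finite A" for A
    using that
  proof (induction A rule: finite_induct)
    case (insert m A)
    have f: "Poly_Mapping.single m (Poly_Mapping.lookup p m) \<in> forms d"
      using assms(1) unfolding forms_single by (auto simp: forms_iff)
    \<comment> \<open>A monomial with coefficient 0 may have a degree other than \<open>d\<close>;
      this is where the case \<open>zero\<close> for every degree is needed.\<close>
    have "P d (Poly_Mapping.single m (Poly_Mapping.lookup p m))"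
      using *[of m "Poly_Mapping.lookup p m"] assms(1) z by (cases "Poly_Mapping.lookup p m = 0") (auto simp: forms_iff)
    with insert f show ?case by (auto intro: a forms_add)
  qed (simp add: z)
  then show ?thesis
    using finite_keys[of p] sum_singles[of p] by metis
qed

lemma forms_zero_conv: "p \<in> forms 0 \<Longrightarrow> \<exists>c. p = cst c"
proof -
  assume p: "p \<in> forms 0"
  have "p = cst (Poly_Mapping.lookup p 0)"
  proof (rule poly_mapping_eqI)
    fix m :: "3 \<Rightarrow>\<^sub>0 nat"
    show "Poly_Mapping.lookup p m = Poly_Mapping.lookup (cst (Poly_Mapping.lookup p 0)) m"
    proof (cases "m = 0")
      case False
      then have "tdeg m \<noteq> 0" by (metis (no_types, lifting) UNIV_I finite lookup_zero poly_mapping_eqI sum_eq_0_iff)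
      with p False show ?thesis by (auto simp: forms_iff cst_def lookup_single when_def)
    qed (simp add: cst_def)
  qed
  then show ?thesis ..
qed

text \<open>For \<open>d = 0\<close> the truncated degree is harmless: the derivative is 0, a form
  of every degree.\<close>

lemma forms_pd: "p \<in> forms d \<Longrightarrow> pd i p \<in> forms (d - 1)"
proof (induction rule: forms_induct)
  case (var k q j)
  have "var j * pd i q \<in> forms k"
  proof (cases k)
    case 0
    with var forms_zero_conv show ?thesis by fastforce
  next
    case (Suc l)
    with var forms_mult[OF forms_var[of j], of "pd i q" l] show ?thesis by simp
  qed
  moreover have "pd i (var j) * q \<in> forms k"
    using var by (simp add: pd_var)
  ultimately show ?case
    by (simp add: pd_mult forms_add)
qed (auto intro: forms_add)

lemma forms_dd: "p \<in> forms d \<Longrightarrow> dd v p \<in> forms (d - 1)"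
  unfolding dd_def by (intro forms_sum forms_cst_mult forms_pd)

lemma euler: "p \<in> forms d \<Longrightarrow> (\<Sum>i\<in>UNIV. var i * pd i p) = of_nat d * p"
proof (induction rule: forms_induct)
  case (var k q j)
  have "(\<Sum>i\<in>UNIV. var i * pd i (var j * q)) = var j * q + var j * (\<Sum>i\<in>UNIV. var i * pd i q)"
    by (cases j rule: exhaust_3_from_0) (simp_all add: sum_3_from_0 pd_mult pd_var algebra_simps)
  with var show ?case by (simp add: algebra_simps)
qed (simp_all add: algebra_simps sum.distrib)

context comm_hom
begin

lemma poly_eval_scale: "p \<in> forms d \<Longrightarrow> poly_eval h (\<chi> i. c * v $ i) p = c ^ d * poly_eval h v p"
proof (induction rule: forms_induct)
qed (simp_all add: poly_eval_simps algebra_simps)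

lemma forms_map: "p \<in> forms d \<Longrightarrow> Poly_Mapping.map h p \<in> forms d"
  unfolding forms_iff lookup_map_hom using zero by metis

end

lemma forms_subst:
  assumes "p \<in> forms d" "\<And>i. v $ i \<in> forms 1" "comm_hom h" "\<And>c. h c \<in> forms 0"
  shows "poly_eval h v p \<in> forms d"
  using assms(1)
proof (induction rule: forms_induct)
  case (var k q i)
  then show ?case
    using forms_mult[OF assms(2)[of i] var(2)] by (simp add: comm_hom.poly_eval_simps[OF assms(3)])
qed (auto simp: comm_hom.poly_eval_simps[OF assms(3)] assms intro: forms_add)

section \<open>Unique factorization\<close>

text \<open>An isomorphism onto iterated univariate polynomials, with X_2 as the outermost variable.
  It imports unique factorization and the finiteness of the set of roots.\<close>

definition nest :: "'k::comm_ring_1 poly3 \<Rightarrow> 'k poly poly poly" where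
  "nest = poly_eval (\<lambda>c. [:[:[:c:]:]:])
     (\<chi> i. if i = 0 then [:[:[:0, 1:]:]:] else if i = 1 then [:[:0, 1:]:] else [:0, 1:])"

lemma comm_hom_const3: "comm_hom (\<lambda>c. [:[:[:c:]:]:])"
  by unfold_locales (simp_all add: one_pCons)

lemma comm_hom_nest: "comm_hom nest"
  unfolding nest_def by (rule comm_hom.comm_hom_poly_eval[OF comm_hom_const3])

lemmas nest_simps = comm_hom.simps[OF comm_hom_nest]

lemma nest_cst: "nest (cst c) = [:[:[:c:]:]:]"
  by (simp add: nest_def comm_hom.poly_eval_simps[OF comm_hom_const3])

lemma nest_var:
  "nest (var 0) = [:[:[:0, 1:]:]:]" "nest (var 1) = [:[:0, 1:]:]" "nest (var 2) = [:0, 1:]"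
  by (simp_all add: nest_def comm_hom.poly_eval_simps[OF comm_hom_const3])

lemma nest_single:
  "nest (Poly_Mapping.single m c)
     = monom (monom (monom c (Poly_Mapping.lookup m 0)) (Poly_Mapping.lookup m 1)) (Poly_Mapping.lookup m 2)"
proof -
  have *: "nest (var 0) = monom (monom (monom (1::'a) 1) 0) 0" "nest (var 1) = monom (monom (1::'a poly) 1) 0"
    "nest (var 2) = monom (1::'a poly poly) 1" "nest (cst c) = monom (monom (monom c 0) 0) 0"
    by (simp_all only: nest_var nest_cst monom_0 monom_Suc One_nat_def)
  show ?thesis
    by (simp add: single_conv_var prod_3_from_0 nest_simps * monom_power mult_monom)
qed

lemma coeff_nest:
  "poly.coeff (poly.coeff (poly.coeff (nest p) (Poly_Mapping.lookup m 2)) (Poly_Mapping.lookup m 1)) (Poly_Mapping.lookup m 0)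
     = Poly_Mapping.lookup p m"
proof (induction p rule: poly3_add_induct)
  case (single n c)
  have "n = m \<longleftrightarrow> (\<forall>i. Poly_Mapping.lookup n i = Poly_Mapping.lookup m i)"
    by (metis poly_mapping_eqI)
  then show ?case
    by (auto simp: nest_single coeff_monom lookup_single when_def forall_3_from_0)
qed (simp add: nest_simps lookup_add)

lemma nest_eq_iff: "nest p = nest q \<longleftrightarrow> p = q"
  by (metis coeff_nest poly_mapping_eqI)

lemma nest_eq_0_iff: "nest p = 0 \<longleftrightarrow> p = 0"
  using nest_eq_iff[of p 0] by (simp add: nest_simps)

lemma poly_closed_induct:
  assumes "\<And>a. [:a:] \<in> S" "[:0, 1:] \<in> S" "\<And>p q. p \<in> S \<Longrightarrow> q \<in> S \<Longrightarrow> p + q \<in> S"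
    "\<And>p q. p \<in> S \<Longrightarrow> q \<in> S \<Longrightarrow> p * q \<in> S"
  shows "(p :: 'a::comm_ring_1 poly) \<in> S"
proof (induction p rule: pCons_induct)
  case 0
  show ?case using assms(1)[of 0] by simp
next
  case (pCons a p)
  have "pCons a p = [:a:] + [:0, 1:] * p" by simp
  then show ?case using assms pCons by metis
qed

text \<open>The range is closed under sums and products and contains the scalars and the variables;
  \<open>poly_closed_induct\<close> is applied at the three levels from the inside out.\<close>

lemma nest_surj: "\<exists>p. nest p = x"
proof -
  let ?R = "range (nest :: 'a poly3 \<Rightarrow> _)"
  have add: "p + q \<in> ?R" and mult: "p * q \<in> ?R" if "p \<in> ?R" "q \<in> ?R" for p q
    using that by (auto simp flip: nest_simps)
  have gen: "[:[:[:c:]:]:] \<in> ?R" "[:[:[:0, 1:]:]:] \<in> ?R" "[:[:0, 1:]:] \<in> ?R" "[:0, 1:] \<in> ?R" for c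
    using rangeI[of nest "cst c"] rangeI[of nest "var 0"] rangeI[of nest "var 1"] rangeI[of nest "var 2"]
    by (simp_all only: nest_cst nest_var)
  have 0: "[:[:p:]:] \<in> ?R" for p
  proof -
    have "p \<in> {p. [:[:p:]:] \<in> ?R}"
      by (rule poly_closed_induct)
        (use gen add[of "[:[:_:]:]" "[:[:_:]:]"] mult[of "[:[:_:]:]" "[:[:_:]:]"] in simp_all)
    then show ?thesis by simp
  qed
  have 1: "[:p:] \<in> ?R" for p
  proof -
    have "p \<in> {p. [:p:] \<in> ?R}"
      by (rule poly_closed_induct)
        (use 0 gen add[of "[:_:]" "[:_:]"] mult[of "[:_:]" "[:_:]"] in simp_all)
    then show ?thesis by simp
  qed
  have "x \<in> ?R"
    by (rule poly_closed_induct) (use 1 gen add mult in auto)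
  then show ?thesis by auto
qed

lemma nest_dvd_iff: "nest p dvd nest q \<longleftrightarrow> p dvd q"
  unfolding dvd_def by (metis nest_simps(4) nest_eq_iff nest_surj)

lemma prime_elem_nest_iff: "prime_elem (nest p) \<longleftrightarrow> prime_elem p"
proof -
  have "nest p dvd 1 \<longleftrightarrow> p dvd 1"
    using nest_dvd_iff[of p 1] by (simp add: nest_simps)
  moreover have "nest p dvd nest a * nest b \<longleftrightarrow> p dvd a * b" for a b
    using nest_dvd_iff[of p "a * b"] by (simp add: nest_simps)
  moreover have all: "(\<forall>a b. Q a b) \<longleftrightarrow> (\<forall>a b. Q (nest a) (nest b))" for Q :: "'a poly poly poly \<Rightarrow> _ \<Rightarrow> bool"
    by (metis nest_surj)
  ultimately show ?thesis
    unfolding prime_elem_def nest_eq_0_iff all[of "\<lambda>a b. nest p dvd a * b \<longrightarrow> nest p dvd a \<or> nest p dvd b"]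
    by (simp only: nest_dvd_iff)
qed

text \<open>Under \<open>nest\<close> this is a constant of a threefold polynomial extension, and
  primes stay prime in each of the three.\<close>

lemma prime_elem_cst: "prime_elem c \<Longrightarrow> prime_elem (cst c :: 'k::idom poly3)"
  by (simp add: nest_cst lift_prime_elem_poly flip: prime_elem_nest_iff)

lemma complex_poly3_prime_induct [case_names zero unit factor]:
  fixes x :: "complex poly3"
  assumes "P 0" "\<And>x. x dvd 1 \<Longrightarrow> P x" "\<And>p x. prime_elem p \<Longrightarrow> P x \<Longrightarrow> P (p * x)"
  shows "P x"
proof -
  have "\<forall>x. nest x = y \<longrightarrow> P x" for y :: "complex poly poly poly"
  proof (induction y rule: prime_divisors_induct)
    case zero
    then show ?case using assms(1) by (simp add: nest_eq_0_iff)
  next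
    case (unit u)
    then show ?case using assms(2) nest_dvd_iff[of _ 1] by (auto simp: nest_simps)
  next
    case (factor q y)
    show ?case
    proof (intro allI impI)
      fix x :: "complex poly3"
      assume x: "nest x = q * y"
      obtain q' y' where qy: "nest q' = q" "nest y' = y" using nest_surj by meson
      with x have "x = q' * y'" by (simp add: nest_simps flip: nest_eq_iff)
      moreover have "prime_elem q'" using factor(1) qy prime_elem_nest_iff by blast
      ultimately show "P x" using factor(2) qy assms(3) by blast
    qed
  qed
  then show ?thesis by blast
qed

text \<open>Gauss's lemma for a primitive \<open>F\<close>, where \<open>L\<close> over
  \<open>p\<close> is the quotient of \<open>G\<close> by \<open>F\<close>. A prime factor of
  \<open>p\<close> divides \<open>L * F\<close>, hence \<open>L\<close>, and cancels;
  \<open>L\<close> changes on the way and is therefore generalized in the induction.\<close>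

lemma gauss_dvd:
  fixes F G L :: "complex poly3 poly3"
  assumes prim: "\<And>\<pi>. prime_elem \<pi> \<Longrightarrow> \<not> cst \<pi> dvd F"
    and "p \<noteq> 0" "cst p * G = L * F"
  shows "F dvd G"
  using assms(2,3)
proof (induction p arbitrary: L rule: complex_poly3_prime_induct)
  case (unit p)
  from unit(1) obtain q where "1 = p * q" by (rule dvdE)
  then have q: "cst q * cst p = 1" by (simp add: mult.commute flip: cst_simps(4))
  have "G = (cst q * cst p) * G" by (simp add: q)
  also have "\<dots> = (cst q * L) * F" by (simp only: mult.assoc unit(3))
  finally show ?case by (metis dvd_triv_right)
next
  case (factor \<pi> x)
  have "cst \<pi> * (cst x * G) = L * F"
    using factor(4) by (simp add: cst_simps mult.assoc)
  then have "cst \<pi> dvd L * F" by (metis dvd_triv_left)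
  with factor(1) have "cst \<pi> dvd L" using prime_elem_cst prime_elem_dvd_mult_iff prim by blast
  then obtain M where M: "L = cst \<pi> * M" by (rule dvdE)
  have "cst \<pi> \<noteq> 0"
    using prime_elem_cst[OF factor(1)] by auto
  moreover have "cst \<pi> * (cst x * G) = cst \<pi> * (M * F)"
    using factor(4) M by (simp add: cst_simps mult.assoc)
  ultimately have "cst x * G = M * F" by simp
  with factor show ?case by auto
qed auto

section \<open>Points where a polynomial does not vanish\<close>

lemma poly_eval_conv_nest:
  "poly_eval id v p = poly (poly (poly (nest p) [:[:v $ 2:]:]) [:v $ 1:]) (v $ 0)"
proof (rule comm_hom_ext[where f = "poly_eval id v"])
  show "comm_hom (\<lambda>p. poly (poly (poly (nest p) [:[:v $ 2:]:]) [:v $ 1:]) (v $ 0))"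
    by unfold_locales (simp_all add: nest_simps)
  show "poly_eval id v (var i) = poly (poly (poly (nest (var i)) [:[:v $ 2:]:]) [:v $ 1:]) (v $ 0)" for i
    by (cases i rule: exhaust_3_from_0) (simp_all add: nest_var comm_hom.poly_eval_simps[OF comm_hom_id])
qed (simp_all add: comm_hom.comm_hom_poly_eval[OF comm_hom_id] nest_cst comm_hom.poly_eval_simps[OF comm_hom_id])

lemma exists_nonroot:
  fixes p :: "'a::idom poly" and f :: "complex \<Rightarrow> 'a"
  assumes "p \<noteq> 0" "inj f"
  shows "\<exists>c. poly p (f c) \<noteq> 0"
proof (rule ccontr)
  assume "\<nexists>c. poly p (f c) \<noteq> 0"
  then have "range f \<subseteq> {x. poly p x = 0}" by auto
  then have "finite (range f)" using poly_roots_finite[OF assms(1)] finite_subset by blast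
  then show False using assms(2) finite_imageD infinite_UNIV_char_0 by blast
qed

lemma exists_nonzero_value:
  fixes p :: "complex poly3"
  assumes "p \<noteq> 0"
  shows "\<exists>v. poly_eval id v p \<noteq> 0"
proof -
  have "nest p \<noteq> 0" using assms by (simp add: nest_eq_0_iff)
  from exists_nonroot[OF this, of "\<lambda>c. [:[:c:]:]"] obtain c
    where "poly (nest p) [:[:c:]:] \<noteq> 0" by (auto simp: inj_def)
  from exists_nonroot[OF this, of "\<lambda>c. [:c:]"] obtain b
    where "poly (poly (nest p) [:[:c:]:]) [:b:] \<noteq> 0" by (auto simp: inj_def)
  from exists_nonroot[OF this, of id] obtain a
    where "poly (poly (poly (nest p) [:[:c:]:]) [:b:]) a \<noteq> 0" by auto
  then have "poly_eval id (\<chi> i. if i = 0 then a else if i = 1 then b else c) p \<noteq> 0"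
    by (simp add: poly_eval_conv_nest)
  then show ?thesis by blast
qed

text \<open>Keeps the degree in \<open>forms 1\<close> from being rewritten to
  \<open>Suc 0\<close>.\<close>

declare One_nat_def [simp del]

section \<open>Linear forms\<close>

text \<open>The \<open>j\<close>-th power of the ideal generated by the variables. A form of degree
  below \<open>j\<close> that lies in it is 0, which is how vanishing is proved below.\<close>

definition lowdeg :: "nat \<Rightarrow> 'k::comm_ring_1 poly3 set" where
  "lowdeg j = {p. \<forall>m. Poly_Mapping.lookup p m \<noteq> 0 \<longrightarrow> j \<le> tdeg m}"

lemma lowdeg_0: "p \<in> lowdeg 0"
  by (simp add: lowdeg_def)

lemma lowdeg_add: "p \<in> lowdeg d \<Longrightarrow> q \<in> lowdeg d \<Longrightarrow> p + q \<in> lowdeg d"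
  unfolding lowdeg_def mem_Collect_eq lookup_add by (metis add_0)

lemma lowdeg_sum: "(\<And>x. x \<in> A \<Longrightarrow> f x \<in> lowdeg d) \<Longrightarrow> sum f A \<in> lowdeg d"
  by (induction A rule: infinite_finite_induct) (auto intro: lowdeg_add, simp_all add: lowdeg_def)

lemma lowdeg_single: "Poly_Mapping.single m c \<in> lowdeg d \<longleftrightarrow> c = 0 \<or> d \<le> tdeg m"
  by (auto simp: lowdeg_def lookup_single when_def)

lemma lowdeg_mult:
  assumes "p \<in> lowdeg d" "q \<in> lowdeg e"
  shows "p * q \<in> lowdeg (d + e)"
proof -
  have "p * q = (\<Sum>m\<in>Poly_Mapping.keys p. \<Sum>n\<in>Poly_Mapping.keys q.
     Poly_Mapping.single (m + n) (Poly_Mapping.lookup p m * Poly_Mapping.lookup q n))"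
    by (subst sum_singles[of p, symmetric], subst sum_singles[of q, symmetric]) (simp add: sum_product mult_single)
  also have "\<dots> \<in> lowdeg (d + e)"
    using assms
    by (intro lowdeg_sum) (unfold lowdeg_single, auto simp: lowdeg_def in_keys_iff lookup_add sum.distrib intro: add_mono)
  finally show ?thesis .
qed

lemma forms_lowdeg: "p \<in> forms d \<Longrightarrow> p \<in> lowdeg d"
  by (auto simp: forms_iff lowdeg_def)

lemma forms_lowdeg_0: "p \<in> forms d \<Longrightarrow> p \<in> lowdeg j \<Longrightarrow> d < j \<Longrightarrow> p = 0"
  by (intro poly_mapping_eqI) (auto simp: forms_iff lowdeg_def)

definition dotp :: "'k::comm_ring_1 ^ 3 \<Rightarrow> 'k ^ 3 \<Rightarrow> 'k" where
  "dotp u v = (\<Sum>i\<in>UNIV. u $ i * v $ i)"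

text \<open>The cross product: \<open>lin (crs Q z)\<close> is the line through two distinct points
  \<open>Q\<close> and \<open>z\<close>, and \<open>dotp (crs u v) w\<close> is the determinant of
  \<open>u\<close>, \<open>v\<close>, \<open>w\<close>.\<close>

definition crs :: "'k::comm_ring_1 ^ 3 \<Rightarrow> 'k ^ 3 \<Rightarrow> 'k ^ 3" where
  "crs u v = (\<chi> i. if i = 0 then u $ 1 * v $ 2 - u $ 2 * v $ 1
     else if i = 1 then u $ 2 * v $ 0 - u $ 0 * v $ 2
     else u $ 0 * v $ 1 - u $ 1 * v $ 0)"

definition lin :: "'k::comm_ring_1 ^ 3 \<Rightarrow> 'k poly3" where
  "lin c = (\<Sum>i\<in>UNIV. cst (c $ i) * var i)"

definition ev :: "'k::comm_ring_1 ^ 3 \<Rightarrow> 'k poly3 \<Rightarrow> 'k" where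
  "ev v p = poly_eval id v p"

lemma comm_hom_ev: "comm_hom (ev v)"
  unfolding ev_def[abs_def] by (rule comm_hom.comm_hom_poly_eval[OF comm_hom_id])

lemma ev_cst [simp]: "ev v (cst c) = c"
  and ev_var [simp]: "ev v (var i) = v $ i"
  by (simp_all add: ev_def comm_hom.poly_eval_cst[OF comm_hom_id] comm_hom.poly_eval_var[OF comm_hom_id])

lemmas ev_simps = comm_hom.simps[OF comm_hom_ev] ev_cst ev_var

lemma ev_lin: "ev v (lin c) = dotp c v"
  by (simp add: lin_def ev_simps dotp_def)

lemma dd_lin: "dd v (lin c) = cst (dotp c v)"
  by (simp add: lin_def dd_sum dotp_def cst_simps)

lemma forms_lin: "lin c \<in> forms 1"
  unfolding lin_def by (intro forms_sum forms_cst_mult forms_var)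

lemma dotp_crs: "dotp (crs u v) u = 0" "dotp (crs u v) v = 0" "dotp u (crs u v) = 0" "dotp v (crs u v) = 0"
  by (simp_all add: dotp_def crs_def sum_3_from_0 algebra_simps)

lemma dotp_crs_rotate: "dotp (crs v w) u = dotp (crs u v) w"
  by (simp add: dotp_def crs_def sum_3_from_0 algebra_simps)

lemma exists_dotp_1:
  assumes "(c :: 'k::field ^ 3) \<noteq> 0"
  shows "\<exists>u. dotp c u = 1"
proof -
  obtain i where i: "c $ i \<noteq> 0" using assms by (auto simp: vec_eq_iff)
  have "dotp c (\<chi> j. if j = i then inverse (c $ i) else 0) = 1"
    using i by (simp add: dotp_def if_distrib cong: if_cong)
  then show ?thesis by blast
qed

lemma exists_crs_nonzero:
  assumes "(Q :: 'k::field ^ 3) \<noteq> 0"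
  shows "\<exists>z. crs Q z \<noteq> 0"
proof -
  obtain i where i: "Q $ i \<noteq> 0" using assms by (auto simp: vec_eq_iff)
  \<comment> \<open>Addition in \<open>3\<close> is cyclic, so this is a unit vector in another
    coordinate than \<open>i\<close> and not proportional to \<open>Q\<close>.\<close>
  have "crs Q (\<chi> j. if j = i + 1 then 1 else 0) \<noteq> 0"
    using i by (cases i rule: exhaust_3_from_0) (auto simp: crs_def vec_eq_iff forall_3_from_0)
  then show ?thesis by blast
qed

text \<open>Cramer's rule: \<open>Q\<close>, \<open>z\<close>, \<open>u\<close> have determinant 1,
  and the three cross products form the dual basis.\<close>

lemma frame:
  assumes "dotp (crs Q z) u = 1"
  shows "var i = cst (Q $ i) * lin (crs z u) + cst (z $ i) * lin (crs u Q) + cst (u $ i) * lin (crs Q z)"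
proof -
  have *: "(if i = j then 1 else 0) = Q $ i * crs z u $ j + z $ i * crs u Q $ j + u $ i * crs Q z $ j" for j
    using assms
    by (cases i rule: exhaust_3_from_0; cases j rule: exhaust_3_from_0)
      (simp_all add: dotp_def crs_def sum_3_from_0, (simp add: algebra_simps)+)
  have "var i = (\<Sum>j\<in>UNIV. cst (if i = j then 1 else 0) * var j)"
    by (simp add: if_distrib if_distribR cong: if_cong)
  also have "\<dots> = cst (Q $ i) * lin (crs z u) + cst (z $ i) * lin (crs u Q) + cst (u $ i) * lin (crs Q z)"
    unfolding * by (simp add: lin_def sum_distrib_left sum.distrib cst_simps algebra_simps)
  finally show ?thesis .
qed

text \<open>Modulo \<open>y0\<close> and \<open>y2\<close> only a multiple of \<open>y1 ^ k\<close>
  survives. The clause for \<open>k = 0\<close> makes up for the truncated degree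
  \<open>k - 1\<close>.\<close>

lemma form_decomp:
  assumes "p \<in> forms k"
    and fr: "\<And>i. \<exists>\<alpha> \<beta> \<gamma>. var i = cst \<alpha> * y0 + cst \<beta> * y1 + cst \<gamma> * y2"
    and y1: "y1 \<in> forms 1"
  shows "\<exists>r s c. p = y0 * r + y2 * s + cst c * y1 ^ k \<and> r \<in> forms (k - 1) \<and> s \<in> forms (k - 1) \<and>
    (k = 0 \<longrightarrow> r = 0 \<and> s = 0)"
  using assms(1)
proof (induction rule: forms_induct)
  case (zero k)
  show ?case by (rule exI[of _ 0], rule exI[of _ 0], rule exI[of _ 0]) simp
next
  case (cst c)
  show ?case by (rule exI[of _ 0], rule exI[of _ 0], rule exI[of _ c]) simp
next
  case (var k q i)
  then obtain r s c where q: "q = y0 * r + y2 * s + cst c * y1 ^ k" and rs: "r \<in> forms (k - 1)" "s \<in> forms (k - 1)"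
    "k = 0 \<longrightarrow> r = 0 \<and> s = 0" by blast
  obtain \<alpha> \<beta> \<gamma> where i: "var i = cst \<alpha> * y0 + cst \<beta> * y1 + cst \<gamma> * y2" using fr by blast
  have "var i * q = y0 * (cst \<alpha> * q) + y2 * (cst \<gamma> * q) + cst \<beta> * y1 * q"
    by (simp add: i algebra_simps)
  also have "cst \<beta> * y1 * q = y0 * (cst \<beta> * (y1 * r)) + y2 * (cst \<beta> * (y1 * s)) + cst (\<beta> * c) * y1 ^ Suc k"
    by (subst q) (simp add: cst_simps algebra_simps)
  finally have "var i * q = y0 * (cst \<alpha> * q + cst \<beta> * (y1 * r)) + y2 * (cst \<gamma> * q + cst \<beta> * (y1 * s))
      + cst (\<beta> * c) * y1 ^ Suc k"
    by (simp add: algebra_simps)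
  moreover have "y1 * r \<in> forms k \<and> y1 * s \<in> forms k"
  proof (cases k)
    case (Suc l)
    with rs show ?thesis using forms_mult[OF y1, of _ l] by (simp add: One_nat_def)
  qed (use rs in simp)
  then have "cst \<alpha> * q + cst \<beta> * (y1 * r) \<in> forms k" "cst \<gamma> * q + cst \<beta> * (y1 * s) \<in> forms k"
    using var(1) by (auto intro!: forms_add forms_cst_mult)
  ultimately show ?case by (metis diff_Suc_1 nat.distinct(1))
next
  case (add k p q)
  then obtain r s c r' s' c' where "p = y0 * r + y2 * s + cst c * y1 ^ k" "q = y0 * r' + y2 * s' + cst c' * y1 ^ k"
    and *: "r \<in> forms (k - 1)" "s \<in> forms (k - 1)" "r' \<in> forms (k - 1)" "s' \<in> forms (k - 1)"
    "k = 0 \<longrightarrow> r = 0 \<and> s = 0" "k = 0 \<longrightarrow> r' = 0 \<and> s' = 0"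
    by blast
  then have "p + q = y0 * (r + r') + y2 * (s + s') + cst (c + c') * y1 ^ k"
    by (simp add: cst_simps algebra_simps)
  with * show ?case by (metis add_0 forms_add)
qed

section \<open>The constants of a directional derivative\<close>

text \<open>For a linear form \<open>y\<close> with \<open>dd Q y = 1\<close>, this is the
  projection onto the plane \<open>y = 0\<close> along \<open>Q\<close>, read on polynomials. In
  characteristic zero its image is the ring of constants of \<open>dd Q\<close>.\<close>

definition flat :: "'k::comm_ring_1 ^ 3 \<Rightarrow> 'k poly3 \<Rightarrow> 'k poly3 \<Rightarrow> 'k poly3" where
  "flat Q y = poly_eval cst (\<chi> i. var i - cst (Q $ i) * y)"

lemma comm_hom_flat: "comm_hom (flat Q y)"
  unfolding flat_def by (rule comm_hom.comm_hom_poly_eval[OF comm_hom_cst])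

lemmas flat_simps = comm_hom.simps[OF comm_hom_flat]

lemma flat_cst [simp]: "flat Q y (cst c) = cst c"
  and flat_var [simp]: "flat Q y (var i) = var i - cst (Q $ i) * y"
  by (simp_all add: flat_def comm_hom.poly_eval_simps[OF comm_hom_cst])

lemma flat_lin: "flat Q y (lin c) = lin c - cst (dotp c Q) * y"
  by (simp add: lin_def flat_simps dotp_def sum_3_from_0 cst_simps algebra_simps)

lemma forms_flat: "p \<in> forms d \<Longrightarrow> y \<in> forms 1 \<Longrightarrow> flat Q y p \<in> forms d"
  unfolding flat_def
  by (rule forms_subst) (auto intro: forms_diff forms_var forms_cst_mult comm_hom_cst forms_cst)

lemma dd_flat:
  assumes "dd Q y = 1"
  shows "dd Q (flat Q y p) = 0"
  by (induction p rule: poly3_induct) (simp_all add: flat_simps dd_mult assms)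

lemma dvd_diff_flat: "y dvd p - flat Q y p"
proof (induction p rule: poly3_induct)
  case (add p q)
  then have "y dvd (p - flat Q y p) + (q - flat Q y q)" by (rule dvd_add)
  then show ?case by (simp add: flat_simps algebra_simps)
next
  case (mult p q)
  then have "y dvd p * (q - flat Q y q) + (p - flat Q y p) * flat Q y q" by auto
  then show ?case by (simp add: flat_simps algebra_simps)
qed simp_all

text \<open>Makes the results for fields of characteristic zero available over
  \<open>func\<close>.\<close>

instance fract :: ("{idom, ring_char_0}") field_char_0
proof
  have "(of_nat n :: 'a fract) = Fract (of_nat n) 1" for n
    by (induction n) (simp_all add: Zero_fract_def One_fract_def)
  then show "inj (of_nat :: nat \<Rightarrow> 'a fract)"
    by (intro injI) (simp add: eq_fract)
qed

text \<open>Characteristic zero: a constant of the derivation divisible by \<open>y\<close> is divisible by all powers of \<open>y\<close>.\<close>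

lemma flat_of_constant:
  fixes Q :: "'k::field_char_0 ^ 3"
  assumes "dd Q p = 0" "dd Q y = 1" "y \<in> forms 1"
  shows "flat Q y p = p"
proof -
  define w where "w = p - flat Q y p"
  have w: "dd Q w = 0"
    using assms by (simp add: w_def dd_flat)
  have y0: "y \<noteq> 0" using assms(2) by auto
  have "y ^ Suc j dvd w" for j
  proof (induction j)
    case 0
    then show ?case by (simp add: w_def dvd_diff_flat)
  next
    case (Suc j)
    then obtain s where s: "w = y ^ Suc j * s" by (rule dvdE)
    let ?n = "of_nat (Suc j) :: 'k"
    \<comment> \<open>Differentiation along \<open>Q\<close> lowers the power of \<open>y\<close> by
      one and produces the factor \<open>j + 1\<close>; dividing by it shows that \<open>y\<close>
      divides \<open>s\<close>.\<close>
    have "0 = y ^ j * (cst ?n * s + y * dd Q s)"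
      using w by (simp add: s dd_mult dd_power assms cst_simps algebra_simps del: power_Suc) (simp add: algebra_simps)
    with y0 have "cst ?n * s + y * dd Q s = 0" by simp
    then have "cst ?n * s = - (y * dd Q s)"
      by (simp only: eq_neg_iff_add_eq_0)
    then have "cst (inverse ?n) * (cst ?n * s) = cst (inverse ?n) * (- (y * dd Q s))"
      by (simp only:)
    moreover have "cst (inverse ?n) * cst ?n = 1"
      using of_nat_neq_0[of j, where 'a = 'k] by (metis cst_1 cst_simps(4) left_inverse)
    ultimately have "s = y * (- cst (inverse ?n) * dd Q s)"
      by (metis (no_types, lifting) mult.assoc mult.commute mult_1 mult_minus_left)
    then obtain t where t: "s = y * t" by blast
    have "w = y ^ Suc (Suc j) * t" unfolding s t by (simp add: algebra_simps)
    then show ?case by (rule dvdI)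
  qed
  \<comment> \<open>Every factor \<open>y\<close> raises the least degree of a monomial, so no
    monomial of \<open>w\<close> is left.\<close>
  have "w \<in> lowdeg (Suc j)" for j
  proof -
    obtain s where s: "w = y ^ Suc j * s" using \<open>y ^ Suc j dvd w\<close> by (meson dvdE)
    have "y ^ Suc j \<in> lowdeg (Suc j)"
      using forms_power[OF assms(3), of "Suc j"] by (intro forms_lowdeg) simp
    then show ?thesis
      using lowdeg_mult[OF _ lowdeg_0, of "y ^ Suc j" "Suc j" s] s by simp
  qed
  then have "Suc (tdeg m) \<le> tdeg m" if "Poly_Mapping.lookup w m \<noteq> 0" for m
    using that unfolding lowdeg_def by blast
  then have "w = 0"
    by (intro poly_mapping_eqI) (metis Suc_n_not_le_n lookup_zero)
  then show ?thesis by (simp add: w_def)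
qed

text \<open>Constants of \<open>dd Q\<close> are binary forms in the lines \<open>y0\<close>,
  \<open>y1\<close> through \<open>Q\<close>. At \<open>z\<close> these take the values 0 and 1, so
  the value of the form is the coefficient of \<open>y1 ^ k\<close>; without that term
  \<open>y0\<close> divides it.\<close>

lemma constant_root_factor:
  fixes Q :: "'k::field_char_0 ^ 3"
  assumes "crs Q z \<noteq> 0" "dd Q p = 0" "p \<in> forms k" "ev z p = 0"
  shows "\<exists>q. p = lin (crs Q z) * q \<and> dd Q q = 0 \<and> q \<in> forms (k - 1) \<and> (k = 0 \<longrightarrow> q = 0)"
proof -
  obtain u where u: "dotp (crs Q z) u = 1" using exists_dotp_1 assms(1) by blast
  define y0 y1 y2 where "y0 = lin (crs Q z)" and "y1 = lin (crs u Q)" and "y2 = lin (crs z u)"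
  have "\<exists>\<alpha> \<beta> \<gamma>. var i = cst \<alpha> * y0 + cst \<beta> * y1 + cst \<gamma> * y2" for i
    using frame[OF u, of i] unfolding y0_def y1_def y2_def by (metis add.commute add.left_commute)
  moreover have y: "y0 \<in> forms 1" "y1 \<in> forms 1" "y2 \<in> forms 1"
    by (simp_all add: y0_def y1_def y2_def forms_lin)
  ultimately obtain r s c where p: "p = y0 * r + y2 * s + cst c * y1 ^ k" and r: "r \<in> forms (k - 1)" "k = 0 \<longrightarrow> r = 0"
    using form_decomp[OF assms(3), of y0 y1 y2] by blast
  have u': "dotp (crs z u) Q = 1" "dotp (crs u Q) z = 1"
    using u dotp_crs_rotate[of Q z u] dotp_crs_rotate[of u Q z] by simp_all
  have d2: "dd Q y2 = 1" by (simp add: y2_def dd_lin u')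
  have fy: "flat Q y2 y0 = y0" "flat Q y2 y1 = y1" "flat Q y2 y2 = 0"
    by (simp_all add: y0_def y1_def flat_lin dotp_crs) (simp add: y2_def flat_lin u')
  have "p = flat Q y2 p"
    using flat_of_constant[OF assms(2) d2] y by simp
  also have "\<dots> = y0 * flat Q y2 r + cst c * y1 ^ k"
    by (simp add: p flat_simps fy)
  finally have p': "p = y0 * flat Q y2 r + cst c * y1 ^ k" .
  have "ev z y0 = 0" "ev z y1 = 1"
    by (simp_all add: y0_def y1_def ev_lin dotp_crs u')
  with assms(4) have "c = 0" by (simp add: p' ev_simps)
  with p' have "p = y0 * flat Q y2 r" by simp
  moreover have "flat Q y2 r \<in> forms (k - 1)" using r y by (simp add: forms_flat)
  ultimately show ?thesis
    using r dd_flat[OF d2] unfolding y0_def by (metis flat_simps(1))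
qed

section \<open>Dimensions\<close>

context vector_space
begin

lemma finite_basis_exists:
  assumes "finite T" "V \<subseteq> span T"
  shows "\<exists>B. finite B \<and> B \<subseteq> V \<and> independent B \<and> V \<subseteq> span B \<and> card B = dim V"
  using basis_exists[of V] independent_span_bound[OF assms(1)] assms(2) by (metis subset_trans)

lemma dim_less_subspace:
  assumes "subspace W" "W \<subseteq> V" "finite T" "V \<subseteq> span T" "v \<in> V" "v \<notin> W"
  shows "dim W + 1 \<le> dim V"
proof -
  obtain B where B: "finite B" "B \<subseteq> W" "independent B" "W \<subseteq> span B" "card B = dim W"
    using finite_basis_exists[OF assms(3), of W] assms by auto
  obtain C where C: "finite C" "V \<subseteq> span C" "card C = dim V"
    using finite_basis_exists[OF assms(3,4)] by auto
  have "span B \<subseteq> W" using B(2) assms(1) by (rule span_minimal)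
  then have v: "v \<notin> span B" "v \<notin> B" using assms(6) B(2) by auto
  have "independent (insert v B)"
    using v B(3) by (simp add: independent_insertI)
  moreover have "insert v B \<subseteq> span C" using B(2) C(2) assms(2,5) by blast
  ultimately have "card (insert v B) \<le> card C" using independent_span_bound[OF C(1)] by blast
  then show ?thesis using v B C by simp
qed

lemma dim_le_dim_kernel:
  assumes "subspace V" "finite T" "V \<subseteq> span T"
    and add: "\<And>x y. \<phi> (x + y) = \<phi> x + \<phi> y" and scale: "\<And>c x. \<phi> (scale c x) = c * \<phi> x"
  shows "dim V \<le> dim {v \<in> V. \<phi> v = 0} + 1"
proof -
  let ?W = "{v \<in> V. \<phi> v = 0}"
  obtain B where B: "finite B" "B \<subseteq> ?W" "?W \<subseteq> span B" "card B = dim ?W"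
    using finite_basis_exists[OF assms(2), of ?W] assms(3) by auto
  show ?thesis
  proof (cases "\<exists>v\<in>V. \<phi> v \<noteq> 0")
    case True
    then obtain v where v: "v \<in> V" "\<phi> v \<noteq> 0" by blast
    have "x \<in> span (insert v B)" if "x \<in> V" for x
    proof -
      let ?c = "\<phi> x / \<phi> v"
      from add[of "x - scale ?c v" "scale ?c v"] have "\<phi> (x - scale ?c v) = 0"
        using v by (simp add: scale)
      then have "x - scale ?c v \<in> ?W"
        using assms(1) v that by (simp add: subspace_diff subspace_scale)
      then have "x - scale ?c v \<in> span (insert v B)"
        using B(3) span_mono[of B "insert v B"] by blast
      from span_add[OF this span_scale[OF span_base[of v]], of ?c] show ?thesis by simp
    qed
    then have "dim V \<le> card (insert v B)"
      by (intro dim_le_card) (use B in auto)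
    also have "\<dots> \<le> card B + 1" using B(1) by (simp add: card_insert_if)
    finally show ?thesis using B by simp
  next
    case False
    then have "?W = V" by auto
    then show ?thesis by simp
  qed
qed

end

text \<open>Any \<open>quotient_basis\<close> completes a basis of \<open>W\<close> to a basis of
  \<open>V\<close>, so all have the same size; extending a basis of \<open>W\<close> shows that one
  exists.\<close>

lemma quotient_dim_eq:
  assumes W: "pvs.subspace W" "W \<subseteq> V" and V: "pvs.subspace V" "finite T" "V \<subseteq> pvs.span T"
  shows "quotient_dim V W = pvs.dim V - pvs.dim W"
proof -
  obtain D where D: "finite D" "D \<subseteq> W" "pvs.independent D" "W \<subseteq> pvs.span D" "card D = pvs.dim W"
    using pvs.finite_basis_exists[OF V(2), of W] W(2) V(3) by auto
  have spanD: "pvs.span D = W"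
    using D(2,4) W(1) pvs.span_minimal by blast
  have cardB: "card B = pvs.dim V - pvs.dim W" if "quotient_basis V W B" for B
  proof -
    from that have B: "finite B" "B \<subseteq> V"
      and u: "\<And>v. v \<in> V \<Longrightarrow> \<exists>!c. (\<forall>b. b \<notin> B \<longrightarrow> c b = 0) \<and> v - (\<Sum>b\<in>B. pscale (c b) b) \<in> W"
      by (auto simp: quotient_basis_def)
    have uniq: "c = c'"
      if "\<forall>b. b \<notin> B \<longrightarrow> c b = 0" "0 - (\<Sum>b\<in>B. pscale (c b) b) \<in> W"
        "\<forall>b. b \<notin> B \<longrightarrow> c' b = 0" "0 - (\<Sum>b\<in>B. pscale (c' b) b) \<in> W" for c c'
      using u[OF pvs.subspace_0[OF V(1)]] that by blast
    \<comment> \<open>Uniqueness of the coefficients at the vector 0 is linear independence modulo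
      \<open>W\<close>.\<close>
    have z: "c b = 0" if "(\<Sum>b\<in>B. pscale (c b) b) \<in> W" "b \<in> B" for c b
    proof -
      let ?c = "\<lambda>b. if b \<in> B then c b else 0"
      have "(\<Sum>b\<in>B. pscale (?c b) b) = (\<Sum>b\<in>B. pscale (c b) b)"
        by (rule sum.cong) auto
      then have "0 - (\<Sum>b\<in>B. pscale (?c b) b) \<in> W"
        using that(1) W(1) pvs.subspace_neg by simp
      moreover have "0 - (\<Sum>b\<in>B. pscale ((\<lambda>b. 0) b) b) \<in> W"
        using W(1) pvs.subspace_0 by simp
      ultimately have "?c = (\<lambda>b. 0)"
        by (intro uniq) auto
      from fun_cong[OF this, of b] show ?thesis using that(2) by simp
    qed
    have disj: "B \<inter> D = {}"
    proof (rule ccontr)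
      assume "B \<inter> D \<noteq> {}"
      then obtain b where b: "b \<in> B" "b \<in> W" using D(2) by blast
      have "(\<Sum>x\<in>B. pscale (if x = b then 1 else 0) x) = b"
        using B(1) b by (simp add: if_distrib if_distribR sum.delta cong: if_cong)
      with z[of "\<lambda>x. if x = b then 1 else 0" b] b show False by simp
    qed
    have "pvs.independent (B \<union> D)"
    proof (rule pvs.independent_if_scalars_zero)
      show "finite (B \<union> D)" using B D by simp
      fix c x assume s: "(\<Sum>x\<in>B \<union> D. pscale (c x) x) = 0" and x: "x \<in> B \<union> D"
      have s': "(\<Sum>x\<in>B. pscale (c x) x) + (\<Sum>x\<in>D. pscale (c x) x) = 0"
        using s B D disj by (simp add: sum.union_disjoint)
      have "(\<Sum>x\<in>D. pscale (c x) x) \<in> W"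
        by (intro pvs.subspace_sum W pvs.subspace_scale) (use D(2) in auto)
      from pvs.subspace_neg[OF W(1) this] have "(\<Sum>x\<in>B. pscale (c x) x) \<in> W"
        using s' by (simp only: eq_neg_iff_add_eq_0[symmetric])
      with z have zB: "c b = 0" if "b \<in> B" for b using that by blast
      then have "(\<Sum>x\<in>D. pscale (c x) x) = 0" using s' by simp
      then have "c b = 0" if "b \<in> D" for b
        using pvs.independentD[OF D(3,1) subset_refl] that by blast
      with zB x show "c x = 0" by blast
    qed
    moreover have "V \<subseteq> pvs.span (B \<union> D)"
    proof
      fix v assume "v \<in> V"
      with u obtain c where "v - (\<Sum>b\<in>B. pscale (c b) b) \<in> W" by blast
      then have "v - (\<Sum>b\<in>B. pscale (c b) b) \<in> pvs.span (B \<union> D)"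
        using spanD pvs.span_mono[of D "B \<union> D"] by blast
      moreover have "(\<Sum>b\<in>B. pscale (c b) b) \<in> pvs.span (B \<union> D)"
        by (intro pvs.span_sum pvs.span_scale pvs.span_base) auto
      ultimately show "v \<in> pvs.span (B \<union> D)"
        using pvs.span_add by fastforce
    qed
    ultimately have "card (B \<union> D) = pvs.dim V"
      using B D W(2) by (intro pvs.basis_card_eq_dim) auto
    then show ?thesis using card_Un_disjoint[OF B(1) D(1) disj] D(5) by simp
  qed
  obtain C where C: "D \<subseteq> C" "C \<subseteq> V" "pvs.independent C" "V \<subseteq> pvs.span C"
    using pvs.maximal_independent_subset_extend[OF _ D(3), of V] D(2) W(2) by blast
  have fC: "finite C" using pvs.independent_span_bound[OF V(2) C(3)] C(2) V(3) by blast
  have "quotient_basis V W (C - D)"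
    unfolding quotient_basis_def
  proof (intro conjI ballI)
    fix v assume "v \<in> V"
    with C(4) obtain c where c: "v = (\<Sum>b\<in>C. pscale (c b) b)"
      unfolding pvs.span_finite[OF fC] by blast
    have split: "(\<Sum>b\<in>C. pscale (c b) b) = (\<Sum>b\<in>C - D. pscale (c b) b) + (\<Sum>b\<in>D. pscale (c b) b)" for c
      using fC C(1) by (simp add: sum.subset_diff)
    have DW: "(\<Sum>b\<in>D. pscale (c b) b) \<in> W" for c
      by (intro pvs.subspace_sum W pvs.subspace_scale) (use D(2) in auto)
    show "\<exists>!c. (\<forall>b. b \<notin> C - D \<longrightarrow> c b = 0) \<and> v - (\<Sum>b\<in>C - D. pscale (c b) b) \<in> W"
    proof (rule ex1I[of _ "\<lambda>b. if b \<in> C - D then c b else 0"])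
      have "(\<Sum>b\<in>C - D. pscale (if b \<in> C - D then c b else 0) b) = (\<Sum>b\<in>C - D. pscale (c b) b)"
        by (rule sum.cong) auto
      then show "(\<forall>b. b \<notin> C - D \<longrightarrow> (if b \<in> C - D then c b else 0) = 0) \<and>
        v - (\<Sum>b\<in>C - D. pscale (if b \<in> C - D then c b else 0) b) \<in> W"
        using DW[of c] c split[of c] by auto
    next
      fix e assume e: "(\<forall>b. b \<notin> C - D \<longrightarrow> e b = 0) \<and> v - (\<Sum>b\<in>C - D. pscale (e b) b) \<in> W"
      then have "v - (\<Sum>b\<in>C - D. pscale (e b) b) \<in> pvs.span D" by (simp add: spanD)
      then obtain k where k: "v - (\<Sum>b\<in>C - D. pscale (e b) b) = (\<Sum>b\<in>D. pscale (k b) b)"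
        unfolding pvs.span_finite[OF D(1)] by blast
      let ?e = "\<lambda>b. if b \<in> D then k b else e b"
      have "v = (\<Sum>b\<in>C - D. pscale (e b) b) + (\<Sum>b\<in>D. pscale (k b) b)"
        using k by (simp add: algebra_simps)
      also have "\<dots> = (\<Sum>b\<in>C - D. pscale (?e b) b) + (\<Sum>b\<in>D. pscale (?e b) b)"
        by (intro arg_cong2[where f = "(+)"] sum.cong) auto
      also have "\<dots> = (\<Sum>b\<in>C. pscale (?e b) b)" by (simp only: split)
      finally have "v = (\<Sum>b\<in>C. pscale (?e b) b)" .
      then have "(\<Sum>b\<in>C. pscale (c b - ?e b) b) = 0"
        using c unfolding pvs.scale_left_diff_distrib sum_subtractf by (simp only: diff_self)
      then have "c b - ?e b = 0" if "b \<in> C" for b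
        using pvs.independentD[OF C(3) fC subset_refl, where u = "\<lambda>b. c b - ?e b"] that by blast
      then have "c b = e b" if "b \<in> C - D" for b
        using that by fastforce
      then show "e = (\<lambda>b. if b \<in> C - D then c b else 0)" using e by auto
    qed
  qed (use fC C in auto)
  then show ?thesis
    unfolding quotient_dim_def using cardB by (intro the_equality) blast+
qed

lemma forms_finitely_spanned: "\<exists>T. finite T \<and> forms d \<subseteq> pvs.span (T :: 'k::field poly3 set)"
proof -
  define T :: "nat \<Rightarrow> 'k poly3 set" where
    "T = rec_nat {1} (\<lambda>_ S. \<Union>i. (\<lambda>t. var i * t) ` S)"
  have T: "T 0 = {1}" "T (Suc k) = (\<Union>i. (\<lambda>t. var i * t) ` T k)" for k
    by (simp_all add: T_def)
  have "finite (T k)" for k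
    by (induction k) (simp_all add: T)
  moreover have "p \<in> pvs.span (T d)" if "p \<in> forms d" for p
    using that
  proof (induction rule: forms_induct)
    case (cst c)
    have "pscale c 1 \<in> pvs.span (T 0)" by (intro pvs.span_scale pvs.span_base) (simp add: T)
    moreover have "pscale c 1 = cst c" by (simp add: pscale_def)
    ultimately show ?case by simp
  next
    case (var k q i)
    show ?case using var(2)
    proof (induction rule: pvs.span_induct_alt)
      case (step c x y)
      have "var i * x \<in> pvs.span (T (Suc k))"
        using step(1) by (intro pvs.span_base) (auto simp: T)
      then have "pscale c (var i * x) + var i * y \<in> pvs.span (T (Suc k))"
        using step(2) by (intro pvs.span_add pvs.span_scale)
      moreover have "pscale c (var i * x) + var i * y = var i * (pscale c x + y)"
        by (simp add: pscale_def algebra_simps)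
      ultimately show ?case by simp
    qed (simp add: pvs.span_zero)
  qed (auto intro: pvs.span_add pvs.span_zero)
  ultimately show ?thesis by blast
qed

section \<open>Minimal bases\<close>

text \<open>
  A form of degree \<open>d\<close> lies in \<open>I(Q)\<^bsup>d - 1\<^esup>\<close> iff it has degree at most one in the direction
  \<open>Q\<close>, that is, iff its second derivative along \<open>Q\<close> vanishes.
\<close>

definition NN :: "'k::field ^ 3 \<Rightarrow> ('k ^ 3) set \<Rightarrow> nat \<Rightarrow> 'k poly3 set" where
  "NN Q Z d = {p \<in> forms d. dd Q (dd Q p) = 0 \<and> (\<forall>z\<in>Z. ev z p = 0)}"

lemma NN_0: "0 \<in> NN Q Z d"
  by (simp add: NN_def ev_simps)

lemma NN_add: "p \<in> NN Q Z d \<Longrightarrow> q \<in> NN Q Z d \<Longrightarrow> p + q \<in> NN Q Z d"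
  by (simp add: NN_def ev_simps forms_add)

lemma NN_diff: "p \<in> NN Q Z d \<Longrightarrow> q \<in> NN Q Z d \<Longrightarrow> p - q \<in> NN Q Z d"
  by (simp add: NN_def ev_simps forms_diff)

lemma NN_mult:
  assumes "p \<in> NN Q Z d" "dd Q r = 0" "r \<in> forms k"
  shows "r * p \<in> NN Q Z (k + d)"
  using assms by (simp add: NN_def ev_simps dd_mult forms_mult)

lemma NN_cst_mult: "p \<in> NN Q Z d \<Longrightarrow> cst c * p \<in> NN Q Z d"
  using NN_mult[of p Q Z d "cst c" 0] by (simp add: forms_cst)

lemma NN_insert: "p \<in> NN Q (insert z Z) d \<longleftrightarrow> p \<in> NN Q Z d \<and> ev z p = 0"
  by (auto simp: NN_def)

lemma subspace_NN: "pvs.subspace (NN Q Z d)"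
  by (simp add: pvs.subspace_def NN_0 NN_add NN_cst_mult pscale_def)

lemma NN_finitely_spanned: "\<exists>T. finite T \<and> NN Q Z d \<subseteq> pvs.span T"
  using forms_finitely_spanned[of d] by (force simp: NN_def)

text \<open>The coefficients that a generator of degree \<open>a\<close> may have in degree
  \<open>d\<close>. For \<open>a > d\<close> the truncated \<open>d - a\<close> would wrongly admit
  scalars.\<close>

definition GG :: "'k::field ^ 3 \<Rightarrow> nat \<Rightarrow> nat \<Rightarrow> 'k poly3 set" where
  "GG Q a d = {r. dd Q r = 0 \<and> (if a \<le> d then r \<in> forms (d - a) else r = 0)}"

lemma GG_NN:
  assumes "r \<in> GG Q a d" "f \<in> NN Q Z a"
  shows "r * f \<in> NN Q Z d"
proof (cases "a \<le> d")
  case True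
  then show ?thesis using NN_mult[OF assms(2), of r "d - a"] assms(1) by (simp add: GG_def)
next
  case False
  then show ?thesis using assms(1) by (simp add: GG_def NN_0)
qed

text \<open>The last clause says that the points impose independent conditions on
  \<open>NN Q {} d\<close> as soon as \<open>d\<close> is at least \<open>a - 1\<close> and
  \<open>b - 1\<close>. As an inequality it is inherited point by point without computing any
  dimension. No order of \<open>a\<close> and \<open>b\<close> is imposed, so that the generators
  can be swapped.\<close>

definition minimal_basis ::
    "'k::field ^ 3 \<Rightarrow> ('k ^ 3) set \<Rightarrow> nat \<Rightarrow> nat \<Rightarrow> 'k poly3 \<Rightarrow> 'k poly3 \<Rightarrow> bool" where
  "minimal_basis Q Z a b f g \<longleftrightarrow>
     f \<in> NN Q Z a \<and> g \<in> NN Q Z b \<and> a + b = card Z + 1 \<and>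
     (\<forall>d. \<forall>h\<in>NN Q Z d. \<exists>r\<in>GG Q a d. \<exists>s\<in>GG Q b d. h = r * f + s * g) \<and>
     (\<forall>r s. dd Q r = 0 \<longrightarrow> dd Q s = 0 \<longrightarrow> r * f + s * g = 0 \<longrightarrow> r = 0 \<and> s = 0) \<and>
     (\<forall>d. a \<le> d + 1 \<longrightarrow> b \<le> d + 1 \<longrightarrow> pvs.dim (NN Q Z d) + card Z \<le> pvs.dim (NN Q {} d))"

lemma minimal_basis_swap: "minimal_basis Q Z a b f g \<Longrightarrow> minimal_basis Q Z b a g f"
  unfolding minimal_basis_def by (metis add.commute)

lemma minimal_basis_generates:
  "minimal_basis Q Z a b f g \<Longrightarrow> h \<in> NN Q Z d \<Longrightarrow> \<exists>r\<in>GG Q a d. \<exists>s\<in>GG Q b d. h = r * f + s * g"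
  by (simp add: minimal_basis_def)

lemma minimal_basis_independent:
  "minimal_basis Q Z a b f g \<Longrightarrow> dd Q r = 0 \<Longrightarrow> dd Q s = 0 \<Longrightarrow> r * f + s * g = 0 \<Longrightarrow> r = 0 \<and> s = 0"
  unfolding minimal_basis_def by blast

text \<open>With vanishing second derivative, \<open>h\<close> is \<open>r + s * lin c\<close> for
  constants \<open>r\<close>, \<open>s\<close> of \<open>dd Q\<close>, where \<open>s\<close> is the
  derivative of \<open>h\<close>.\<close>

lemma minimal_basis_empty:
  fixes Q :: "'k::field ^ 3"
  assumes "dotp c Q = 1"
  shows "minimal_basis Q {} 0 1 1 (lin c)"
  unfolding minimal_basis_def
proof (intro conjI allI ballI impI)
  fix d and h :: "'k poly3" assume h: "h \<in> NN Q {} d"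
  define s where "s = dd Q h"
  have d0: "d = 0 \<Longrightarrow> s = 0"
    using h forms_zero_conv[of h] by (auto simp: NN_def s_def)
  have s: "dd Q s = 0" "s \<in> forms (d - 1)" using h by (auto simp: NN_def s_def forms_dd)
  have "s * lin c \<in> forms d"
    using d0 forms_mult[OF s(2) forms_lin, of c] by (cases "d = 0") auto
  then have "h - s * lin c \<in> GG Q 0 d"
    using h s by (simp add: GG_def NN_def dd_mult dd_lin assms forms_diff) (simp add: s_def)
  moreover have "s \<in> GG Q 1 d" using d0 s by (cases "d = 0") (auto simp: GG_def)
  ultimately show "\<exists>r\<in>GG Q 0 d. \<exists>s\<in>GG Q 1 d. h = r * 1 + s * lin c"
    by (intro bexI[of _ "h - s * lin c"] bexI[of _ s]) simp_all
next
  fix r s assume *: "dd Q r = 0" "dd Q s = 0" "r * 1 + s * lin c = 0"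
  then have "dd Q (r * 1 + s * lin c) = 0" by simp
  then show "s = 0" using * by (simp add: dd_mult dd_lin assms)
  with * show "r = 0" by simp
qed (use forms_lin[of c] in \<open>simp_all add: NN_def forms_1 dd_lin\<close>)

text \<open>
  One step of the interpolation algorithm of Koetter: among the two generators, one that does not
  vanish at the new point is multiplied by the line through \<open>Q\<close> and \<open>z\<close>, and the other one is
  corrected by a multiple of it.
\<close>

lemma minimal_basis_step:
  fixes Q :: "'k::field_char_0 ^ 3"
  assumes mb: "minimal_basis Q Z a b f g" and Z: "finite Z" "z \<notin> Z" "crs Q z \<noteq> 0"
    and f: "ev z f \<noteq> 0" and ab: "a \<le> b \<or> ev z g = 0"
  shows "\<exists>f' g'. minimal_basis Q (insert z Z) (a + 1) b f' g'"
proof -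
  obtain u where u: "dotp (crs Q z) u = 1" using exists_dotp_1 Z(3) by blast
  have u': "dotp (crs u Q) z = 1"
    using u dotp_crs_rotate[of Q z u] by simp
  \<comment> \<open>\<open>ell\<close> is the line through \<open>Q\<close> and \<open>z\<close>;
    \<open>m\<close> is a line through \<open>Q\<close> with value 1 at \<open>z\<close>, so its
    powers raise degrees without changing values at \<open>z\<close>.\<close>
  define ell m where "ell = lin (crs Q z)" and "m = lin (crs u Q)"
  have ell: "ell \<in> forms 1" "dd Q ell = 0" "ev z ell = 0" "ell \<noteq> 0"
  proof -
    have "ev u ell = 1" by (simp add: ell_def ev_lin u)
    then show "ell \<noteq> 0" by (auto simp: ev_simps)
  qed (simp_all add: ell_def forms_lin dd_lin ev_lin dotp_crs)
  have m: "m ^ k \<in> forms k" "dd Q (m ^ k) = 0" "ev z (m ^ k) = 1" for k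
    using forms_power[OF forms_lin[of "crs u Q"], of k]
    by (simp_all add: m_def dd_power dd_lin ev_simps ev_lin dotp_crs u')
  have m1: "ev z m = 1" by (simp add: m_def ev_lin u')
  \<comment> \<open>Chosen so that \<open>t * f\<close> and \<open>g\<close> agree at
    \<open>z\<close> and, for \<open>a \<le> b\<close>, have the same degree. If
    \<open>a > b\<close>, then \<open>g\<close> vanishes at \<open>z\<close> and \<open>t\<close> is
    0.\<close>
  define \<kappa> where "\<kappa> = ev z g / ev z f"
  define t where "t = cst \<kappa> * m ^ (b - a)"
  have t: "dd Q t = 0" "ev z t = \<kappa>" by (simp_all add: t_def m m1 ev_simps)
  have tGG: "s * t \<in> GG Q a d" if "s \<in> GG Q b d" for s d
  proof (cases "\<kappa> = 0")
    case False
    with ab have "a \<le> b" by (auto simp: \<kappa>_def)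
    show ?thesis
    proof (cases "b \<le> d")
      case True
      have "s * m ^ (b - a) \<in> forms ((d - b) + (b - a))"
        using that True by (intro forms_mult m) (simp add: GG_def)
      then have "s * t \<in> forms (d - a)"
        using \<open>a \<le> b\<close> True forms_cst_mult[of "s * m ^ (b - a)" "d - a" \<kappa>] by (simp add: t_def mult.left_commute)
      then show ?thesis using that True \<open>a \<le> b\<close> by (simp add: GG_def dd_mult t)
    qed (use that in \<open>simp add: GG_def\<close>)
  qed (simp add: t_def GG_def)
  have bb: "1 \<in> GG Q b b" by (simp add: GG_def forms_1)
  from mb have fN: "f \<in> NN Q Z a" and gN: "g \<in> NN Q Z b" and card: "a + b = card Z + 1"
    and gen: "\<And>d h. h \<in> NN Q Z d \<Longrightarrow> \<exists>r\<in>GG Q a d. \<exists>s\<in>GG Q b d. h = r * f + s * g"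
    and ind: "\<And>r s. dd Q r = 0 \<Longrightarrow> dd Q s = 0 \<Longrightarrow> r * f + s * g = 0 \<Longrightarrow> r = 0 \<and> s = 0"
    and dim: "\<And>d. a \<le> d + 1 \<Longrightarrow> b \<le> d + 1 \<Longrightarrow> pvs.dim (NN Q Z d) + card Z \<le> pvs.dim (NN Q {} d)"
    unfolding minimal_basis_def by blast+
  have "minimal_basis Q (insert z Z) (a + 1) b (ell * f) (g - t * f)"
    unfolding minimal_basis_def
  proof (intro conjI allI ballI impI)
    show "ell * f \<in> NN Q (insert z Z) (a + 1)"
      using NN_mult[OF fN ell(2,1)] ell(3) by (simp add: NN_insert ev_simps add.commute)
    have "t * f \<in> NN Q Z b" using GG_NN[OF tGG[OF bb] fN] by simp
    then show "g - t * f \<in> NN Q (insert z Z) b"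
      using NN_diff[OF gN] f by (simp add: NN_insert ev_simps t \<kappa>_def)
    then have evg: "ev z (g - t * f) = 0" by (simp add: NN_insert)
    fix d h assume h: "h \<in> NN Q (insert z Z) d"
    then obtain r s where rs: "r \<in> GG Q a d" "s \<in> GG Q b d" "h = r * f + s * g"
      using gen[of h d] by (auto simp: NN_insert)
    define r1 where "r1 = r + s * t"
    have hr1: "h = r1 * f + s * (g - t * f)" by (simp add: r1_def rs(3) algebra_simps)
    have r1: "r1 \<in> GG Q a d"
      using rs(1) tGG[OF rs(2)] by (auto simp: r1_def GG_def split: if_splits intro: forms_add)
    have "ev z h = 0" using h by (simp add: NN_insert)
    \<comment> \<open>At \<open>z\<close> only the term \<open>r1 * f\<close> remains, and
      \<open>f\<close> does not vanish there; hence the line \<open>ell\<close> splits off from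
      \<open>r1\<close>.\<close>
    then have "ev z r1 = 0" using evg f by (simp add: hr1 ev_simps)
    have "\<exists>q\<in>GG Q (a + 1) d. r1 = ell * q"
    proof (cases "a \<le> d")
      case True
      then obtain q where "r1 = ell * q" "dd Q q = 0" "q \<in> forms (d - a - 1)" "d - a = 0 \<longrightarrow> q = 0"
        using constant_root_factor[OF Z(3), of r1 "d - a"] r1 \<open>ev z r1 = 0\<close> by (auto simp: GG_def ell_def)
      then show ?thesis by (intro bexI[of _ q]) (auto simp: GG_def)
    qed (use r1 in \<open>auto simp: GG_def\<close>)
    then obtain q where "q \<in> GG Q (a + 1) d" "r1 = ell * q" by blast
    then show "\<exists>r\<in>GG Q (a + 1) d. \<exists>s\<in>GG Q b d. h = r * (ell * f) + s * (g - t * f)"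
      using rs(2) by (intro bexI[of _ q] bexI[of _ s]) (simp_all add: hr1 mult_ac)
  next
    fix r s assume *: "dd Q r = 0" "dd Q s = 0" "r * (ell * f) + s * (g - t * f) = 0"
    then have "(r * ell - s * t) * f + s * g = 0" by (simp add: algebra_simps)
    then have "r * ell - s * t = 0 \<and> s = 0"
      by (intro ind) (simp_all add: * dd_mult ell t)
    then show "r = 0" "s = 0" using ell(4) by auto
  next
    fix d assume d: "a + 1 \<le> d + 1" "b \<le> d + 1"
    obtain T where "finite T" "NN Q Z d \<subseteq> pvs.span T" using NN_finitely_spanned by blast
    \<comment> \<open>A witness that the new point imposes one more condition in degree
      \<open>d\<close>.\<close>
    moreover have "m ^ (d - a) * f \<in> NN Q Z d"
      using NN_mult[OF fN m(2,1), of "d - a"] d by simp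
    moreover have "m ^ (d - a) * f \<notin> NN Q (insert z Z) d"
      using f by (simp add: NN_insert ev_simps m1)
    ultimately have "pvs.dim (NN Q (insert z Z) d) + 1 \<le> pvs.dim (NN Q Z d)"
      by (intro pvs.dim_less_subspace[OF subspace_NN]) (auto simp: NN_insert)
    with dim[of d] d Z show "pvs.dim (NN Q (insert z Z) d) + card (insert z Z) \<le> pvs.dim (NN Q {} d)"
      by simp
  qed (use card Z in simp_all)
  then show ?thesis by blast
qed

text \<open>The product of the lines joining \<open>Q\<close> to the points of \<open>Z\<close> lies
  in the module and is nonzero at \<open>z\<close>, which is on none of these lines.\<close>

lemma minimal_basis_nonvanishing:
  fixes Q :: "'k::field ^ 3"
  assumes mb: "minimal_basis Q Z a b f g" and Z: "finite Z" "\<And>x. x \<in> Z \<Longrightarrow> dotp (crs Q x) z \<noteq> 0"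
  shows "ev z f \<noteq> 0 \<or> ev z g \<noteq> 0"
proof (rule ccontr)
  assume neg: "\<not> ?thesis"
  define w where "w = (\<Prod>x\<in>Z. lin (crs Q x))"
  have "dd Q (\<Prod>x\<in>Y. lin (crs Q x)) = 0 \<and> (\<Prod>x\<in>Y. lin (crs Q x)) \<in> forms (card Y)" if "finite Y" for Y
    using that
  proof (induction rule: finite_induct)
    case (insert x F)
    then show ?case
      using forms_mult[OF forms_lin[of "crs Q x"], of "\<Prod>x\<in>F. lin (crs Q x)" "card F"]
      by (simp add: dd_mult dd_lin dotp_crs One_nat_def)
  qed (simp add: forms_1)
  then have "dd Q w = 0" "w \<in> forms (card Z)" using Z(1) by (auto simp: w_def)
  moreover have "ev x w = 0" if "x \<in> Z" for x
    using that Z(1) dotp_crs(2)[of Q x] by (auto simp: w_def ev_simps ev_lin intro!: prod_zero)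
  ultimately have "w \<in> NN Q Z (card Z)" by (simp add: NN_def)
  from minimal_basis_generates[OF mb this] obtain r s where "w = r * f + s * g" by blast
  then have "ev z w = 0" using neg by (simp add: ev_simps)
  moreover have "ev z w \<noteq> 0" using Z by (simp add: w_def ev_simps ev_lin)
  ultimately show False by simp
qed

text \<open>General position: \<open>Q\<close> is none of the points and is not collinear with two
  of them. At each new point the generator of smaller degree is multiplied by the line, unless it
  already vanishes there.\<close>

lemma exists_minimal_basis:
  fixes Q :: "'k::field_char_0 ^ 3"
  assumes "finite Z" "Q \<noteq> 0" "\<And>x. x \<in> Z \<Longrightarrow> crs Q x \<noteq> 0"
    "\<And>x y. x \<in> Z \<Longrightarrow> y \<in> Z \<Longrightarrow> x \<noteq> y \<Longrightarrow> dotp (crs Q x) y \<noteq> 0"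
  shows "\<exists>a b f g. a \<le> b \<and> minimal_basis Q Z a b f g"
  using assms(1,3,4)
proof (induction rule: finite_induct)
  case empty
  obtain c where "dotp Q c = 1" using exists_dotp_1 assms(2) by blast
  then have "dotp c Q = 1" by (simp add: dotp_def mult.commute)
  then show ?case using minimal_basis_empty zero_le by blast
next
  case (insert z Z)
  then obtain a b f g where ab: "a \<le> b" and mb: "minimal_basis Q Z a b f g" by auto
  have nv: "ev z f \<noteq> 0 \<or> ev z g \<noteq> 0"
    using minimal_basis_nonvanishing[OF mb insert(1)] insert.prems(2) insert.hyps(2) by auto
  have "\<exists>a b f g. minimal_basis Q (insert z Z) a b f g"
  proof (cases "ev z f = 0")
    case False
    then show ?thesis
      using minimal_basis_step[OF mb insert(1,2)] insert.prems(1) ab by blast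
  next
    case True
    with nv show ?thesis
      using minimal_basis_step[OF minimal_basis_swap[OF mb] insert(1,2)] insert.prems(1) by blast
  qed
  then show ?case using minimal_basis_swap nle_le by metis
qed

section \<open>Vanishing ideals and fat points\<close>

lemma proj_point_eq: "proj_point v = range (\<lambda>c. c *s v)"
  by (simp add: proj_point_def vec.span_singleton)

lemma vanishes_at_proj_point:
  assumes "p \<in> forms d"
  shows "vanishes_at p (proj_point v) \<longleftrightarrow> ev v p = 0"
proof -
  have "c *s v = (\<chi> i. c * v $ i)" for c
    by (simp add: vec_eq_iff)
  then have *: "ev (c *s v) p = c ^ d * ev v p" for c
    using comm_hom.poly_eval_scale[OF comm_hom_id assms, of c v] by (simp add: ev_def)
  have "vanishes_at p (proj_point v) \<longleftrightarrow> (\<forall>c. ev (c *s v) p = 0)"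
    by (simp add: vanishes_at_def proj_point_eq ev_def)
  also have "\<dots> \<longleftrightarrow> ev v p = 0"
    unfolding * by (auto dest: spec[of _ 1])
  finally show ?thesis .
qed

lemma vanishing_ideal_ev:
  assumes "p \<in> vanishing_ideal (proj_point ` V)" "v \<in> V"
  shows "ev v p = 0"
  using assms(1) unfolding vanishing_ideal_def
proof (induction rule: ideal.span_induct_alt)
  case (step c x y)
  then obtain d where "x \<in> forms d" "vanishes_at x (proj_point v)" using assms(2) by blast
  then have "ev v x = 0" using vanishes_at_proj_point by blast
  then show ?case using step(2) by (simp only: ev_simps mult_zero_right add_0)
qed (simp only: ev_simps)

lemma forms_in_vanishing_ideal:
  assumes "p \<in> forms d" "\<And>v. v \<in> V \<Longrightarrow> ev v p = 0"
  shows "p \<in> vanishing_ideal (proj_point ` V)"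
  unfolding vanishing_ideal_def
  by (rule ideal.span_base) (use assms vanishes_at_proj_point in blast)

lemma vanishing_ideal_forms:
  "vanishing_ideal (proj_point ` V) \<inter> forms d = {p \<in> forms d. \<forall>v\<in>V. ev v p = 0}"
  using vanishing_ideal_ev forms_in_vanishing_ideal by blast

lemma subspace_ideal_power: "ideal.subspace (ideal_power I n)"
  by (cases n) (auto simp: ideal.subspace_def intro: ideal.span_add ideal.span_scale ideal.span_zero)

lemma ideal_power_mult: "x \<in> I \<Longrightarrow> y \<in> ideal_power I n \<Longrightarrow> x * y \<in> ideal_power I (Suc n)"
  by (auto intro: ideal.span_base)

lemma ideal_power_Suc_subset: "ideal_power I (Suc n) \<subseteq> ideal_power I n"
proof -
  have "{x * y |x y. x \<in> I \<and> y \<in> ideal_power I n} \<subseteq> ideal_power I n"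
    using ideal.subspace_scale[OF subspace_ideal_power] by blast
  then show ?thesis
    unfolding ideal_power.simps by (rule ideal.span_minimal) (rule subspace_ideal_power)
qed

text \<open>A nonzero scalar does not vanish at \<open>Q\<close>, so the homogeneous generators have
  no constant term.\<close>

lemma vanishing_ideal_lowdeg:
  assumes "p \<in> vanishing_ideal {proj_point Q}"
  shows "p \<in> lowdeg 1"
  using assms unfolding vanishing_ideal_def
proof (induction rule: ideal.span_induct_alt)
  case base
  show ?case by (simp add: lowdeg_def)
next
  case (step c x y)
  then obtain d where d: "x \<in> forms d" "ev Q x = 0" using vanishes_at_proj_point by blast
  have "x \<in> lowdeg 1"
  proof (cases "d = 0")
    case True
    with d forms_zero_conv have "x = 0" by (metis ev_cst cst_0)
    then show ?thesis by (simp add: lowdeg_def)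
  next
    case False
    then show ?thesis using forms_lowdeg[OF d(1)] by (auto simp: lowdeg_def)
  qed
  then have "c * x \<in> lowdeg 1" using lowdeg_mult[OF lowdeg_0, of x 1 c] by simp
  with step show ?case by (simp add: lowdeg_add)
qed

lemma ideal_power_lowdeg:
  "p \<in> ideal_power (vanishing_ideal {proj_point Q}) n \<Longrightarrow> p \<in> lowdeg n"
proof (induction n arbitrary: p)
  case (Suc n)
  show ?case using Suc(2) unfolding ideal_power.simps
  proof (induction rule: ideal.span_induct_alt)
    case base
    show ?case by (simp add: lowdeg_def)
  next
    case (step c w y)
    then obtain x z where w: "w = x * z" "x \<in> vanishing_ideal {proj_point Q}"
      "z \<in> ideal_power (vanishing_ideal {proj_point Q}) n" by blast
    then have "w \<in> lowdeg (1 + n)"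
      using lowdeg_mult vanishing_ideal_lowdeg Suc(1) by blast
    then have "c * w \<in> lowdeg (0 + (1 + n))" by (intro lowdeg_mult lowdeg_0)
    then show ?case using lowdeg_add[OF _ step(2), of "c * w"] by (simp add: One_nat_def)
  qed
qed (rule lowdeg_0)

lemma ev_dd_self: "p \<in> forms d \<Longrightarrow> ev Q (dd Q p) = of_nat d * ev Q p"
  using arg_cong[OF euler, of p d "ev Q"] by (simp add: dd_def ev_simps)

text \<open>By Euler's formula the derivative of a form along \<open>Q\<close> has at
  \<open>Q\<close> a multiple of the value of the form there.\<close>

lemma dd_vanishing_ideal:
  assumes "p \<in> vanishing_ideal {proj_point Q}"
  shows "dd Q p \<in> vanishing_ideal {proj_point Q}"
  using assms unfolding vanishing_ideal_def
proof (induction rule: ideal.span_induct_alt)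
  case (step c x y)
  let ?S = "{p. (\<exists>d. p \<in> forms d) \<and> (\<forall>P\<in>{proj_point Q}. vanishes_at p P)}"
  obtain d where d: "x \<in> forms d" "ev Q x = 0" using step vanishes_at_proj_point by blast
  then have "dd Q x \<in> ?S"
    using vanishes_at_proj_point[OF forms_dd[OF d(1)]] ev_dd_self[OF d(1), of Q] forms_dd[OF d(1), of Q] d(2) by auto
  then have "dd Q c * x + c * dd Q x + dd Q y \<in> ideal.span ?S"
    using step by (intro ideal.span_add ideal.span_scale) (auto intro: ideal.span_base)
  then show ?case by (simp add: dd_mult)
qed (simp add: ideal.span_zero)

lemma dd_ideal_power:
  "p \<in> ideal_power (vanishing_ideal {proj_point Q}) n \<Longrightarrow> dd Q p \<in> ideal_power (vanishing_ideal {proj_point Q}) n"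
proof (induction n arbitrary: p)
  case (Suc n)
  let ?I = "vanishing_ideal {proj_point Q}"
  show ?case using Suc(2) unfolding ideal_power.simps
  proof (induction rule: ideal.span_induct_alt)
    case (step c w y)
    then obtain x z where w: "w = x * z" "x \<in> ?I" "z \<in> ideal_power ?I n" by blast
    let ?S = "{x * y |x y. x \<in> ?I \<and> y \<in> ideal_power ?I n}"
    have "x * z \<in> ?S" "dd Q x * z \<in> ?S" "x * dd Q z \<in> ?S"
      using w dd_vanishing_ideal Suc(1) by blast+
    then have "x * z \<in> ideal.span ?S" "dd Q x * z \<in> ideal.span ?S" "x * dd Q z \<in> ideal.span ?S"
      by (simp_all only: ideal.span_base)
    with step(2) have "dd Q c * (x * z) + (c * (dd Q x * z) + c * (x * dd Q z)) + dd Q y \<in> ideal.span ?S"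
      by (simp only: ideal.span_add ideal.span_scale)
    then show ?case by (simp add: w dd_mult algebra_simps)
  qed (simp add: ideal.span_zero)
qed simp

lemma flat_gen_vanishing:
  assumes "dotp c Q = 1"
  shows "var i - cst (Q $ i) * lin c \<in> vanishing_ideal {proj_point Q} \<inter> forms 1"
proof -
  have f: "var i - cst (Q $ i) * lin c \<in> forms 1"
    by (intro forms_diff forms_var forms_cst_mult forms_lin)
  with forms_in_vanishing_ideal[OF this, of "{Q}"] show ?thesis
    by (simp add: ev_simps ev_lin assms)
qed

text \<open>The substitution turns every variable into a linear form vanishing at \<open>Q\<close>,
  and a monomial of degree \<open>k\<close> into a product of \<open>k\<close> of them.\<close>

lemma flat_ideal_power:
  assumes "dotp c Q = 1" "p \<in> forms k"
  shows "flat Q (lin c) p \<in> ideal_power (vanishing_ideal {proj_point Q}) k"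
  using assms(2)
proof (induction rule: forms_induct)
  case (zero k)
  show ?case using ideal.subspace_0[OF subspace_ideal_power] by (simp add: flat_simps)
next
  case (cst c)
  show ?case by simp
next
  case (var k q i)
  then show ?case
    using ideal_power_mult[OF _ var(2)] flat_gen_vanishing[OF assms(1), of i] by (simp add: flat_simps)
next
  case (add k p q)
  then show ?case using ideal.subspace_add[OF subspace_ideal_power] by (simp add: flat_simps)
qed

text \<open>The power of I(Q) is stable under \<open>dd Q\<close> and has no terms of degree below
  \<open>d - 1\<close>, whereas the second derivative has degree \<open>d - 2\<close>. Conversely,
  \<open>p\<close> is \<open>lin c * u + v\<close> with constants \<open>u\<close>, \<open>v\<close>
  of degrees \<open>d - 1\<close> and \<open>d\<close>, which lie in the corresponding powers of
  I(Q).\<close>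

lemma ideal_power_forms:
  fixes Q :: "'k::field_char_0 ^ 3"
  assumes "Q \<noteq> 0"
  shows "ideal_power (vanishing_ideal {proj_point Q}) (d - 1) \<inter> forms d = NN Q {} d"
proof (intro subset_antisym subsetI)
  fix p assume p: "p \<in> ideal_power (vanishing_ideal {proj_point Q}) (d - 1) \<inter> forms d"
  then have low: "dd Q (dd Q p) \<in> lowdeg (d - 1)"
    by (auto intro: ideal_power_lowdeg dd_ideal_power)
  have f: "dd Q (dd Q p) \<in> forms (d - 1 - 1)" using p forms_dd by blast
  have "dd Q (dd Q p) = 0"
  \<comment> \<open>For \<open>d \<le> 1\<close> the degree \<open>d - 1 - 1\<close> is truncated
    and gives no contradiction; there the first derivative is a scalar.\<close>
  proof (cases "d - 1 = 0")
    case True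
    then have "dd Q p \<in> forms 0" using p forms_dd[of p d Q] by simp
    then show ?thesis using forms_zero_conv by fastforce
  next
    case False
    with forms_lowdeg_0[OF f low] show ?thesis by simp
  qed
  with p show "p \<in> NN Q {} d" by (simp add: NN_def)
next
  fix p assume p: "p \<in> NN Q {} d"
  let ?I = "ideal_power (vanishing_ideal {proj_point Q})"
  show "p \<in> ?I (d - 1) \<inter> forms d"
  proof (cases d)
    case 0
    then show ?thesis using p by (simp add: NN_def)
  next
    case (Suc k)
    obtain c where "dotp Q c = 1" using exists_dotp_1 assms by blast
    then have c: "dotp c Q = 1" by (simp add: dotp_def mult.commute)
    then have dc: "dd Q (lin c) = 1" by (simp add: dd_lin)
    define u v where "u = dd Q p" and "v = p - lin c * u"
    have u: "dd Q u = 0" "u \<in> forms k" using p Suc forms_dd[of p d Q] by (auto simp: NN_def u_def)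
    have "lin c * u \<in> forms d" using forms_mult[OF forms_lin u(2), of c] Suc by (simp add: One_nat_def)
    then have v: "dd Q v = 0" "v \<in> forms d"
      using p u by (simp_all add: v_def dd_mult dc forms_diff NN_def) (simp add: u_def)
    have "flat Q (lin c) u = u" "flat Q (lin c) v = v"
      using flat_of_constant[OF u(1) dc] flat_of_constant[OF v(1) dc] forms_lin by auto
    then have "u \<in> ?I k" "v \<in> ?I (Suc k)"
      using flat_ideal_power[OF c u(2)] flat_ideal_power[OF c v(2)] Suc by simp_all
    then have "lin c * u + v \<in> ?I k"
      using subsetD[OF ideal_power_Suc_subset \<open>v \<in> ?I (Suc k)\<close>]
      by (intro ideal.subspace_add ideal.subspace_scale subspace_ideal_power)
    with p Suc show ?thesis by (simp add: v_def NN_def)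
  qed
qed

text \<open>A constant is its own image under \<open>flat\<close>, hence a polynomial in linear
  forms that vanish at \<open>Q\<close>.\<close>

lemma constants_generated:
  fixes Q :: "'k::field_char_0 ^ 3"
  assumes "Q \<noteq> 0"
  shows "generated_subring (range cst \<union> (vanishing_ideal {proj_point Q} \<inter> forms 1)) = {r. dd Q r = 0}"
    (is "generated_subring ?S = _")
proof (intro subset_antisym subsetI)
  fix r assume "r \<in> generated_subring ?S"
  then show "r \<in> {r. dd Q r = 0}"
  proof induction
    case (base x)
    then show ?case
    proof
      assume x: "x \<in> vanishing_ideal {proj_point Q} \<inter> forms 1"
      then have "dd Q x \<in> forms 0" using forms_dd[of x 1 Q] by simp
      moreover have "dd Q x \<in> lowdeg 1"
        using x dd_vanishing_ideal vanishing_ideal_lowdeg by blast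
      ultimately have "dd Q x = 0" by (rule forms_lowdeg_0) simp
      then show ?thesis by simp
    qed auto
  qed (simp_all add: dd_mult)
next
  fix r assume r: "r \<in> {r. dd Q r = 0}"
  obtain c where "dotp Q c = 1" using exists_dotp_1 assms by blast
  then have c: "dotp c Q = 1" by (simp add: dotp_def mult.commute)
  then have "dd Q (lin c) = 1" by (simp add: dd_lin)
  then have "flat Q (lin c) r = r"
    using flat_of_constant[of Q r "lin c", OF _ _ forms_lin] r by simp
  moreover have "flat Q (lin c) p \<in> generated_subring ?S" for p
  proof (induction p rule: poly3_induct)
    case (cst a)
    then show ?case by (auto intro: generated_subring.base)
  next
    case (var i)
    then show ?case using flat_gen_vanishing[OF c, of i] by (auto intro: generated_subring.base)
  next
    case (add p q)
    have "0 \<in> generated_subring ?S" by (rule generated_subring.base) (metis Un_iff cst_0 rangeI)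
    then have "flat Q (lin c) p - (0 - flat Q (lin c) q) \<in> generated_subring ?S"
      using add by (intro generated_subring.diff)
    then show ?case by (simp add: flat_simps)
  next
    case (mult p q)
    then show ?case by (simp add: flat_simps generated_subring.mult)
  qed
  ultimately show "r \<in> generated_subring ?S" by metis
qed

section \<open>Projective points and their coordinate vectors\<close>

lemma crs_0_proportional:
  fixes v w :: "'k::field ^ 3"
  assumes "crs v w = 0" "v \<noteq> 0"
  shows "\<exists>c. w = c *s v"
proof -
  obtain i where i: "v $ i \<noteq> 0" using assms(2) by (auto simp: vec_eq_iff)
  have *: "v $ j * w $ k = v $ k * w $ j" for j k
    using assms(1)
    by (cases j rule: exhaust_3_from_0; cases k rule: exhaust_3_from_0)
      (auto simp: crs_def vec_eq_iff forall_3_from_0 mult.commute)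
  define c where "c = w $ i / v $ i"
  have "w $ k = c * v $ k" for k
    using i *[of i k] by (simp add: c_def field_simps)
  then have "w = c *s v" by (simp add: vec_eq_iff)
  then show ?thesis ..
qed

lemma proj_point_eqI:
  fixes v w :: "'k::field ^ 3"
  assumes "crs v w = 0" "v \<noteq> 0" "w \<noteq> 0"
  shows "proj_point v = proj_point w"
proof -
  obtain c where c: "w = c *s v" using crs_0_proportional[OF assms(1,2)] by blast
  then have "c \<noteq> 0" using assms(3) by auto
  have "k *s v = (k / c) *s w" for k using c \<open>c \<noteq> 0\<close> by (simp add: vec.scale_scale)
  moreover have "k *s w = (k * c) *s v" for k using c by (simp add: vec.scale_scale)
  ultimately show ?thesis unfolding proj_point_eq by blast
qed

lemma representatives:
  assumes "Z \<subseteq> proj_plane" "finite Z"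
  shows "\<exists>V. finite V \<and> Z = proj_point ` V \<and> 0 \<notin> V \<and> (\<forall>v\<in>V. \<forall>w\<in>V. v \<noteq> w \<longrightarrow> crs v w \<noteq> 0)"
proof -
  have "\<forall>P\<in>Z. \<exists>v. v \<noteq> 0 \<and> P = proj_point v" using assms(1) by (auto simp: proj_plane_def)
  then obtain r where r: "\<forall>P\<in>Z. r P \<noteq> 0 \<and> P = proj_point (r P)" by metis
  show ?thesis
  proof (intro exI[of _ "r ` Z"] conjI)
    show "Z = proj_point ` r ` Z" using r by (auto simp: image_iff)
    show "\<forall>v\<in>r ` Z. \<forall>w\<in>r ` Z. v \<noteq> w \<longrightarrow> crs v w \<noteq> 0"
      using r proj_point_eqI by (metis (no_types, lifting) imageE)
  qed (use r assms(2) in auto)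
qed

section \<open>Unexpected curves and minimal bases\<close>

lemma dim_forms_le:
  fixes V :: "('k::field ^ 3) set"
  assumes "finite V"
  shows "pvs.dim (forms d :: 'k poly3 set) \<le> pvs.dim {p \<in> forms d. \<forall>v\<in>V. ev v p = 0} + card V"
  using assms
proof (induction rule: finite_induct)
  case empty
  then show ?case by simp
next
  case (insert v V)
  let ?K = "\<lambda>V. {p \<in> forms d. \<forall>v\<in>V. ev v p = (0 :: 'k)}"
  obtain T :: "'k poly3 set" where "finite T" "forms d \<subseteq> pvs.span T"
    using forms_finitely_spanned by blast
  moreover have "pvs.subspace (?K V)"
    by (auto simp: pvs.subspace_def pscale_def ev_simps intro: forms_add forms_cst_mult)
  ultimately have "pvs.dim (?K V) \<le> pvs.dim {p \<in> ?K V. ev v p = 0} + 1"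
    by (intro pvs.dim_le_dim_kernel) (auto simp: ev_simps pscale_def)
  moreover have "{p \<in> ?K V. ev v p = 0} = ?K (insert v V)" by auto
  ultimately show ?case using insert by simp
qed

lemma subspace_forms: "pvs.subspace (forms d)"
  by (simp add: pvs.subspace_def forms_add pscale_def forms_cst_mult)

text \<open>For \<open>d < a\<close> the module is 0 in degree \<open>d\<close>. For
  \<open>b \<le> d + 1\<close> the points impose \<open>card V\<close> independent conditions on
  \<open>NN Q {} d\<close> and at most that many on all forms, so the dimension does not exceed the
  expected one.\<close>

lemma unexpected_degrees:
  fixes Q :: "'k::field_char_0 ^ 3"
  assumes "Q \<noteq> 0" "finite V" and mb: "minimal_basis Q V a b f g" and ab: "a \<le> b"
    and un: "int (pvs.dim (vanishing_ideal (proj_point ` V) \<inter> ideal_power (vanishing_ideal {proj_point Q}) (d - 1) \<inter> forms d))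
       > max 0 (int (pvs.dim (vanishing_ideal (proj_point ` V) \<inter> forms d))
                - int (quotient_dim (forms d) (ideal_power (vanishing_ideal {proj_point Q}) (d - 1) \<inter> forms d)))"
  shows "a \<le> d" "d + 1 < b"
proof -
  let ?F = "forms d :: 'k poly3 set"
  obtain T :: "'k poly3 set" where T: "finite T" "?F \<subseteq> pvs.span T"
    using forms_finitely_spanned by blast
  have fat: "ideal_power (vanishing_ideal {proj_point Q}) (d - 1) \<inter> forms d = NN Q {} d"
    by (rule ideal_power_forms) fact
  have "vanishing_ideal (proj_point ` V) \<inter> ideal_power (vanishing_ideal {proj_point Q}) (d - 1) \<inter> forms d
      = (vanishing_ideal (proj_point ` V) \<inter> forms d) \<inter> NN Q {} d"
    unfolding fat[symmetric] by blast
  also have "\<dots> = NN Q V d"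
    unfolding vanishing_ideal_forms by (auto simp: NN_def)
  finally have N: "int (pvs.dim (NN Q V d)) > max 0 (int (pvs.dim {p \<in> ?F. \<forall>v\<in>V. ev v p = 0})
       - int (pvs.dim ?F - pvs.dim (NN Q {} d)))"
    using un quotient_dim_eq[OF subspace_NN _ subspace_forms T, of Q "{}"]
    by (simp add: fat vanishing_ideal_forms) (auto simp: NN_def)
  show "a \<le> d"
  proof (rule ccontr)
    assume "\<not> a \<le> d"
    with ab have "GG Q a d \<subseteq> {0}" "GG Q b d \<subseteq> {0}" by (auto simp: GG_def)
    with minimal_basis_generates[OF mb] have "NN Q V d \<subseteq> {0}" by fastforce
    then have "pvs.dim (NN Q V d) \<le> card ({} :: 'k poly3 set)"
      by (intro pvs.dim_le_card) (auto simp: pvs.span_zero)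
    with N show False by simp
  qed
  show "d + 1 < b"
  proof (rule ccontr)
    assume "\<not> d + 1 < b"
    then have "b \<le> d + 1" "a \<le> d + 1" using ab by auto
    then have "pvs.dim (NN Q V d) + card V \<le> pvs.dim (NN Q {} d)"
      using mb by (simp add: minimal_basis_def)
    moreover have "pvs.dim ?F \<le> pvs.dim {p \<in> ?F. \<forall>v\<in>V. ev v p = 0} + card V"
      by (rule dim_forms_le) fact
    \<comment> \<open>Needed because the quotient dimension is a truncated difference of natural
      numbers.\<close>
    moreover have "pvs.dim (NN Q {} d) \<le> pvs.dim ?F"
    proof -
      obtain B where B: "finite B" "?F \<subseteq> pvs.span B" "card B = pvs.dim ?F"
        using pvs.finite_basis_exists[OF T] by metis
      have "NN Q {} d \<subseteq> ?F" by (auto simp: NN_def)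
      with B show ?thesis using pvs.dim_le_card[of "NN Q {} d" B] by auto
    qed
    ultimately show False using N by linarith
  qed
qed

section \<open>The generic point and specialization\<close>

lemma (in comm_hom) ev_map: "ev (\<chi> i. h (v $ i)) (Poly_Mapping.map h p) = h (ev v p)"
  by (rule comm_hom_ext[where f = "\<lambda>p. ev (\<chi> i. h (v $ i)) (Poly_Mapping.map h p)"])
    (simp_all add: comm_hom_comp[OF comm_hom_ev comm_hom_map] comm_hom_comp[OF comm_hom_axioms comm_hom_ev])

definition to_func :: "complex poly3 \<Rightarrow> func" where
  "to_func c = Fract c 1"

lemma cst_eq_0_iff [simp]: "cst c = 0 \<longleftrightarrow> c = 0"
  by (metis cst_0 ev_cst)

lemma comm_hom_to_func: "comm_hom to_func"
  by unfold_locales (simp_all add: to_func_def One_fract_def)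

interpretation tf: comm_hom to_func
  by (rule comm_hom_to_func)

lemma to_func_eq_0_iff [simp]: "to_func c = 0 \<longleftrightarrow> c = 0"
  by (simp add: to_func_def Zero_fract_def eq_fract)

lemma eps_Q_eq: "eps_Q = Poly_Mapping.map to_func"
  by (simp add: eps_Q_def to_func_def[abs_def])

lemmas eps_simps = tf.map_simps[folded eps_Q_eq]

lemma lookup_eps [simp]: "Poly_Mapping.lookup (eps_Q F) m = to_func (Poly_Mapping.lookup F m)"
  by (simp add: eps_Q_eq)

lemma eps_eq_0_iff: "eps_Q F = 0 \<longleftrightarrow> F = 0"
  by (metis lookup_eps lookup_zero poly_mapping_eqI to_func_eq_0_iff)

lemma eps_eq_iff: "eps_Q F = eps_Q G \<longleftrightarrow> F = G"
  using eps_eq_0_iff[of "F - G"] by (simp add: eps_simps)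

lemma eps_forms_iff: "eps_Q F \<in> forms d \<longleftrightarrow> F \<in> forms d"
  by (simp add: forms_iff)

definition A_pt :: "complex poly3 ^ 3" where
  "A_pt = (\<chi> i. var i)"

definition Q_pt :: "func ^ 3" where
  "Q_pt = (\<chi> i. to_func (A_pt $ i))"

definition const_pt :: "complex ^ 3 \<Rightarrow> complex poly3 ^ 3" where
  "const_pt v = (\<chi> i. cst (v $ i))"

definition func_pt :: "complex ^ 3 \<Rightarrow> func ^ 3" where
  "func_pt v = (\<chi> i. to_func (const_pt v $ i))"

lemma generic_point_eq: "generic_point = proj_point Q_pt"
  by (simp add: generic_point_def Q_pt_def A_pt_def to_func_def)

lemma inj_func_pt: "inj func_pt"
proof (rule injI)
  fix v w assume "func_pt v = func_pt w"
  then have "to_func (cst (v $ i) - cst (w $ i)) = 0" for i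
    unfolding tf.diff by (simp add: func_pt_def const_pt_def vec_eq_iff)
  then have "cst (v $ i - w $ i) = 0" for i by (simp add: cst_simps)
  then show "v = w" by (simp add: vec_eq_iff)
qed

text \<open>The part of \<open>NN\<close> at the generic point without denominators, whose elements
  can be specialized at complex points.\<close>

definition BN :: "(complex ^ 3) set \<Rightarrow> nat \<Rightarrow> biring set" where
  "BN V d = {F \<in> forms d. dd A_pt (dd A_pt F) = 0 \<and> (\<forall>v\<in>V. ev (const_pt v) F = 0)}"

lemma eps_dd: "eps_Q (dd A_pt F) = dd Q_pt (eps_Q F)"
  by (simp add: eps_Q_eq tf.map_dd Q_pt_def)

lemma ev_eps: "ev (func_pt v) (eps_Q F) = to_func (ev (const_pt v) F)"
  by (simp add: eps_Q_eq func_pt_def tf.ev_map)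

lemma eps_NN_iff: "eps_Q F \<in> NN Q_pt (func_pt ` V) d \<longleftrightarrow> F \<in> BN V d"
  by (simp add: NN_def BN_def eps_forms_iff ev_eps eps_eq_0_iff flip: eps_dd)

definition specialize :: "complex ^ 3 \<Rightarrow> biring \<Rightarrow> complex poly3" where
  "specialize v = Poly_Mapping.map (ev v)"

lemma comm_hom_specialize: "comm_hom (specialize v)"
  unfolding specialize_def by (rule comm_hom.comm_hom_map[OF comm_hom_ev])

lemmas specialize_simps = comm_hom.simps[OF comm_hom_specialize]

lemma specialize_dd: "specialize v (dd A_pt F) = dd v (specialize v F)"
  by (simp add: specialize_def comm_hom.map_dd[OF comm_hom_ev] A_pt_def ev_simps)

lemma ev_specialize: "ev w (specialize v F) = ev v (ev (const_pt w) F)"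
  using comm_hom.ev_map[OF comm_hom_ev, of v "const_pt w" F]
  by (simp add: specialize_def const_pt_def ev_simps)

lemma specialize_BN: "F \<in> BN V d \<Longrightarrow> specialize v F \<in> NN v V d"
  unfolding NN_def BN_def mem_Collect_eq
proof (elim conjE, intro conjI ballI)
  assume F: "F \<in> forms d" "dd A_pt (dd A_pt F) = 0" "\<forall>w\<in>V. ev (const_pt w) F = 0"
  show "specialize v F \<in> forms d"
    using F(1) by (simp add: specialize_def comm_hom.forms_map[OF comm_hom_ev])
  have "specialize v (dd A_pt (dd A_pt F)) = 0"
    by (simp only: F(2) specialize_simps)
  then show "dd v (dd v (specialize v F)) = 0" by (simp add: specialize_dd)
  show "ev w (specialize v F) = 0" if "w \<in> V" for w
    using F(3) that by (simp add: ev_specialize ev_simps)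
qed

lemma clear_denominators: "\<exists>c F. c \<noteq> 0 \<and> cst (to_func c) * f = eps_Q F"
proof (induction f rule: poly3_add_induct)
  case (single m x)
  obtain p q where x: "x = Fract p q" "q \<noteq> 0" by (cases x) auto
  have "cst (to_func q) * Poly_Mapping.single m x = eps_Q (Poly_Mapping.single m p)"
    by (rule poly_mapping_eqI)
      (use x in \<open>auto simp: lookup_single when_def to_func_def eq_fract Zero_fract_def\<close>)
  with x show ?case by blast
next
  case (add p q)
  then obtain c F c' F' where *: "c \<noteq> 0" "cst (to_func c) * p = eps_Q F" "c' \<noteq> 0" "cst (to_func c') * q = eps_Q F'"
    by blast
  have "cst (to_func (c * c')) * (p + q)
      = cst (to_func c') * (cst (to_func c) * p) + cst (to_func c) * (cst (to_func c') * q)"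
    by (simp add: tf.mult cst_simps algebra_simps)
  also have "\<dots> = eps_Q (cst c' * F + cst c * F')"
    by (simp add: * eps_simps)
  finally show ?case using * by (metis mult_eq_0_iff)
qed

text \<open>
  The determinant of two elements of \<open>NN Q Z\<close> over the ring of constants of \<open>dd Q\<close>, written
  without reference to a basis of the ambient module.
\<close>

definition wronskian :: "'k::comm_ring_1 ^ 3 \<Rightarrow> 'k poly3 \<Rightarrow> 'k poly3 \<Rightarrow> 'k poly3" where
  "wronskian Q f g = f * dd Q g - g * dd Q f"

text \<open>If it were 0, it would be a linear relation between \<open>f\<close> and
  \<open>g\<close> with coefficients \<open>dd Q g\<close> and \<open>- dd Q f\<close>, which are
  constants because second derivatives vanish.\<close>

lemma minimal_basis_wronskian:
  assumes "minimal_basis Q Z a b f g"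
  shows "wronskian Q f g \<noteq> 0"
proof
  assume w: "wronskian Q f g = 0"
  have fg: "dd Q (dd Q f) = 0" "dd Q (dd Q g) = 0"
    using assms by (auto simp: minimal_basis_def NN_def)
  note ind = minimal_basis_independent[OF assms]
  have "dd Q g = 0 \<and> - dd Q f = 0"
    by (rule ind) (use fg w in \<open>simp_all add: wronskian_def algebra_simps\<close>)
  then have "g = 0 \<and> - f = 0" by (intro ind) simp_all
  then show False using ind[of 1 0] by simp
qed

text \<open>\<open>N\<close> is a coefficient of the Wronskian after clearing denominators. If
  \<open>a' < a \<le> b\<close>, equality of the degree sums puts \<open>a\<close> and
  \<open>b\<close> below \<open>b'\<close>; both specialized generators are then multiples of
  \<open>f'\<close>, and their Wronskian vanishes.\<close>

lemma generic_degree_le: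
  assumes mb: "minimal_basis Q_pt (func_pt ` V) a b f g" and V: "finite V"
  shows "\<exists>N. N \<noteq> 0 \<and> (\<forall>v a' b' f' g'. ev v N \<noteq> 0 \<longrightarrow> minimal_basis v V a' b' f' g' \<longrightarrow> a' < a \<longrightarrow> b < a)"
proof -
  obtain c F where F: "c \<noteq> 0" "cst (to_func c) * f = eps_Q F" using clear_denominators by blast
  obtain e G where G: "e \<noteq> 0" "cst (to_func e) * g = eps_Q G" using clear_denominators by blast
  have "eps_Q F \<in> NN Q_pt (func_pt ` V) a" "eps_Q G \<in> NN Q_pt (func_pt ` V) b"
    using mb unfolding F(2)[symmetric] G(2)[symmetric] by (auto simp: minimal_basis_def intro: NN_cst_mult)
  then have FG: "F \<in> BN V a" "G \<in> BN V b" by (simp_all add: eps_NN_iff)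
  have "eps_Q (wronskian A_pt F G) = wronskian Q_pt (cst (to_func c) * f) (cst (to_func e) * g)"
    by (simp add: wronskian_def eps_simps eps_dd F G)
  also have "\<dots> = cst (to_func c) * cst (to_func e) * wronskian Q_pt f g"
    unfolding wronskian_def dd_cst_mult by (simp only: right_diff_distrib mult_ac)
  also have "\<dots> \<noteq> 0"
    using F(1) G(1) minimal_basis_wronskian[OF mb] by (simp add: cst_eq_0_iff)
  finally have "wronskian A_pt F G \<noteq> 0" by (auto simp: eps_simps)
  then obtain m where m: "Poly_Mapping.lookup (wronskian A_pt F G) m \<noteq> 0"
    by (metis lookup_zero poly_mapping_eqI)
  define N where "N = Poly_Mapping.lookup (wronskian A_pt F G) m"
  have "b < a" if v: "ev v N \<noteq> 0" and mb': "minimal_basis v V a' b' f' g'" and "a' < a" for v a' b' f' g'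
  proof (rule ccontr)
    assume "\<not> b < a"
    have card: "a + b = card V + 1" "a' + b' = card V + 1"
      using mb mb' card_image[OF inj_on_subset[OF inj_func_pt], of V] by (simp_all add: minimal_basis_def)
    with \<open>a' < a\<close> \<open>\<not> b < a\<close> have b': "a < b'" "b < b'" by auto
    obtain r s where "r \<in> GG v a' a" "s \<in> GG v b' a" "specialize v F = r * f' + s * g'"
      using minimal_basis_generates[OF mb' specialize_BN[OF FG(1)]] by blast
    with b' have r: "dd v r = 0" "specialize v F = r * f'" by (simp_all add: GG_def)
    obtain k s where "k \<in> GG v a' b" "s \<in> GG v b' b" "specialize v G = k * f' + s * g'"
      using minimal_basis_generates[OF mb' specialize_BN[OF FG(2)]] by blast
    with b' have k: "dd v k = 0" "specialize v G = k * f'" by (simp_all add: GG_def)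
    have "specialize v (wronskian A_pt F G) = wronskian v (r * f') (k * f')"
      by (simp add: wronskian_def specialize_simps specialize_dd r(2) k(2))
    also have "\<dots> = 0" by (simp add: wronskian_def dd_mult r(1) k(1) algebra_simps)
    finally have "Poly_Mapping.lookup (specialize v (wronskian A_pt F G)) m = 0" by simp
    with v show False by (simp add: specialize_def comm_hom.lookup_map_hom[OF comm_hom_ev] N_def)
  qed
  with m show ?thesis unfolding N_def by blast
qed

section \<open>Bihomogeneous polynomials\<close>

definition aforms :: "nat \<Rightarrow> biring set" where
  "aforms e = {F. \<forall>m. Poly_Mapping.lookup F m \<in> forms e}"

lemma aforms_0 [simp]: "0 \<in> aforms e"
  by (simp add: aforms_def)

lemma aforms_add: "F \<in> aforms e \<Longrightarrow> G \<in> aforms e \<Longrightarrow> F + G \<in> aforms e"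
  by (simp add: aforms_def lookup_add forms_add)

lemma aforms_diff: "F \<in> aforms e \<Longrightarrow> G \<in> aforms e \<Longrightarrow> F - G \<in> aforms e"
  by (simp add: aforms_def lookup_minus forms_diff)

lemma aforms_sum: "(\<And>x. x \<in> S \<Longrightarrow> f x \<in> aforms e) \<Longrightarrow> sum f S \<in> aforms e"
  by (induction S rule: infinite_finite_induct) (auto intro: aforms_add)

lemma aforms_single: "c \<in> forms e \<Longrightarrow> Poly_Mapping.single m c \<in> aforms e"
  by (simp add: aforms_def lookup_single when_def)

lemma aforms_cst: "c \<in> forms e \<Longrightarrow> cst c \<in> aforms e"
  by (simp add: cst_def aforms_single)

lemma aforms_var: "var i \<in> aforms 0"
  by (simp add: var_def aforms_single forms_1)

lemma aforms_mult:
  assumes "F \<in> aforms d" "G \<in> aforms e"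
  shows "F * G \<in> aforms (d + e)"
proof -
  have "F * G = (\<Sum>m\<in>Poly_Mapping.keys F. \<Sum>n\<in>Poly_Mapping.keys G.
     Poly_Mapping.single (m + n) (Poly_Mapping.lookup F m * Poly_Mapping.lookup G n))"
    by (subst sum_singles[of F, symmetric], subst sum_singles[of G, symmetric]) (simp add: sum_product mult_single)
  also have "\<dots> \<in> aforms (d + e)"
    using assms by (intro aforms_sum aforms_single forms_mult) (auto simp: aforms_def)
  finally show ?thesis .
qed

lemma aforms_induct [consumes 1, case_names zero single]:
  assumes "F \<in> aforms e" "P 0" "\<And>m c G. c \<in> forms e \<Longrightarrow> P G \<Longrightarrow> P (Poly_Mapping.single m c + G)"
  shows "P F"
proof -
  have "P (\<Sum>m\<in>S. Poly_Mapping.single m (Poly_Mapping.lookup F m))" if "finite S" for S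
    using that by (induction S rule: finite_induct) (use assms in \<open>auto simp: aforms_def\<close>)
  then show ?thesis using finite_keys[of F] sum_singles[of F] by metis
qed

definition dA :: "3 \<Rightarrow> biring \<Rightarrow> biring" where
  "dA i = Poly_Mapping.map (pd i)"

lemma lookup_dA [simp]: "Poly_Mapping.lookup (dA i F) m = pd i (Poly_Mapping.lookup F m)"
  by (simp add: dA_def map.rep_eq when_def)

lemma dA_simps [simp]:
  "dA i 0 = 0" "dA i (F + G) = dA i F + dA i G" "dA i (- F) = - dA i F" "dA i (F - G) = dA i F - dA i G"
  by (auto intro!: poly_mapping_eqI simp: lookup_add lookup_minus)

lemma dA_single: "dA i (Poly_Mapping.single m c) = Poly_Mapping.single m (pd i c)"
  by (rule poly_mapping_eqI) (simp add: lookup_single when_def)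

lemma dA_mult: "dA i (F * G) = dA i F * G + F * dA i G"
proof (induction F rule: poly3_add_induct)
  case (single m c)
  show ?case
    by (induction G rule: poly3_add_induct)
      (simp_all add: mult_single dA_single pd_mult single_add algebra_simps)
qed (simp add: algebra_simps)

lemma dA_var [simp]: "dA i (var j) = 0"
  using pd_1 by (simp add: var_def dA_single)

lemma dA_cst: "dA i (cst c) = cst (pd i c)"
  by (simp add: cst_def dA_single)

lemma dA_commute: "dA i (dA j F) = dA j (dA i F)"
  by (rule poly_mapping_eqI) (simp add: pd_commute)

lemma pd_of_nat [simp]: "pd i (of_nat n) = 0"
  by (induction n) simp_all

lemma pd_of_nat_mult: "pd i (of_nat n * c) = of_nat n * pd i c"
  by (simp add: pd_mult)

lemma dA_pd_commute: "dA i (pd j F) = pd j (dA i F)"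
  by (rule poly_mapping_eqI) (simp add: lookup_pd pd_of_nat_mult del: of_nat_Suc of_nat_add)

lemma forms_dA: "F \<in> forms d \<Longrightarrow> dA i F \<in> forms d"
  unfolding forms_iff lookup_dA using pd_0 by metis

lemma aforms_dA: "F \<in> aforms e \<Longrightarrow> dA i F \<in> aforms (e - 1)"
  by (simp add: aforms_def forms_pd)

lemma aforms_pd: "F \<in> aforms e \<Longrightarrow> pd i F \<in> aforms e"
proof (induction rule: aforms_induct)
  case (single m c G)
  have "of_nat n * c \<in> forms e" for n
    using forms_cst_mult[OF single(1), of "of_nat n"] by (simp add: cst_simps)
  then show ?case using single by (simp add: pd_single aforms_add aforms_single)
qed simp

lemma euler_A:
  assumes "F \<in> aforms e"
  shows "(\<Sum>i\<in>UNIV. cst (var i) * dA i F) = of_nat e * F"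
proof (rule poly_mapping_eqI)
  fix m
  have eq: "of_nat e = (cst (of_nat e) :: biring)" by (simp add: cst_simps(10))
  show "Poly_Mapping.lookup (\<Sum>i\<in>UNIV. cst (var i) * dA i F) m = Poly_Mapping.lookup (of_nat e * F) m"
    using assms euler[of "Poly_Mapping.lookup F m" e] unfolding eq by (simp add: lookup_sum aforms_def)
qed

text \<open>The points of Z do not involve the A_i. This is why polarization in the A_i preserves
  vanishing at Z.\<close>

lemma ev_dA: "ev (const_pt v) (dA i F) = pd i (ev (const_pt v) F)"
proof (induction F rule: poly3_add_induct)
  case (single m c)
  have *: "ev (const_pt v) (Poly_Mapping.single m c) = c * cst (\<Prod>i\<in>UNIV. v $ i ^ Poly_Mapping.lookup m i)" for c
    by (simp add: single_conv_var ev_simps const_pt_def cst_simps)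
  show ?case unfolding dA_single * by (simp add: pd_mult)
qed (simp add: ev_simps)

lemma forms_ev_const:
  "F \<in> aforms e \<Longrightarrow> ev (const_pt v) F \<in> forms e"
proof (induction rule: aforms_induct)
  case (single m c G)
  have *: "ev (const_pt v) (Poly_Mapping.single m c) = cst (\<Prod>i\<in>UNIV. v $ i ^ Poly_Mapping.lookup m i) * c" for c
    by (simp add: single_conv_var ev_simps const_pt_def cst_simps)
  show ?case using single by (simp add: ev_simps(3) * forms_add forms_cst_mult)
qed (simp add: ev_simps)

lemma aforms_dd: "F \<in> aforms e \<Longrightarrow> dd A_pt F \<in> aforms (e + 1)"
  unfolding dd_def
proof (rule aforms_sum)
  fix i assume "F \<in> aforms e"
  then have "cst (A_pt $ i) * pd i F \<in> aforms (1 + e)"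
    by (intro aforms_mult aforms_cst aforms_pd) (simp_all add: A_pt_def forms_var)
  then show "cst (A_pt $ i) * pd i F \<in> aforms (e + 1)" by (simp add: add.commute)
qed

text \<open>The grading by the degree in the \<open>A\<^sub>i\<close>, as the homomorphism \<open>A\<^sub>i \<mapsto> T A\<^sub>i\<close> into polynomials in \<open>T\<close>.\<close>

definition gr0 :: "complex poly3 \<Rightarrow> biring poly" where
  "gr0 = poly_eval (\<lambda>c. [:cst (cst c):]) (\<chi> i. monom (cst (var i)) 1)"

definition gr :: "biring \<Rightarrow> biring poly" where
  "gr = poly_eval gr0 (\<chi> i. [:var i:])"

lemma comm_hom_cst_cst: "comm_hom (\<lambda>c. cst (cst c))"
  by (rule comm_hom_comp[OF comm_hom_cst comm_hom_cst])

lemma comm_hom_const_poly: "comm_hom (\<lambda>c. [:cst (cst c):])"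
  by unfold_locales (simp_all add: cst_simps one_pCons)

lemma comm_hom_gr0: "comm_hom gr0"
  unfolding gr0_def by (rule comm_hom.comm_hom_poly_eval[OF comm_hom_const_poly])

lemma comm_hom_gr: "comm_hom gr"
  unfolding gr_def by (rule comm_hom.comm_hom_poly_eval[OF comm_hom_gr0])

lemmas gr0_simps = comm_hom.simps[OF comm_hom_gr0]
lemmas gr_simps = comm_hom.simps[OF comm_hom_gr]

lemma gr0_cst: "gr0 (cst c) = [:cst (cst c):]" and gr0_var: "gr0 (var i) = monom (cst (var i)) 1"
  by (simp_all add: gr0_def comm_hom.poly_eval_cst[OF comm_hom_const_poly] comm_hom.poly_eval_var[OF comm_hom_const_poly])

lemma gr_cst: "gr (cst c) = gr0 c" and gr_var: "gr (var i) = [:var i:]"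
  by (simp_all add: gr_def comm_hom.poly_eval_cst[OF comm_hom_gr0] comm_hom.poly_eval_var[OF comm_hom_gr0])

lemma gr0_forms: "c \<in> forms e \<Longrightarrow> gr0 c = monom (cst c) e"
proof (induction rule: forms_induct)
  case (var k q i)
  then show ?case by (simp add: gr0_simps gr0_var mult_monom cst_simps One_nat_def)
qed (simp_all add: gr0_simps gr0_cst monom_0 cst_simps add_monom)

lemma gr_single: "gr (Poly_Mapping.single m c) = gr0 c * [:Poly_Mapping.single m 1:]"
proof -
  have "[:x:] ^ n = [:x ^ n:]" for x :: biring and n by (induction n) (simp_all add: one_pCons)
  then show ?thesis
    by (simp add: single_conv_var[of m] gr_simps gr_cst gr_var prod_3_from_0 mult_ac)
qed

lemma single_cst_mult: "cst c * Poly_Mapping.single m 1 = Poly_Mapping.single m c"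
  by (simp add: cst_def mult_single)

lemma gr_aforms: "F \<in> aforms e \<Longrightarrow> gr F = monom F e"
proof (induction rule: aforms_induct)
  case (single m c G)
  have "[:Poly_Mapping.single m (1 :: complex poly3):] = monom (Poly_Mapping.single m 1) 0"
    by (simp add: monom_0)
  then have "gr (Poly_Mapping.single m c) = monom (Poly_Mapping.single m c) e"
    using single(1) by (simp add: gr_single gr0_forms mult_monom single_cst_mult)
  with single(2) show ?case by (simp add: gr_simps add_monom)
qed (simp add: gr_simps)

lemma coeff_gr0: "\<exists>d \<in> forms k. poly.coeff (gr0 c) k = cst d"
proof (induction c rule: poly3_add_induct)
  case (single m x)
  have "gr0 (Poly_Mapping.single m x) = monom (cst (Poly_Mapping.single m x)) (tdeg m)"
    by (rule gr0_forms) (simp add: forms_single)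
  then show ?case
    by (cases "k = tdeg m") (auto simp: forms_single intro: bexI[of _ "Poly_Mapping.single m x"] bexI[of _ 0])
next
  case (add p q)
  then obtain d e where "d \<in> forms k" "e \<in> forms k" "poly.coeff (gr0 p) k = cst d" "poly.coeff (gr0 q) k = cst e"
    by blast
  then show ?case by (auto simp: gr0_simps cst_simps intro!: bexI[of _ "d + e"] forms_add)
qed

lemma coeff_gr_aforms: "poly.coeff (gr F) k \<in> aforms k"
proof (induction F rule: poly3_add_induct)
  case (single m c)
  obtain d where "d \<in> forms k" "poly.coeff (gr0 c) k = cst d" using coeff_gr0 by blast
  then show ?case
    by (simp add: gr_single mult.commute[of "Poly_Mapping.single m 1"] single_cst_mult aforms_single)
qed (simp add: gr_simps aforms_add)

lemma coeff_gr_forms: "F \<in> forms d \<Longrightarrow> poly.coeff (gr F) k \<in> forms d"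
proof (induction rule: forms_induct)
  case (cst c)
  obtain e where "poly.coeff (gr0 c) k = cst e" using coeff_gr0 by blast
  then show ?case by (simp add: gr_cst forms_cst)
next
  case (var l q i)
  then show ?case using forms_mult[OF forms_var[of i], of _ l] by (simp add: gr_simps gr_var One_nat_def)
qed (simp_all add: gr_simps forms_add)

lemma poly_gr_1: "poly (gr F) 1 = F"
proof -
  have *: "poly (gr0 c) 1 = cst c" for c
    by (rule comm_hom_ext[where f = "\<lambda>c. poly (gr0 c) 1"])
      (unfold_locales, simp_all add: gr0_simps gr0_cst gr0_var cst_simps poly_monom)
  show ?thesis
    by (rule comm_hom_ext[where f = "\<lambda>F. poly (gr F) 1" and g = "\<lambda>F. F"])
      (unfold_locales, simp_all add: gr_simps gr_cst gr_var *)
qed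

lemma gr_eq_0_iff: "gr F = 0 \<longleftrightarrow> F = 0"
  by (metis poly_0 poly_gr_1 gr_simps(1))

lemma sum_coeff_gr: "(\<Sum>k\<le>degree (gr F). poly.coeff (gr F) k) = F"
  using poly_gr_1[of F] by (simp add: poly_altdef)

text \<open>The shift \<open>c\<close> allows for operators such as \<open>dd A_pt\<close> that
  raise the degree in the A_i.\<close>

lemma aforms_sum_eq_0:
  assumes "(\<Sum>k\<le>n. G k) = 0" "\<And>k. G k \<in> aforms (k + c)" "j \<le> n"
  shows "G j = 0"
proof -
  have "(\<Sum>k\<le>n. monom (G k) (k + c)) = 0"
    using arg_cong[OF assms(1), of gr] gr_aforms[OF assms(2)] by (simp add: gr_simps)
  then have "poly.coeff (\<Sum>k\<le>n. monom (G k) (k + c)) (j + c) = 0" by simp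
  then show ?thesis using assms(3) by (simp add: coeff_sum coeff_monom)
qed

text \<open>The equations defining \<open>BN\<close> are homogeneous in the A_i, so they hold for
  each graded component.\<close>

lemma coeff_gr_BN:
  assumes "F \<in> BN V a"
  shows "poly.coeff (gr F) k \<in> BN V a"
proof (cases "k \<le> degree (gr F)")
  case True
  let ?n = "degree (gr F)" and ?c = "poly.coeff (gr F)"
  have "(\<Sum>k\<le>?n. dd A_pt (dd A_pt (?c k))) = 0"
    using assms arg_cong[OF sum_coeff_gr, of "\<lambda>F. dd A_pt (dd A_pt F)" F] by (simp add: BN_def dd_sum)
  moreover have "dd A_pt (dd A_pt (?c k)) \<in> aforms (k + 2)" for k
    using aforms_dd[OF aforms_dd[OF coeff_gr_aforms]] by (simp add: add.assoc)
  ultimately have 1: "dd A_pt (dd A_pt (?c k)) = 0" by (rule aforms_sum_eq_0) fact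
  have 2: "ev (const_pt v) (?c k) = 0" if "v \<in> V" for v
  proof -
    have "(\<Sum>k\<le>?n. cst (ev (const_pt v) (?c k))) = 0"
      using assms that arg_cong[OF sum_coeff_gr, of "\<lambda>F. cst (ev (const_pt v) F)" F]
      by (simp add: BN_def ev_simps cst_simps)
    moreover have "cst (ev (const_pt v) (?c k)) \<in> aforms (k + 0)" for k
      by (simp add: aforms_cst forms_ev_const coeff_gr_aforms)
    ultimately have "cst (ev (const_pt v) (?c k)) = 0" by (rule aforms_sum_eq_0) fact
    then show ?thesis by simp
  qed
  show ?thesis using assms 1 2 by (simp add: BN_def coeff_gr_forms)
next
  case False
  then show ?thesis by (simp add: coeff_eq_0 BN_def ev_simps)
qed

lemma BN_cst_cancel:
  assumes "cst c * F \<in> BN V a" "c \<noteq> 0"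
  shows "F \<in> BN V a"
  using assms by (simp add: BN_def forms_iff ev_simps)

text \<open>Take least degree in the A_i: dividing by a prime of positive degree would give a
  nonzero element of smaller degree.\<close>

lemma minimal_bihomogeneous:
  assumes "F \<in> BN V a" "F \<noteq> 0"
  shows "\<exists>F e. F \<in> BN V a \<and> F \<noteq> 0 \<and> F \<in> aforms e \<and> (\<forall>\<pi>. prime_elem \<pi> \<longrightarrow> \<not> cst \<pi> dvd F)"
proof -
  let ?P = "\<lambda>e. \<exists>F. F \<in> BN V a \<and> F \<noteq> 0 \<and> F \<in> aforms e"
  have "?P (degree (gr F))"
    using assms coeff_gr_BN coeff_gr_aforms gr_eq_0_iff[of F] by (metis leading_coeff_0_iff)
  then have "?P (LEAST e. ?P e)" by (rule LeastI)
  then obtain e F where e: "e = (LEAST e. ?P e)" and F: "F \<in> BN V a" "F \<noteq> 0" "F \<in> aforms e" by blast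
  have least: "e \<le> k" if "G \<in> BN V a" "G \<noteq> 0" "G \<in> aforms k" for G k
    unfolding e by (rule Least_le) (use that in blast)
  have "\<not> cst \<pi> dvd F" if "prime_elem \<pi>" for \<pi>
  proof
    assume "cst \<pi> dvd F"
    then obtain F1 where F1: "F = cst \<pi> * F1" by (rule dvdE)
    have m: "monom F e = gr0 \<pi> * gr F1"
      using gr_aforms[OF F(3)] by (simp add: F1 gr_simps gr_cst)
    \<comment> \<open>The cofactor \<open>F1\<close> is replaced by its top component, which is
      homogeneous by construction; the product of the top components is still
      \<open>F\<close>.\<close>
    let ?G = "lead_coeff (gr F1)"
    obtain d where d: "d \<in> forms (degree (gr0 \<pi>))" "lead_coeff (gr0 \<pi>) = cst d" using coeff_gr0 by blast
    have "lead_coeff (monom F e) = cst d * ?G"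
      unfolding m by (simp add: lead_coeff_mult d)
    then have FG: "F = cst d * ?G" using F(2) by (simp add: degree_monom_eq)
    with F have "d \<noteq> 0" "?G \<noteq> 0" by auto
    with F FG have "?G \<in> BN V a" by (metis BN_cst_cancel)
    then have "e \<le> degree (gr F1)" using \<open>?G \<noteq> 0\<close> coeff_gr_aforms by (rule least)
    moreover have "degree (gr0 \<pi> * gr F1) = e" using F(2) by (simp add: degree_monom_eq flip: m)
    moreover have nz: "gr0 \<pi> \<noteq> 0" "gr F1 \<noteq> 0" using m F(2) by auto
    ultimately have "degree (gr0 \<pi>) = 0" by (simp add: degree_mult_eq)
    then have "gr0 \<pi> = [:cst d:]" using d(2) by (metis degree_eq_zeroE coeff_pCons_0)
    then have "poly (gr (cst \<pi>)) 1 = cst d" by (simp add: gr_cst)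
    then have "cst \<pi> = cst d" unfolding poly_gr_1 .
    then have "\<pi> = d" by (metis ev_cst)
    with d \<open>degree (gr0 \<pi>) = 0\<close> obtain x where x: "\<pi> = cst x" using forms_zero_conv by auto
    with \<open>d \<noteq> 0\<close> \<open>\<pi> = d\<close> have "x \<noteq> 0" by auto
    then have "\<pi> * cst (inverse x) = 1" by (simp add: x flip: cst_simps(4))
    then have "\<pi> dvd 1" by (intro dvdI) (rule sym)
    with that show False by (simp add: prime_elem_def)
  qed
  with F show ?thesis by blast
qed

section \<open>Polarization\<close>

definition DD :: "biring \<Rightarrow> biring" where
  "DD F = (\<Sum>i\<in>UNIV. var i * dA i F)"

lemma DD_simps [simp]: "DD 0 = 0" "DD (F + G) = DD F + DD G" "DD (F - G) = DD F - DD G"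
  by (simp_all add: DD_def sum.distrib sum_subtractf algebra_simps)

lemma forms_DD: "F \<in> forms d \<Longrightarrow> DD F \<in> forms (d + 1)"
  unfolding DD_def
proof (rule forms_sum)
  fix i :: 3 assume "F \<in> forms d"
  then show "var i * dA i F \<in> forms (d + 1)"
    using forms_mult[OF forms_var forms_dA, of F d i i] by (simp add: add.commute)
qed

lemma aforms_DD: "F \<in> aforms e \<Longrightarrow> DD F \<in> aforms (e - 1)"
  unfolding DD_def
proof (rule aforms_sum)
  fix i :: 3 assume "F \<in> aforms e"
  then show "var i * dA i F \<in> aforms (e - 1)"
    using aforms_mult[OF aforms_var aforms_dA, of F e i i] by simp
qed

lemma DD_aforms_0: "F \<in> aforms 0 \<Longrightarrow> DD F = 0"
proof -
  assume F: "F \<in> aforms 0"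
  have "dA i F = 0" for i
  proof (rule poly_mapping_eqI)
    fix m
    obtain c where "Poly_Mapping.lookup F m = cst c"
      using F forms_zero_conv unfolding aforms_def by blast
    then show "Poly_Mapping.lookup (dA i F) m = Poly_Mapping.lookup 0 m" by simp
  qed
  then show ?thesis by (simp add: DD_def)
qed

text \<open>Comparing the degrees in the \<open>A\<^sub>i\<close>: polarization lowers this degree.\<close>

lemma DD_eq_0_of_dvd:
  assumes "F \<in> aforms e" "F dvd DD F"
  shows "DD F = 0"
proof (rule ccontr)
  assume nz: "DD F \<noteq> 0"
  then have "e \<noteq> 0" using DD_aforms_0 assms(1) by metis
  obtain L where L: "DD F = F * L" using assms(2) by (rule dvdE)
  have *: "monom (DD F) (e - 1) = monom F e * gr L"
    using gr_aforms[OF aforms_DD[OF assms(1)]] gr_aforms[OF assms(1)] by (simp add: L gr_simps)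
  moreover have "F \<noteq> 0" "gr L \<noteq> 0" using nz L by (auto simp: gr_eq_0_iff)
  ultimately have "degree (monom (DD F) (e - 1)) = e + degree (gr L)"
    by (simp add: degree_mult_eq degree_monom_eq)
  then show False using nz \<open>e \<noteq> 0\<close> by (simp add: degree_monom_eq)
qed

lemma dd_A_pt: "dd A_pt F = (\<Sum>i\<in>UNIV. cst (var i) * pd i F)"
  by (simp add: dd_def A_pt_def)

lemma pd_DD: "pd j (DD F) = dA j F + DD (pd j F)"
  by (cases j rule: exhaust_3_from_0) (simp_all add: DD_def sum_3_from_0 pd_mult pd_var dA_pd_commute algebra_simps)

text \<open>The two polarizations and the difference of the Euler operators form a copy of \<open>sl\<^sub>2\<close>.\<close>

lemma dd_DD:
  assumes "F \<in> forms a" "F \<in> aforms e"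
  shows "dd A_pt (DD F) = DD (dd A_pt F) + (of_nat e - of_nat a) * F"
proof -
  have "dd A_pt (DD F) = (\<Sum>j\<in>UNIV. cst (var j) * dA j F) + (\<Sum>j\<in>UNIV. cst (var j) * DD (pd j F))"
    by (simp add: dd_A_pt pd_DD algebra_simps sum.distrib)
  also have "(\<Sum>j\<in>UNIV. cst (var j) * dA j F) = of_nat e * F"
    by (rule euler_A) fact
  also have "(\<Sum>j\<in>UNIV. cst (var j) * DD (pd j F)) = DD (dd A_pt F) - (\<Sum>j\<in>UNIV. var j * pd j F)"
    by (simp add: dd_A_pt DD_def sum_3_from_0 dA_mult dA_cst pd_var algebra_simps)
  also have "(\<Sum>j\<in>UNIV. var j * pd j F) = of_nat a * F"
    by (rule euler) fact
  finally show ?thesis by (simp add: algebra_simps)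
qed

text \<open>Apply \<open>dd_DD\<close> to \<open>F\<close> and to \<open>dd A_pt F\<close>, of
  degrees \<open>a - 1\<close> and \<open>e + 1\<close>. The two contributions e - a and e + 2 - a
  add up to twice e + 1 - a.\<close>

lemma dd_dd_DD:
  assumes "F \<in> forms a" "F \<in> aforms e" "dd A_pt (dd A_pt F) = 0"
  shows "dd A_pt (dd A_pt (DD F)) = 2 * (of_nat (e + 1) - of_nat a) * dd A_pt F"
proof -
  have k: "dd A_pt (of_nat n * G) = of_nat n * dd A_pt G" for n and G :: biring
    using dd_cst_mult[of A_pt "of_nat n" G] by (simp add: cst_simps)
  \<comment> \<open>For \<open>a = 0\<close> the truncated difference is wrong, but then
    \<open>dd A_pt F\<close> is 0.\<close>
  have "(of_nat (a - 1) :: biring) * dd A_pt F = (of_nat a - 1) * dd A_pt F"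
  proof (cases a)
    case 0
    with assms(1) forms_zero_conv obtain c where "F = cst c" by blast
    then show ?thesis by simp
  qed simp
  moreover have "dd A_pt (DD (dd A_pt F)) = (of_nat (e + 1) - of_nat (a - 1)) * dd A_pt F"
    using dd_DD[OF forms_dd[OF assms(1)] aforms_dd[OF assms(2)]] assms(3) by (simp only: DD_simps add_0)
  ultimately have "dd A_pt (DD (dd A_pt F)) = (of_nat (e + 1) - (of_nat a - 1)) * dd A_pt F"
    by (simp only: left_diff_distrib)
  then show ?thesis
    unfolding dd_DD[OF assms(1,2)] by (simp add: left_diff_distrib k) (simp add: algebra_simps)
qed

text \<open>
  The correction term makes the polarization of an element of \<open>BN V a\<close> an element of
  \<open>BN V (a + 1)\<close>; the gap between the degrees of the minimal basis then forces it to be a multiple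
  of \<open>F\<close>.
\<close>

lemma corrected_DD_BN:
  assumes F: "F \<in> BN V a" and e: "F \<in> aforms e"
  shows "cst (var 0) * DD F - (of_nat (e + 1) - of_nat a) * (var 0 * F) \<in> BN V (a + 1)"
    (is "?H \<in> _")
proof -
  define k :: complex where "k = of_nat (e + 1) - of_nat a"
  have k: "(of_nat (e + 1) - of_nat a :: biring) = cst (cst k)"
    by (simp add: k_def cst_simps)
  have Ff: "F \<in> forms a" "dd A_pt (dd A_pt F) = 0" using F by (auto simp: BN_def)
  have "cst (var 0) * DD F \<in> forms (a + 1)" "cst (cst k) * (var 0 * F) \<in> forms (a + 1)"
    using forms_mult[OF forms_var Ff(1), of 0] forms_DD[OF Ff(1)]
    by (auto intro!: forms_cst_mult simp: add.commute)
  then have 1: "?H \<in> forms (a + 1)" unfolding k by (rule forms_diff)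
  have A0: "A_pt $ 0 = var 0" by (simp add: A_pt_def)
  \<comment> \<open>This fixes the correction: its factor A_0 is matched by multiplying
    \<open>DD F\<close> with \<open>cst (var 0)\<close>.\<close>
  have "dd A_pt (dd A_pt (var 0 * F)) = 2 * (cst (var 0) * dd A_pt F)"
    using Ff(2) by (simp add: dd_mult A0 algebra_simps)
  then have "dd A_pt (dd A_pt ?H) = 0"
    using dd_dd_DD[OF Ff(1) e Ff(2)] unfolding k by (simp only: dd_simps dd_cst_mult) (simp add: mult_ac)
  moreover have "ev (const_pt v) ?H = 0" if "v \<in> V" for v
    using F that by (simp add: BN_def ev_simps DD_def ev_dA)
  ultimately show ?thesis using 1 by (simp add: BN_def)
qed

section \<open>Capelli's identity\<close>

abbreviation minors :: "biring ^ 3" where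
  "minors \<equiv> \<chi> j. maximal_minor A_vec X_vec j"

text \<open>Cayley's Omega operators: the maximal minors of the matrix of derivations with rows
  \<open>dA\<close> and \<open>pd\<close>.\<close>

definition Om :: "3 \<Rightarrow> biring \<Rightarrow> biring" where
  "Om j F = (if j = 0 then dA 1 (pd 2 F) - dA 2 (pd 1 F)
     else if j = 1 then dA 0 (pd 2 F) - dA 2 (pd 0 F)
     else dA 0 (pd 1 F) - dA 1 (pd 0 F))"

lemma minors_simps:
  "minors $ 0 = cst (var 1) * var 2 - cst (var 2) * var 1"
  "minors $ 1 = cst (var 0) * var 2 - cst (var 2) * var 0"
  "minors $ 2 = cst (var 0) * var 1 - cst (var 1) * var 0"
  by (simp_all add: maximal_minor_def A_vec_def X_vec_def)

text \<open>Without the hypothesis on \<open>DD F\<close> the left side differs by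
  \<open>dd A_pt (DD F)\<close> from the Euler operator in the A_i applied after the Euler operator
  in the X_i plus one.\<close>

lemma capelli:
  assumes "F \<in> forms d" "F \<in> aforms e" "DD F = 0"
  shows "(\<Sum>j\<in>UNIV. minors $ j * Om j F) = of_nat (e * (d + 1)) * F"
proof -
  let ?E = "\<Sum>i\<in>UNIV. cst (var i) * dA i (\<Sum>j\<in>UNIV. var j * pd j F)"
  have "(\<Sum>j\<in>UNIV. minors $ j * Om j F) + dd A_pt (DD F) = ?E + (\<Sum>i\<in>UNIV. cst (var i) * dA i F)"
    unfolding sum_3_from_0 minors_simps
    by (simp add: Om_def dd_A_pt DD_def sum_3_from_0 pd_mult pd_var dA_mult dA_pd_commute algebra_simps)
  moreover have "(\<Sum>j\<in>UNIV. var j * pd j F) = of_nat d * F"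
    by (rule euler) fact
  moreover have "of_nat d * F \<in> aforms e"
    using aforms_mult[OF aforms_cst[OF forms_cst, of "of_nat d"] assms(2)] by (simp add: cst_simps)
  ultimately have "(\<Sum>j\<in>UNIV. minors $ j * Om j F) = of_nat e * (of_nat d * F) + of_nat e * F"
    using euler_A assms(2,3) by simp
  then show ?thesis by (simp add: algebra_simps)
qed

text \<open>On the kernel of \<open>DD\<close>, commuting \<open>DD\<close> past \<open>pd b\<close>
  leaves \<open>- dA b\<close>. The resulting second derivatives in the A_i are symmetric and cancel
  in the antisymmetric operator.\<close>

lemma DD_Om:
  assumes "DD F = 0"
  shows "DD (Om j F) = 0"
proof -
  have "DD (pd b F) = - dA b F" for b
    using pd_DD[of b F] assms by (simp add: eq_neg_iff_add_eq_0 add.commute)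
  moreover have "DD (dA a G) = dA a (DD G)" for a G
    by (simp add: DD_def sum_3_from_0 dA_mult dA_commute)
  ultimately have "DD (dA a (pd b F)) = - dA a (dA b F)" for a b
    by simp
  then show ?thesis
    by (simp add: Om_def) (simp add: dA_commute)
qed

lemma forms_Om: "F \<in> forms d \<Longrightarrow> Om j F \<in> forms (d - 1)"
  by (simp add: Om_def forms_diff forms_dA forms_pd)

lemma aforms_Om: "F \<in> aforms e \<Longrightarrow> Om j F \<in> aforms (e - 1)"
  by (simp add: Om_def aforms_diff aforms_dA aforms_pd)

abbreviation at_minors :: "complex poly3 \<Rightarrow> biring" where
  "at_minors \<equiv> poly_eval (\<lambda>c. cst (cst c)) minors"

lemmas at_minors_simps = comm_hom.poly_eval_simps[OF comm_hom_cst_cst, of minors]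

text \<open>Induction on the degree in the A_i: the Omega operators lower both degrees by one and
  stay in the kernel, and Capelli's identity recovers \<open>F\<close> from their values.\<close>

lemma kernel_of_DD:
  assumes "F \<in> forms (l + 1)" "F \<in> aforms l" "DD F = 0"
  shows "\<exists>h. (\<forall>i. h i \<in> forms l) \<and> F = (\<Sum>i\<in>UNIV. var i * at_minors (h i))"
  using assms
proof (induction l arbitrary: F)
  case 0
  have F: "F = (\<Sum>i\<in>UNIV. var i * pd i F)"
    using euler[of F 1] 0(1) by simp
  have "\<exists>k. pd i F = cst (cst k)" for i
  proof -
    have "pd i F \<in> forms 0" using forms_pd[of F 1 i] 0(1) by simp
    then obtain c where c: "pd i F = cst c" using forms_zero_conv by blast
    have "Poly_Mapping.lookup (cst c) 0 \<in> forms 0"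
      using aforms_pd[OF 0(2), of i] unfolding c aforms_def by blast
    then have "c \<in> forms 0" by (simp add: cst_def)
    then show ?thesis using c forms_zero_conv by blast
  qed
  then have "\<forall>i. \<exists>k. pd i F = cst (cst k)" by blast
  from choice[OF this] obtain k where k: "\<And>i. pd i F = cst (cst (k i))" by blast
  show ?case
    by (intro exI[of _ "\<lambda>i. cst (k i)"] conjI allI forms_cst, subst F)
      (simp only: k comm_hom.poly_eval_cst[OF comm_hom_cst_cst])
next
  case (Suc l)
  have "\<exists>h. (\<forall>i. h i \<in> forms l) \<and> Om j F = (\<Sum>i\<in>UNIV. var i * at_minors (h i))" for j
    using Suc.prems forms_Om[of F _ j] aforms_Om[of F _ j] by (intro Suc.IH DD_Om) fastforce+
  then have "\<forall>j. \<exists>h. (\<forall>i. h i \<in> forms l) \<and> Om j F = (\<Sum>i\<in>UNIV. var i * at_minors (h i))"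
    by blast
  from choice[OF this] obtain h where h: "\<And>j i. h j i \<in> forms l"
    "\<And>j. Om j F = (\<Sum>i\<in>UNIV. var i * at_minors (h j i))" by blast
  \<comment> \<open>The integer of Capelli's identity for degree \<open>Suc l\<close> in the A_i and
    \<open>Suc l + 1\<close> in the X_i.\<close>
  let ?n = "Suc l * (Suc l + 1 + 1)"
  define k :: complex where "k = inverse (of_nat ?n)"
  have n0: "(of_nat ?n :: complex) \<noteq> 0" unfolding of_nat_eq_0_iff by simp
  have "cst (cst k) * of_nat ?n = (cst (cst (k * of_nat ?n)) :: biring)"
    unfolding cst_simps(4) cst_simps(10) ..
  also have "k * of_nat ?n = 1" unfolding k_def using n0 by (rule left_inverse)
  finally have k: "cst (cst k) * of_nat ?n = (1 :: biring)" by simp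
  have "F = cst (cst k) * (of_nat ?n * F)" using k by (simp only: mult.assoc[symmetric] mult_1)
  also have "of_nat ?n * F = (\<Sum>j\<in>UNIV. minors $ j * Om j F)"
    using capelli[OF Suc.prems] by simp
  also have "cst (cst k) * \<dots> = (\<Sum>i\<in>UNIV. var i * at_minors (cst k * (\<Sum>j\<in>UNIV. var j * h j i)))"
    unfolding h(2) at_minors_simps by (simp only: sum_3_from_0 algebra_simps)
  finally have 1: "F = (\<Sum>i\<in>UNIV. var i * at_minors (cst k * (\<Sum>j\<in>UNIV. var j * h j i)))" .
  have 2: "cst k * (\<Sum>j\<in>UNIV. var j * h j i) \<in> forms (Suc l)" for i
    using forms_mult[OF forms_var h(1)] by (intro forms_cst_mult forms_sum) (simp add: One_nat_def)
  show ?case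
    using 1 2 by (intro exI[of _ "\<lambda>i. cst k * (\<Sum>j\<in>UNIV. var j * h j i)"] conjI allI)
qed

section \<open>The modules of the generic point\<close>

lemma ev_const_single:
  "ev (const_pt v) (Poly_Mapping.single m c) = cst (\<Prod>i\<in>UNIV. v $ i ^ Poly_Mapping.lookup m i) * c"
  by (simp add: single_conv_var ev_simps const_pt_def cst_simps)

text \<open>Expand \<open>F\<close> by monomials in the A_i. As the points have scalar coordinates,
  each coefficient is a complex form vanishing on \<open>V\<close>.\<close>

lemma extend_cst_vanishing_ideal:
  assumes F: "F \<in> forms d" "\<And>v. v \<in> V \<Longrightarrow> ev (const_pt v) F = 0"
  shows "F \<in> extend_ideal cst (vanishing_ideal (proj_point ` V))"
proof -
  have L: "Poly_Mapping.lookup (Poly_Mapping.map (\<lambda>c. Poly_Mapping.lookup c \<alpha>) G) m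
      = Poly_Mapping.lookup (Poly_Mapping.lookup G m) \<alpha>" for \<alpha> m and G :: biring
    by (simp add: map.rep_eq when_def)
  define coef where "coef \<alpha> = Poly_Mapping.map (\<lambda>c. Poly_Mapping.lookup c \<alpha>) F" for \<alpha>
  have l: "Poly_Mapping.lookup (coef \<alpha>) m = Poly_Mapping.lookup (Poly_Mapping.lookup F m) \<alpha>" for \<alpha> m
    by (simp add: coef_def L)
  have "ev v (Poly_Mapping.map (\<lambda>c. Poly_Mapping.lookup c \<alpha>) G) = Poly_Mapping.lookup (ev (const_pt v) G) \<alpha>" for v \<alpha> G
  proof (induction G rule: poly3_add_induct)
    case (single m c)
    have "Poly_Mapping.map (\<lambda>c. Poly_Mapping.lookup c \<alpha>) (Poly_Mapping.single m c)
        = Poly_Mapping.single m (Poly_Mapping.lookup c \<alpha>)"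
      by (rule poly_mapping_eqI) (simp add: L lookup_single when_def)
    then show ?case
      unfolding ev_const_single by (simp add: single_conv_var[of m] ev_simps)
  next
    case (add p q)
    have "Poly_Mapping.map (\<lambda>c. Poly_Mapping.lookup c \<alpha>) (p + q)
        = Poly_Mapping.map (\<lambda>c. Poly_Mapping.lookup c \<alpha>) p + Poly_Mapping.map (\<lambda>c. Poly_Mapping.lookup c \<alpha>) q"
      by (rule poly_mapping_eqI) (simp add: L lookup_add)
    with add show ?case by (simp add: ev_simps lookup_add)
  qed
  then have "ev v (coef \<alpha>) = 0" if "v \<in> V" for v \<alpha>
    using F(2)[OF that] by (simp add: coef_def)
  moreover have "coef \<alpha> \<in> forms d" for \<alpha>
    using F(1) unfolding forms_iff l by (metis lookup_zero)
  ultimately have "coef \<alpha> \<in> vanishing_ideal (proj_point ` V)" for \<alpha>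
    by (intro forms_in_vanishing_ideal[of _ d])
  moreover define S where "S = (\<Union>m\<in>Poly_Mapping.keys F. Poly_Mapping.keys (Poly_Mapping.lookup F m))"
  ultimately have "(\<Sum>\<alpha>\<in>S. cst (Poly_Mapping.single \<alpha> 1) * Poly_Mapping.map cst (coef \<alpha>))
      \<in> extend_ideal cst (vanishing_ideal (proj_point ` V))"
    unfolding extend_ideal_def by (intro ideal.span_sum ideal.span_scale ideal.span_base) blast
  moreover have "F = (\<Sum>\<alpha>\<in>S. cst (Poly_Mapping.single \<alpha> 1) * Poly_Mapping.map cst (coef \<alpha>))"
  proof (rule poly_mapping_eqI)
    fix m
    let ?c = "Poly_Mapping.lookup F m"
    have S: "finite S" "Poly_Mapping.keys ?c \<subseteq> S"
      by (auto simp: S_def) (metis in_keys_iff lookup_zero)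
    have "Poly_Mapping.lookup (\<Sum>\<alpha>\<in>S. cst (Poly_Mapping.single \<alpha> 1) * Poly_Mapping.map cst (coef \<alpha>)) m
        = (\<Sum>\<alpha>\<in>S. Poly_Mapping.single \<alpha> (Poly_Mapping.lookup ?c \<alpha>))"
      by (simp add: lookup_sum comm_hom.lookup_map_hom[OF comm_hom_cst] l) (simp add: cst_def mult_single)
    also have "\<dots> = ?c"
      using S by (intro poly_mapping_eqI) (auto simp: lookup_sum lookup_single when_def in_keys_iff)
    finally show "?c = Poly_Mapping.lookup (\<Sum>\<alpha>\<in>S. cst (Poly_Mapping.single \<alpha> 1) * Poly_Mapping.map cst (coef \<alpha>)) m" ..
  qed
  ultimately show ?thesis by simp
qed

lemma comm_hom_to_func_cst: "comm_hom (\<lambda>c. to_func (cst c))"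
  by (rule comm_hom_comp[OF comm_hom_to_func comm_hom_cst])

lemma eps_extend_ideal:
  "F \<in> extend_ideal cst I \<Longrightarrow> eps_Q F \<in> extend_ideal (\<lambda>c. to_func (cst c)) I"
  unfolding extend_ideal_def
proof (induction rule: ideal.span_induct_alt)
  case base
  show ?case by (simp add: eps_simps ideal.span_zero)
next
  case (step c x y)
  then obtain p where p: "p \<in> I" "x = Poly_Mapping.map cst p" by blast
  have "eps_Q x = Poly_Mapping.map (\<lambda>c. to_func (cst c)) p"
    by (rule poly_mapping_eqI)
      (simp add: p(2) comm_hom.lookup_map_hom[OF comm_hom_cst] comm_hom.lookup_map_hom[OF comm_hom_to_func_cst])
  then have "eps_Q x \<in> ideal.span (Poly_Mapping.map (\<lambda>c. to_func (cst c)) ` I)"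
    using p(1) by (intro ideal.span_base) blast
  then have "eps_Q c * eps_Q x + eps_Q y \<in> ideal.span (Poly_Mapping.map (\<lambda>c. to_func (cst c)) ` I)"
    using step(2) by (intro ideal.span_add ideal.span_scale)
  then show ?case by (simp only: eps_simps)
qed

lemma extend_func_vanishing_ideal:
  "extend_ideal (\<lambda>c. to_func (cst c)) (vanishing_ideal (proj_point ` V)) \<inter> forms d
     = {p \<in> forms d. \<forall>v\<in>V. ev (func_pt v) p = 0}"
proof (intro subset_antisym subsetI)
  fix p assume p: "p \<in> extend_ideal (\<lambda>c. to_func (cst c)) (vanishing_ideal (proj_point ` V)) \<inter> forms d"
  have "ev (func_pt v) p = 0" if "v \<in> V" for v
    using IntD1[OF p] unfolding extend_ideal_def
  proof (induction rule: ideal.span_induct_alt)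
    case (step c x y)
    then obtain q where q: "q \<in> vanishing_ideal (proj_point ` V)" "x = Poly_Mapping.map (\<lambda>c. to_func (cst c)) q"
      by blast
    have "func_pt v = (\<chi> i. to_func (cst (v $ i)))" by (simp add: func_pt_def const_pt_def)
    then have "ev (func_pt v) x = to_func (cst (ev v q))"
      using comm_hom.ev_map[OF comm_hom_to_func_cst, of v q] q(2) by simp
    also have "\<dots> = 0" using vanishing_ideal_ev[OF q(1) that] by simp
    finally show ?case using step(2) by (simp add: ev_simps)
  qed (simp add: ev_simps)
  with p show "p \<in> {p \<in> forms d. \<forall>v\<in>V. ev (func_pt v) p = 0}" by blast
next
  fix p assume p: "p \<in> {p \<in> forms d. \<forall>v\<in>V. ev (func_pt v) p = 0}"
  obtain c F where c: "c \<noteq> 0" and F: "cst (to_func c) * p = eps_Q F" using clear_denominators by blast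
  have "eps_Q F \<in> forms d" using p unfolding F[symmetric] by (auto intro: forms_cst_mult)
  then have f: "F \<in> forms d" by (simp add: eps_forms_iff)
  have "ev (const_pt v) F = 0" if "v \<in> V" for v
  proof -
    have "to_func (ev (const_pt v) F) = ev (func_pt v) (cst (to_func c) * p)" by (simp only: F ev_eps)
    also have "\<dots> = 0" using p that by (simp add: ev_simps)
    finally show ?thesis by simp
  qed
  then have "eps_Q F \<in> extend_ideal (\<lambda>c. to_func (cst c)) (vanishing_ideal (proj_point ` V))"
    by (intro eps_extend_ideal extend_cst_vanishing_ideal[OF f])
  then have "cst (inverse (to_func c)) * eps_Q F
      \<in> extend_ideal (\<lambda>c. to_func (cst c)) (vanishing_ideal (proj_point ` V))"
    unfolding extend_ideal_def by (rule ideal.span_scale)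
  moreover have "cst (inverse (to_func c)) * (cst (to_func c) * p) = p"
    using c by (simp add: cst_simps(4)[symmetric] flip: mult.assoc)
  ultimately show "p \<in> extend_ideal (\<lambda>c. to_func (cst c)) (vanishing_ideal (proj_point ` V)) \<inter> forms d"
    using p by (simp add: F)
qed

lemma Q_pt_nonzero: "Q_pt \<noteq> 0"
proof
  assume "Q_pt = 0"
  then have "to_func (var 0) = 0" by (simp add: Q_pt_def A_pt_def vec_eq_iff)
  then show False by (simp add: var_nonzero)
qed

lemma I_gg_Q_eq: "I_gg_Q (proj_point ` V) = pvs.span (\<Union>d. NN Q_pt (func_pt ` V) d)"
proof -
  have "extend_ideal (\<lambda>c. Fract (cst c) 1) (vanishing_ideal (proj_point ` V))
      \<inter> ideal_power (vanishing_ideal {generic_point}) (d - 1) \<inter> forms d = NN Q_pt (func_pt ` V) d" for d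
  proof -
    have "ideal_power (vanishing_ideal {generic_point}) (d - 1) \<inter> forms d = NN Q_pt {} d"
      unfolding generic_point_eq by (rule ideal_power_forms) (rule Q_pt_nonzero)
    moreover have "NN Q_pt (func_pt ` V) d = {p \<in> forms d. \<forall>v\<in>V. ev (func_pt v) p = 0} \<inter> NN Q_pt {} d"
      by (auto simp: NN_def)
    ultimately show ?thesis
      using extend_func_vanishing_ideal[of V d] unfolding to_func_def by blast
  qed
  then show ?thesis by (simp add: I_gg_Q_def)
qed

lemma F_Q_eq: "F_Q = {r. dd Q_pt r = 0}"
  unfolding F_Q_def generic_point_eq by (rule constants_generated) (rule Q_pt_nonzero)

lemma minimal_basis_free:
  fixes Q :: "'k::field_char_0 ^ 3"
  assumes "Q \<noteq> 0" and mb: "minimal_basis Q Z a b f g"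
  shows "free_on_two {r. dd Q r = 0} (pvs.span (\<Union>d. NN Q Z d)) f g"
proof -
  let ?M = "pvs.span (\<Union>d. NN Q Z d)"
  let ?R = "{r * f + s * g | r s. r \<in> {r. dd Q r = 0} \<and> s \<in> {r. dd Q r = 0}}"
  have "h \<in> ?R" if "h \<in> ?M" for h
    using that
  proof (induction rule: pvs.span_induct_alt)
    case base
    show ?case by (intro CollectI exI[of _ 0]) simp
  next
    case (step c x y)
    then obtain r s where y: "y = r * f + s * g" "dd Q r = 0" "dd Q s = 0" by blast
    from step obtain d where "x \<in> NN Q Z d" by blast
    with minimal_basis_generates[OF mb] obtain r' s' where
      x: "x = r' * f + s' * g" "r' \<in> GG Q a d" "s' \<in> GG Q b d" by blast
    then have x': "dd Q r' = 0" "dd Q s' = 0" by (auto simp: GG_def)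
    have "pscale c x + y = (cst c * r' + r) * f + (cst c * s' + s) * g"
      by (simp add: pscale_def x y algebra_simps)
    moreover have "dd Q (cst c * r' + r) = 0" "dd Q (cst c * s' + s) = 0" using x' y by simp_all
    ultimately show ?case by blast
  qed
  \<comment> \<open>The span is taken over the scalars only; closure under constants of
    \<open>dd Q\<close> is checked on the generators of their ring, which are scalars and linear
    forms.\<close>
  moreover have stable: "r * h \<in> ?M" if "dd Q r = 0" "h \<in> ?M" for r h
  proof -
    have "r \<in> generated_subring (range cst \<union> (vanishing_ideal {proj_point Q} \<inter> forms 1))"
      using that(1) constants_generated[OF assms(1)] by simp
    then have "\<forall>h\<in>?M. r * h \<in> ?M"
    proof induction
      case (base x)
      then show ?case
      proof
        assume "x \<in> range cst"
        then obtain c where "x = cst c" by blast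
        then show ?thesis using pvs.span_scale[of _ _ c] by (simp only: pscale_def[symmetric]) blast
      next
        assume "x \<in> vanishing_ideal {proj_point Q} \<inter> forms 1"
        then have x: "x \<in> forms 1" "dd Q x = 0"
          using constants_generated[OF assms(1)] by (auto intro: generated_subring.base)
        show ?thesis
        proof
          fix h assume "h \<in> ?M"
          then show "x * h \<in> ?M"
          proof (induction rule: pvs.span_induct_alt)
            case (step c y z)
            then obtain d where "y \<in> NN Q Z d" by blast
            then have "x * y \<in> NN Q Z (1 + d)" using x by (intro NN_mult)
            then have "pscale c (x * y) + x * z \<in> ?M"
              using step(2) by (intro pvs.span_add pvs.span_scale) (auto intro: pvs.span_base)
            moreover have "pscale c (x * y) + x * z = x * (pscale c y + z)"
              by (simp add: pscale_def algebra_simps)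
            ultimately show ?case by simp
          qed (simp add: pvs.span_zero)
        qed
      qed
    qed (simp_all add: left_diff_distrib pvs.span_diff mult.assoc)
    with that(2) show ?thesis by blast
  qed
  have "f \<in> ?M" "g \<in> ?M" using mb unfolding minimal_basis_def by (auto intro: pvs.span_base)
  then have "?R \<subseteq> ?M" using stable by (auto intro: pvs.span_add)
  ultimately have "?M = ?R" by blast
  then show ?thesis
    unfolding free_on_two_def using minimal_basis_independent[OF mb] by blast
qed

text \<open>Serves to exchange \<open>f\<close> for its scalar multiple that lifts.\<close>

lemma minimal_basis_scale:
  assumes mb: "minimal_basis Q Z a b f g" and c: "c \<noteq> 0"
  shows "minimal_basis Q Z a b (cst c * f) g"
  unfolding minimal_basis_def
proof (intro conjI allI ballI impI)
  fix d h assume "h \<in> NN Q Z d"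
  then obtain r s where rs: "r \<in> GG Q a d" "s \<in> GG Q b d" "h = r * f + s * g"
    using minimal_basis_generates[OF mb] by blast
  have "cst (inverse c) * r \<in> GG Q a d"
    using rs(1) by (auto simp: GG_def forms_cst_mult split: if_splits)
  moreover have "cst (inverse c) * cst c = 1" using c by (simp flip: cst_simps(4))
  then have "(cst (inverse c) * r) * (cst c * f) = r * f" by (simp add: mult_ac flip: mult.assoc)
  ultimately show "\<exists>r\<in>GG Q a d. \<exists>s\<in>GG Q b d. h = r * (cst c * f) + s * g"
    using rs by (intro bexI[of _ "cst (inverse c) * r"] bexI[of _ s]) simp_all
next
  fix r s assume *: "dd Q r = 0" "dd Q s = 0" "r * (cst c * f) + s * g = 0"
  then have "(cst c * r) * f + s * g = 0" by (simp add: mult_ac)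
  with * have "cst c * r = 0 \<and> s = 0"
    by (intro minimal_basis_independent[OF mb]) simp_all
  then show "r = 0" "s = 0" using c by simp_all
qed (use mb in \<open>simp_all add: minimal_basis_def NN_cst_mult\<close>)

section \<open>General position\<close>

lemma lin_nonzero:
  assumes "(c :: 'k::field ^ 3) \<noteq> 0"
  shows "lin c \<noteq> 0"
proof
  assume "lin c = 0"
  moreover obtain u where "dotp c u = 1" using exists_dotp_1 assms by blast
  ultimately show False using ev_lin[of u c] by (simp add: ev_simps)
qed

text \<open>Noncollinearity with two given points becomes the nonvanishing of a linear form at
  \<open>v\<close>, an open condition on \<open>v\<close>.\<close>

lemma dotp_crs_ev: "dotp (crs v x) y = ev v (lin (crs x y))"
  by (simp add: ev_lin dotp_crs_rotate[of x y v])

lemma dotp_crs_generic: "dotp (crs Q_pt (func_pt x)) (func_pt y) = to_func (lin (crs x y))"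
  by (simp add: dotp_def crs_def lin_def sum_3_from_0 Q_pt_def A_pt_def func_pt_def const_pt_def
      tf.simps cst_simps algebra_simps)

lemma crs_nonzero_of_dotp: "dotp (crs v x) y \<noteq> 0 \<Longrightarrow> crs v x \<noteq> 0"
  by (auto simp: dotp_def)

section \<open>The lifted generator\<close>

lemma generated_subring_zero: "0 \<in> generated_subring S"
  using generated_subring.diff[OF generated_subring.one generated_subring.one] by simp

lemma generated_subring_uminus: "x \<in> generated_subring S \<Longrightarrow> - x \<in> generated_subring S"
  using generated_subring.diff[OF generated_subring_zero] by fastforce

lemma generated_subring_add:
  "x \<in> generated_subring S \<Longrightarrow> y \<in> generated_subring S \<Longrightarrow> x + y \<in> generated_subring S"
  using generated_subring.diff[OF _ generated_subring_uminus] by fastforce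

text \<open>Exchanging the rows X and A changes all signs; the cofactor sign of the middle column
  changes that one back.\<close>

lemma minors_signed: "minors $ 0 = - signed_minor 0" "minors $ 1 = signed_minor 1" "minors $ 2 = - signed_minor 2"
proof -
  \<comment> \<open>\<open>det_3\<close> numbers the indices 1, 2, 3, where 3 is the index
    0.\<close>
  have "v $ (3 :: 3) = v $ 0" for v :: "biring ^ 3"
    by (rule arg_cong[where f = "($) v"]) simp
  then show "minors $ 0 = - signed_minor 0" "minors $ 1 = signed_minor 1" "minors $ 2 = - signed_minor 2"
    by (simp_all add: maximal_minor_def signed_minor_def det_3 axis_def mult.commute)
qed

lemma at_minors_generated:
  "at_minors p \<in> generated_subring (range (\<lambda>c. cst (cst c)) \<union> range signed_minor)" (is "_ \<in> ?G")
proof (induction p rule: poly3_induct)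
  case (cst c)
  then show ?case by (auto simp: comm_hom.poly_eval_cst[OF comm_hom_cst_cst] intro: generated_subring.base)
next
  case (var i)
  have "signed_minor j \<in> ?G" for j by (intro generated_subring.base) blast
  then have "minors $ i \<in> ?G"
    by (cases i rule: exhaust_3_from_0) (simp_all only: minors_signed generated_subring_uminus)
  then show ?case by (simp only: comm_hom.poly_eval_var[OF comm_hom_cst_cst])
next
  case (add p q)
  then show ?case by (simp only: at_minors_simps generated_subring_add)
next
  case (mult p q)
  then show ?case by (simp only: at_minors_simps generated_subring.mult)
qed

lemma lifted_generator:
  assumes mb: "minimal_basis Q_pt (func_pt ` V) a b f g" and gap: "a + 1 < b"
  shows "\<exists>F c. c \<noteq> 0 \<and> eps_Q F = cst c * f \<and> F \<in> BN V a \<and> F \<in> aforms (a - 1) \<and> DD F = 0 \<and> 1 \<le> a"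
proof -
  have multiple: "\<exists>r\<in>GG Q_pt a d. h = r * f" if h: "h \<in> NN Q_pt (func_pt ` V) d" and d: "d < b" for h d
  proof -
    obtain r s where rs: "r \<in> GG Q_pt a d" "s \<in> GG Q_pt b d" "h = r * f + s * g"
      using minimal_basis_generates[OF mb h] by blast
    with d have "s = 0" by (simp add: GG_def)
    with rs show ?thesis by auto
  qed
  have f: "f \<in> NN Q_pt (func_pt ` V) a" using mb by (simp add: minimal_basis_def)
  have "f \<noteq> 0" using minimal_basis_independent[OF mb, of 1 0] by auto
  obtain c0 F1 where F1: "c0 \<noteq> 0" "cst (to_func c0) * f = eps_Q F1" using clear_denominators by blast
  then have "F1 \<in> BN V a" using NN_cst_mult[OF f, of "to_func c0"] by (simp add: eps_NN_iff)
  moreover have "F1 \<noteq> 0" using F1 \<open>f \<noteq> 0\<close> by (auto simp: eps_simps)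
  ultimately obtain F e where F: "F \<in> BN V a" "F \<noteq> 0" "F \<in> aforms e"
    and prim: "\<And>\<pi>. prime_elem \<pi> \<Longrightarrow> \<not> cst \<pi> dvd F"
    using minimal_bihomogeneous by blast
  \<comment> \<open>In degree \<open>a\<close> the coefficient is a form of degree 0, so
    \<open>F\<close> is a scalar multiple of \<open>f\<close> over the function field.\<close>
  have "\<exists>r\<in>GG Q_pt a a. eps_Q F = r * f"
    using F(1) gap by (intro multiple) (simp_all add: eps_NN_iff)
  then obtain c where c: "eps_Q F = cst c * f" using forms_zero_conv by (auto simp: GG_def)
  with F(2) have "c \<noteq> 0" by (auto simp flip: eps_eq_0_iff)
  define k :: complex where "k = of_nat (e + 1) - of_nat a"
  have k: "(of_nat (e + 1) - of_nat a :: biring) = cst (cst k)"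
    by (simp add: k_def cst_simps)
  define H where "H = cst (var 0) * DD F - cst (cst k) * (var 0 * F)"
  have "H \<in> BN V (a + 1)"
    using corrected_DD_BN[OF F(1,3)] unfolding k H_def .
  then obtain r where r: "r \<in> GG Q_pt a (a + 1)" "eps_Q H = r * f"
    using multiple[of "eps_Q H" "a + 1"] gap by (auto simp: eps_NN_iff)
  have r0: "dd Q_pt r = 0" using r(1) by (simp add: GG_def)
  \<comment> \<open>\<open>L\<close> over \<open>q\<close> is the quotient of \<open>H\<close> by
    \<open>F\<close>. Clearing denominators keeps it a constant of the derivation, which settles the
    value of \<open>k\<close> below.\<close>
  obtain q L where qL: "q \<noteq> 0" "cst (to_func q) * (cst (inverse c) * r) = eps_Q L"
    using clear_denominators by blast
  have "eps_Q (dd A_pt L) = 0"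
    by (simp add: eps_dd qL(2)[symmetric] r0)
  then have L0: "dd A_pt L = 0" by (simp only: eps_eq_0_iff)
  have inv: "cst (inverse c) * cst c = 1"
    using \<open>c \<noteq> 0\<close> by (simp flip: cst_simps(4))
  have "eps_Q (L * F) = cst (to_func q) * ((cst (inverse c) * cst c) * (r * f))"
    by (simp only: eps_simps c qL(2)[symmetric] mult_ac)
  also have "\<dots> = eps_Q (cst q * H)"
    by (simp add: inv eps_simps r(2))
  finally have "L * F = cst q * H" by (simp only: eps_eq_iff)
  then have eq: "cst (q * var 0) * DD F = (L + cst q * (cst (cst k) * var 0)) * F"
    by (simp add: H_def cst_simps algebra_simps)
  have "F dvd DD F"
    by (intro gauss_dvd[OF prim _ eq]) (simp_all add: qL(1) var_nonzero)
  with F(3) have DF: "DD F = 0" by (rule DD_eq_0_of_dvd)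
  then have L: "L + cst q * (cst (cst k) * var 0) = 0" using eq F(2) by simp
  \<comment> \<open>With \<open>DD F = 0\<close>, \<open>L\<close> is a multiple of X_0 by a factor
    free of the X_i. Its derivative vanishes and that of X_0 is A_0, which forces
    \<open>k = 0\<close>.\<close>
  have "dd A_pt (L + cst q * (cst (cst k) * var 0)) = cst q * (cst (cst k) * cst (var 0))"
    by (simp add: L0) (simp add: A_pt_def)
  then have "cst q * (cst (cst k) * cst (var 0)) = (0 :: biring)" unfolding L by simp
  then have "k = 0" using qL(1) by (simp add: var_nonzero)
  then have "(of_nat (e + 1) :: complex) = of_nat a" by (simp add: k_def)
  then have "a = e + 1" by (simp only: of_nat_eq_iff)
  with F DF c \<open>c \<noteq> 0\<close> show ?thesis by auto
qed

theorem corollary6p10: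
  fixes Z :: "(complex^3) set set"
  assumes "Z \<subseteq> proj_plane"
    and "finite Z"
    and "\<exists>d. admits_unexpected_curves Z d"
  shows "\<exists>(f :: func poly3) (g :: func poly3) (a :: nat) (b :: nat) (F :: biring).
           f \<in> forms a \<and> g \<in> forms b \<and> a < b - 1 \<and>
           free_on_two F_Q (I_gg_Q Z) f g \<and>
           F \<in> I_gg Z \<and> eps_Q F = f \<and>
           (\<exists>h :: 3 \<Rightarrow> complex poly3.
              (\<forall>i. h i \<in> forms (a - 1)) \<and>
              f = eps_Q (\<Sum>i\<in>UNIV. var i *
                    poly_eval (\<lambda>c. cst (cst c)) (\<chi> j. maximal_minor A_vec X_vec j) (h i)))"
proof -
  obtain V where V: "finite V" "Z = proj_point ` V" "0 \<notin> V" "\<And>v w. v \<in> V \<Longrightarrow> w \<in> V \<Longrightarrow> v \<noteq> w \<Longrightarrow> crs v w \<noteq> 0"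
    using representatives[OF assms(1,2)] by blast
  \<comment> \<open>An auxiliary point for each \<open>x\<close>: a point off the line through
    \<open>x\<close> and \<open>w x\<close> differs from \<open>x\<close>, so this too is controlled
    by a linear form.\<close>
  have "\<forall>x\<in>V. \<exists>w. crs x w \<noteq> 0" using V(3) exists_crs_nonzero by metis
  then obtain w where w: "\<And>x. x \<in> V \<Longrightarrow> crs x (w x) \<noteq> 0" by metis
  obtain a b f g where ab: "a \<le> b" and mb: "minimal_basis Q_pt (func_pt ` V) a b f g"
  proof -
    have "\<exists>a b f g. a \<le> b \<and> minimal_basis Q_pt (func_pt ` V) a b f g"
    proof (rule exists_minimal_basis)
      fix x assume "x \<in> func_pt ` V"
      then obtain v where v: "v \<in> V" "x = func_pt v" by blast
      show "crs Q_pt x \<noteq> 0"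
        by (rule crs_nonzero_of_dotp[of _ _ "func_pt (w v)"])
          (simp add: v dotp_crs_generic lin_nonzero w)
    next
      fix x y assume "x \<in> func_pt ` V" "y \<in> func_pt ` V" "x \<noteq> y"
      then obtain v u where v: "v \<in> V" "u \<in> V" "v \<noteq> u" "x = func_pt v" "y = func_pt u" by blast
      show "dotp (crs Q_pt x) y \<noteq> 0"
        using lin_nonzero[OF V(4)[OF v(1-3)]] by (simp add: v(4,5) dotp_crs_generic)
    qed (use V(1) Q_pt_nonzero in auto)
    then show ?thesis using that by blast
  qed
  obtain N where N: "N \<noteq> 0"
    "\<And>v a' b' f' g'. ev v N \<noteq> 0 \<Longrightarrow> minimal_basis v V a' b' f' g' \<Longrightarrow> a' < a \<Longrightarrow> b < a"
    using generic_degree_le[OF mb V(1)] by blast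
  have gap: "a + 1 < b"
  proof -
    from assms(3) obtain d W where d: "zariski_closed W" "W \<noteq> proj_plane"
      and un: "\<And>P. P \<in> proj_plane - W \<Longrightarrow>
        int (pvs.dim (vanishing_ideal Z \<inter> ideal_power (vanishing_ideal {P}) (d - 1) \<inter> forms d))
       > max 0 (int (pvs.dim (vanishing_ideal Z \<inter> forms d))
                - int (quotient_dim (forms d)
                        (ideal_power (vanishing_ideal {P}) (d - 1) \<inter> forms d)))"
      unfolding admits_unexpected_curves_def for_general_point_def by blast
    obtain T where T: "\<forall>p\<in>T. \<exists>d. p \<in> forms d" "W = {P \<in> proj_plane. \<forall>p\<in>T. vanishes_at p P}"
      using d(1) unfolding zariski_closed_def by blast
    with d(2) obtain p v0 where p: "p \<in> T" "\<not> vanishes_at p (proj_point v0)"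
      unfolding proj_plane_def by blast
    then obtain k where pk: "p \<in> forms k" using T(1) by blast
    have "p \<noteq> 0"
      using p(2) vanishes_at_proj_point[OF forms_0, of v0] by (auto simp: ev_simps)
    \<comment> \<open>The product of all open conditions on \<open>v\<close>: outside
      \<open>W\<close> by \<open>p\<close>, good specialization by \<open>N\<close>, a nonzero
      vector by \<open>var 0\<close>, and general position with respect to \<open>V\<close> by the
      lines.\<close>
    define R where "R = p * N * var 0 * (\<Prod>x\<in>V. lin (crs x (w x)) * (\<Prod>y\<in>V - {x}. lin (crs x y)))"
    have "R \<noteq> 0"
      using \<open>p \<noteq> 0\<close> N(1) V(1,4) w by (auto simp: R_def lin_nonzero var_nonzero)
    then obtain v where "ev v R \<noteq> 0" using exists_nonzero_value unfolding ev_def by blast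
    then have v: "ev v p \<noteq> 0" "ev v N \<noteq> 0" "v $ 0 \<noteq> 0"
      "\<And>x. x \<in> V \<Longrightarrow> dotp (crs v x) (w x) \<noteq> 0"
      "\<And>x y. x \<in> V \<Longrightarrow> y \<in> V \<Longrightarrow> x \<noteq> y \<Longrightarrow> dotp (crs v x) y \<noteq> 0"
      using V(1) by (auto simp: R_def ev_simps dotp_crs_ev)
    then have "v \<noteq> 0" by auto
    then have "proj_point v \<in> proj_plane - W"
      using v(1) p(1) vanishes_at_proj_point[OF pk] by (auto simp: T(2) proj_plane_def)
    note unP = un[OF this]
    obtain a' b' f' g' where ab': "a' \<le> b'" and mb': "minimal_basis v V a' b' f' g'"
      using exists_minimal_basis[OF V(1) \<open>v \<noteq> 0\<close>] v(4,5) crs_nonzero_of_dotp by blast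
    have "a' \<le> d" "d + 1 < b'"
      using unexpected_degrees[OF \<open>v \<noteq> 0\<close> V(1) mb' ab'] unP unfolding V(2) by blast+
    \<comment> \<open>Otherwise \<open>N\<close> would give \<open>b < a\<close>, against the choice
      \<open>a \<le> b\<close>.\<close>
    moreover have "a \<le> a'" using N(2)[OF v(2) mb'] ab by fastforce
    moreover have "a + b = card V + 1" "a' + b' = card V + 1"
      using mb mb' card_image[OF inj_on_subset[OF inj_func_pt], of V] by (simp_all add: minimal_basis_def)
    ultimately show ?thesis by linarith
  qed
  obtain F c where F: "c \<noteq> 0" "eps_Q F = cst c * f" "F \<in> BN V a" "F \<in> aforms (a - 1)" "DD F = 0" "1 \<le> a"
    using lifted_generator[OF mb gap] by blast
  have mbF: "minimal_basis Q_pt (func_pt ` V) a b (eps_Q F) g"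
    unfolding F(2) by (rule minimal_basis_scale[OF mb F(1)])
  have "F \<in> forms (a - 1 + 1)" using F(3,6) by (simp add: BN_def)
  then obtain h where h: "\<And>i. h i \<in> forms (a - 1)" "F = (\<Sum>i\<in>UNIV. var i * at_minors (h i))"
    using kernel_of_DD[OF _ F(4,5)] by blast
  have "F \<in> m_gg"
    unfolding m_gg_def
    by (intro CollectI exI[of _ "\<lambda>i. at_minors (h i)"] conjI allI at_minors_generated, subst h(2))
      (simp only: mult.commute)
  moreover have "F \<in> extend_ideal cst (vanishing_ideal Z)"
    unfolding V(2) using F(3) by (intro extend_cst_vanishing_ideal) (auto simp: BN_def)
  ultimately have "F \<in> I_gg Z" by (simp add: I_gg_def)
  moreover have "free_on_two F_Q (I_gg_Q Z) (eps_Q F) g"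
    unfolding F_Q_eq V(2) I_gg_Q_eq by (rule minimal_basis_free[OF Q_pt_nonzero mbF])
  moreover have "eps_Q F \<in> forms a" "g \<in> forms b"
    using mbF by (auto simp: minimal_basis_def NN_def)
  moreover have "a < b - 1" using gap by simp
  ultimately show ?thesis
    using h by (intro exI[of _ "eps_Q F"] exI[of _ g] exI[of _ a] exI[of _ b] exI[of _ F] conjI exI[of _ h]) auto
qed

end
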